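(* Let $f:X_\bullet\to Y_\bullet$ be a map of simplicial topological spaces, or of semi-simplicial topological spaces, such that $f_n:X_n\to Y_n$ is a weak homotopy equivalence for every $n$. Then the induced map $\|X\|\to\|Y\|$ on fat geometric realizations is a weak homotopy equivalence.
   Context: $\mathrm{Top}$ is the category of all topological spaces (no separation assumptions). $\Delta_+$ is the category of non-empty finite ordinals and injective order-preserving maps; a semi-simplicial space is a functor $Y_\bullet:\Delta_+^{op}\to\mathrm{Top}$. The fat geometric realization of a semi-simplicial space $Y_\bullet$ is the coend $\|Y\|=\int^{n\in\Delta_+}Y_n\times\Delta^n$. The fat geometric realization $\|X\|$ of a simplicial space $X_\bullet:\Delta^{op}\to\mathrm{Top}$ is that of its restriction along $\Delta_+\to\Delta$ (i.e. one quotients $\coprod_n X_n\times\Delta^n$ only by the relations coming from face maps, not degeneracies). *)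

theory Defs
  imports "HOL-Homology.Simplices"
begin

section \<open>Quotient spaces and induced maps on quotients\<close>

definition quotient_topology :: "'a topology \<Rightarrow> ('a \<times> 'a) set \<Rightarrow> 'a set topology" where
  "quotient_topology X R =
     topology (\<lambda>\<U>. \<U> \<subseteq> topspace X // R \<and> openin X {x \<in> topspace X. R `` {x} \<in> \<U>})"

lemma istopology_quotient_topology:
  "istopology (\<lambda>\<U>. \<U> \<subseteq> topspace X // R \<and> openin X {x \<in> topspace X. R `` {x} \<in> \<U>})"
proof -
  have Int: "{x \<in> topspace X. R `` {x} \<in> S \<inter> T} =
      {x \<in> topspace X. R `` {x} \<in> S} \<inter> {x \<in> topspace X. R `` {x} \<in> T}" for S T
    by blast
  have Un: "{x \<in> topspace X. R `` {x} \<in> \<Union>\<K>} = (\<Union>K\<in>\<K>. {x \<in> topspace X. R `` {x} \<in> K})" for \<K>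
    by blast
  show ?thesis
    unfolding istopology_def Int Un by (auto intro!: openin_Int openin_Union)
qed

lemma openin_quotient_topology:
  "openin (quotient_topology X R) \<U> \<longleftrightarrow>
     \<U> \<subseteq> topspace X // R \<and> openin X {x \<in> topspace X. R `` {x} \<in> \<U>}"
  unfolding quotient_topology_def
  by (simp add: topology_inverse'[OF istopology_quotient_topology])

lemma topspace_quotient_topology: "topspace (quotient_topology X R) = topspace X // R"
proof
  show "topspace (quotient_topology X R) \<subseteq> topspace X // R"
    by (metis openin_quotient_topology openin_topspace)
  have "{x \<in> topspace X. R `` {x} \<in> topspace X // R} = topspace X"
    by (auto intro: quotientI)
  then have "openin (quotient_topology X R) (topspace X // R)"
    by (simp add: openin_quotient_topology)
  then show "topspace X // R \<subseteq> topspace (quotient_topology X R)"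
    by (rule openin_subset)
qed

lemma quotient_map_quotient_topology:
  "quotient_map X (quotient_topology X R) (\<lambda>x. R `` {x})"
  unfolding quotient_map_def topspace_quotient_topology openin_quotient_topology
  by (auto simp: quotient_def)

text \<open>If \<open>h\<close> carries \<open>R\<close>-related points to points related by the equivalence relation \<open>R'\<close>,
  then this sends the \<open>R\<close>-class of \<open>x\<close> to the \<open>R'\<close>-class of \<open>h x\<close>.\<close>

definition quotient_induced :: "('b \<times> 'b) set \<Rightarrow> ('a \<Rightarrow> 'b) \<Rightarrow> 'a set \<Rightarrow> 'b set" where
  "quotient_induced R' h c = R' `` (h ` c)"

lemma quotient_induced_class:
  assumes "equiv A R" "equiv B R'" "x \<in> A"
    and "\<And>y z. (y, z) \<in> R \<Longrightarrow> (h y, h z) \<in> R'"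
  shows "quotient_induced R' h (R `` {x}) = R' `` {h x}"
proof -
  have "(x, x) \<in> R"
    using assms(1,3) by (simp add: equiv_def refl_on_def)
  moreover have "R' `` {h y} = R' `` {h x}" if "(x, y) \<in> R" for y
    using equiv_class_eq[OF assms(2) assms(4)[OF that]] by simp
  ultimately show ?thesis
    unfolding quotient_induced_def by blast
qed

section \<open>Weak homotopy equivalences\<close>

definition cube :: "nat \<Rightarrow> (nat \<Rightarrow> real) topology" where
  "cube n = product_topology (\<lambda>_. top_of_set {0..1}) {..<n}"

definition cube_boundary :: "nat \<Rightarrow> (nat \<Rightarrow> real) set" where
  "cube_boundary n = {t \<in> topspace (cube n). \<exists>i<n. t i = 0 \<or> t i = 1}"

definition based_cubes :: "nat \<Rightarrow> 'a topology \<Rightarrow> 'a \<Rightarrow> ((nat \<Rightarrow> real) \<Rightarrow> 'a) set" where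
  "based_cubes n X x = {g. continuous_map (cube n) X g \<and> g ` cube_boundary n \<subseteq> {x}}"

definition based_homotopy ::
    "nat \<Rightarrow> 'a topology \<Rightarrow> 'a \<Rightarrow> (((nat \<Rightarrow> real) \<Rightarrow> 'a) \<times> ((nat \<Rightarrow> real) \<Rightarrow> 'a)) set" where
  "based_homotopy n X x =
     {(g, h). homotopic_with (\<lambda>k. k ` cube_boundary n \<subseteq> {x}) (cube n) X g h}"

text \<open>The underlying set of the \<open>n\<close>-th homotopy group, as homotopy classes of maps of pairs
  \<open>(I\<^sup>n, \<partial>I\<^sup>n) \<rightarrow> (X, x)\<close>.\<close>

definition homotopy_group :: "nat \<Rightarrow> 'a topology \<Rightarrow> 'a \<Rightarrow> ((nat \<Rightarrow> real) \<Rightarrow> 'a) set set" where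
  "homotopy_group n X x = based_cubes n X x // based_homotopy n X x"

definition path_component_rel :: "'a topology \<Rightarrow> ('a \<times> 'a) set" where
  "path_component_rel X = {(x, y). path_component_of X x y}"

text \<open>The map induced on homotopy groups is always a homomorphism, so for \<open>n \<ge> 1\<close> it is an
  isomorphism iff it is bijective. The separate clause on path components also covers the case of
  empty \<open>X\<close>, where there are no base points.\<close>

definition weak_homotopy_equivalence :: "'a topology \<Rightarrow> 'b topology \<Rightarrow> ('a \<Rightarrow> 'b) \<Rightarrow> bool" where
  "weak_homotopy_equivalence X Y f \<longleftrightarrow>
     continuous_map X Y f \<and>
     bij_betw (quotient_induced (path_component_rel Y) f)
       (path_components_of X) (path_components_of Y) \<and>
     (\<forall>n\<ge>1. \<forall>x\<in>topspace X.
        bij_betw (quotient_induced (based_homotopy n Y (f x)) (\<lambda>g. f \<circ> g))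
          (homotopy_group n X x) (homotopy_group n Y (f x)))"

section \<open>Simplicial and semi-simplicial spaces\<close>

text \<open>The object \<open>[n]\<close> is \<open>{..n}\<close>. Morphisms are extensional functions, so that equality of
  morphisms is equality of functions.\<close>

definition Delta_hom :: "nat \<Rightarrow> nat \<Rightarrow> (nat \<Rightarrow> nat) set" where
  "Delta_hom m n = {\<theta> \<in> {..m} \<rightarrow>\<^sub>E {..n}. mono_on {..m} \<theta>}"

definition Delta_plus_hom :: "nat \<Rightarrow> nat \<Rightarrow> (nat \<Rightarrow> nat) set" where
  "Delta_plus_hom m n = {\<theta> \<in> Delta_hom m n. inj_on \<theta> {..m}}"

text \<open>Data of a contravariant functor to topological spaces: \<open>act X m n \<theta> : X\<^sub>n \<rightarrow> X\<^sub>m\<close> is the map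
  induced by \<open>\<theta> : [m] \<rightarrow> [n]\<close>. All levels have the same carrier type, but their underlying sets
  are arbitrary subsets of it.\<close>

record 'a space_diagram =
  level :: "nat \<Rightarrow> 'a topology"
  act :: "nat \<Rightarrow> nat \<Rightarrow> (nat \<Rightarrow> nat) \<Rightarrow> 'a \<Rightarrow> 'a"

definition contravariant_functor ::
    "(nat \<Rightarrow> nat \<Rightarrow> (nat \<Rightarrow> nat) set) \<Rightarrow> 'a space_diagram \<Rightarrow> bool" where
  "contravariant_functor Mor X \<longleftrightarrow>
     (\<forall>m n. \<forall>\<theta>\<in>Mor m n. continuous_map (level X n) (level X m) (act X m n \<theta>)) \<and>
     (\<forall>n. \<forall>x\<in>topspace (level X n). act X n n (restrict id {..n}) x = x) \<and>
     (\<forall>l m n. \<forall>\<phi>\<in>Mor l m. \<forall>\<theta>\<in>Mor m n. \<forall>x\<in>topspace (level X n).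
        act X l n (compose {..l} \<theta> \<phi>) x = act X l m \<phi> (act X m n \<theta> x))"

definition natural_map ::
    "(nat \<Rightarrow> nat \<Rightarrow> (nat \<Rightarrow> nat) set) \<Rightarrow> 'a space_diagram \<Rightarrow> 'b space_diagram \<Rightarrow> (nat \<Rightarrow> 'a \<Rightarrow> 'b) \<Rightarrow> bool"
  where
  "natural_map Mor X Y f \<longleftrightarrow>
     (\<forall>n. continuous_map (level X n) (level Y n) (f n)) \<and>
     (\<forall>m n. \<forall>\<theta>\<in>Mor m n. \<forall>x\<in>topspace (level X n).
        f m (act X m n \<theta> x) = act Y m n \<theta> (f n x))"

definition simplicial_space :: "'a space_diagram \<Rightarrow> bool" where
  "simplicial_space X \<longleftrightarrow> contravariant_functor Delta_hom X"

definition semi_simplicial_space :: "'a space_diagram \<Rightarrow> bool" where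
  "semi_simplicial_space X \<longleftrightarrow> contravariant_functor Delta_plus_hom X"

definition simplicial_map ::
    "'a space_diagram \<Rightarrow> 'b space_diagram \<Rightarrow> (nat \<Rightarrow> 'a \<Rightarrow> 'b) \<Rightarrow> bool" where
  "simplicial_map X Y f \<longleftrightarrow> simplicial_space X \<and> simplicial_space Y \<and> natural_map Delta_hom X Y f"

definition semi_simplicial_map ::
    "'a space_diagram \<Rightarrow> 'b space_diagram \<Rightarrow> (nat \<Rightarrow> 'a \<Rightarrow> 'b) \<Rightarrow> bool" where
  "semi_simplicial_map X Y f \<longleftrightarrow>
     semi_simplicial_space X \<and> semi_simplicial_space Y \<and> natural_map Delta_plus_hom X Y f"

definition restrict_to_Delta_plus :: "'a space_diagram \<Rightarrow> 'a space_diagram" where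
  "restrict_to_Delta_plus X =
     \<lparr>level = level X, act = (\<lambda>m n. restrict (act X m n) (Delta_plus_hom m n))\<rparr>"

section \<open>Fat geometric realization\<close>

definition simplex_space :: "nat \<Rightarrow> (nat \<Rightarrow> real) topology" where
  "simplex_space n = subtopology (powertop_real UNIV) (standard_simplex n)"

definition simplex_push :: "nat \<Rightarrow> (nat \<Rightarrow> nat) \<Rightarrow> (nat \<Rightarrow> real) \<Rightarrow> (nat \<Rightarrow> real)" where
  "simplex_push m \<theta> t = (\<lambda>j. \<Sum>i | i \<le> m \<and> \<theta> i = j. t i)"

definition realization_sum :: "'a space_diagram \<Rightarrow> (nat \<times> 'a \<times> (nat \<Rightarrow> real)) topology" where
  "realization_sum X = sum_topology (\<lambda>n. prod_topology (level X n) (simplex_space n)) UNIV"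

definition realization_gluing ::
    "'a space_diagram \<Rightarrow> ((nat \<times> 'a \<times> (nat \<Rightarrow> real)) \<times> (nat \<times> 'a \<times> (nat \<Rightarrow> real))) set" where
  "realization_gluing X =
     {((m, act X m n \<theta> x, t), (n, x, simplex_push m \<theta> t)) | m n \<theta> x t.
        \<theta> \<in> Delta_plus_hom m n \<and> x \<in> topspace (level X n) \<and> t \<in> standard_simplex m}"

text \<open>The equivalence relation on the disjoint union generated by the gluing relations.\<close>

definition realization_rel ::
    "'a space_diagram \<Rightarrow> ((nat \<times> 'a \<times> (nat \<Rightarrow> real)) \<times> (nat \<times> 'a \<times> (nat \<Rightarrow> real))) set" where
  "realization_rel X =
     (realization_gluing X \<union> (realization_gluing X)\<inverse>)\<^sup>* \<inter>
     (topspace (realization_sum X) \<times> topspace (realization_sum X))"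

lemma equiv_realization_rel: "equiv (topspace (realization_sum X)) (realization_rel X)"
proof (rule equivI)
  show "sym (realization_rel X)"
    unfolding realization_rel_def
    by (intro sym_Int sym_rtrancl) (auto simp: sym_def)
  show "trans (realization_rel X)"
    unfolding realization_rel_def by (auto simp: trans_def intro: rtrancl_trans)
qed (auto simp: realization_rel_def refl_on_def)

definition fat_realization :: "'a space_diagram \<Rightarrow> (nat \<times> 'a \<times> (nat \<Rightarrow> real)) set topology" where
  "fat_realization X = quotient_topology (realization_sum X) (realization_rel X)"

definition fat_realization_map ::
    "'b space_diagram \<Rightarrow> (nat \<Rightarrow> 'a \<Rightarrow> 'b) \<Rightarrow>
     (nat \<times> 'a \<times> (nat \<Rightarrow> real)) set \<Rightarrow> (nat \<times> 'b \<times> (nat \<Rightarrow> real)) set" where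
  "fat_realization_map Y f =
     quotient_induced (realization_rel Y) (\<lambda>(n, x, t). (n, f n x, t))"

end

theory Submission
  imports Defs "HOL-Analysis.Abstract_Topological_Spaces"
begin

text \<open>
  A map is a weak homotopy equivalence iff every lifting problem for it on a pair \<open>(I\<^sup>n, \<partial>I\<^sup>n)\<close> can be
  solved up to a homotopy extending the one given on the boundary. By induction over the cells of a fine
  grid, this property is local on the target: it suffices to check it over all finite intersections of
  the members of some open cover.

  Cover \<open>\<parallel>Y\<parallel>\<close> by the open sets \<open>V\<^sub>k\<close> of all points whose \<open>k + 1\<close> largest barycentric coordinates are
  strictly larger than the remaining ones. They are the stars of the barycentres of the \<open>k\<close>-simplices in
  the barycentric subdivision. If \<open>m\<close> is the largest element of \<open>S\<close>, the intersection of the \<open>V\<^sub>k\<close> with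
  \<open>k \<in> S\<close> is a disjoint union of open pieces, one for each flag of faces of \<open>[m]\<close> with dimensions in
  \<open>S\<close>. Every piece contracts linearly, and naturally in \<open>Y\<close>, onto a copy of \<open>Y\<^sub>m\<close>, where the lifting
  property holds by assumption. In this way neither pushouts nor colimits along skeleta are needed.
\<close>

section \<open>Lifting problems and homotopy extension\<close>

text \<open>Lifting problems replace homotopy groups because they mention neither base points nor
  path components, treat injectivity and surjectivity at once and can be restricted to small cells.
  Letting the square commute only up to a given homotopy makes solvability invariant under
  deformation, so a problem can be moved to where it is easy. The obstacle is the target: the levels
  are arbitrary spaces and the realization is a quotient, about whose closed pieces little is known.
  Over open sets, however, the quotient map restricts to a quotient map, and the product with the
  interval preserves quotient maps. Fatness enters through the sets V_k: a face inclusion only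
  inserts zero coordinates, so comparisons between coordinates survive the gluing, whereas a
  degeneracy would add coordinates up. Flags appear because the V_k overlap: a point in several of
  them has nested dominant faces, of which the largest names the level and the smaller ones must
  stay dominant during the contraction.\<close>

abbreviation continuous_to :: "'k::topological_space set \<Rightarrow> 'a topology \<Rightarrow> ('k \<Rightarrow> 'a) \<Rightarrow> bool" where
  "continuous_to S X g \<equiv> continuous_map (top_of_set S) X g"

abbreviation unit_interval :: "real set" ("\<I>") where
  "\<I> \<equiv> {0..1}"

lemma continuous_to_compose:
  assumes "continuous_to S X g" "continuous_on T \<phi>" "\<phi> ` T \<subseteq> S"
  shows "continuous_to T X (\<lambda>x. g (\<phi> x))"
proof -
  have "continuous_map (top_of_set T) (top_of_set S) \<phi>"
    using assms(2,3) by (auto simp: continuous_map_in_subtopology)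
  from continuous_map_compose[OF this assms(1)] show ?thesis
    by (simp add: o_def)
qed

lemma continuous_to_subset:
  "continuous_to S X g \<Longrightarrow> T \<subseteq> S \<Longrightarrow> continuous_to T X g"
  by (rule continuous_map_from_subtopology_mono)

lemma continuous_to_map:
  "continuous_to S X g \<Longrightarrow> continuous_map X Y f \<Longrightarrow> continuous_to S Y (\<lambda>x. f (g x))"
  using continuous_map_compose[of _ X g Y f] by (simp add: o_def)

lemma continuous_to_mem:
  "continuous_to S X g \<Longrightarrow> x \<in> S \<Longrightarrow> g x \<in> topspace X"
  using continuous_map_funspace by fastforce

text \<open>Finite closed pasting in which every map is given on its own piece with the subspace
  topology of the ambient type, the form in which data on cells and on faces of cylinders
  arise.\<close>

lemma continuous_to_paste:
  assumes "finite N" "S = (\<Union>i\<in>N. T i)"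
    and "\<And>i. i \<in> N \<Longrightarrow> closedin (top_of_set S) (T i)"
    and "\<And>i. i \<in> N \<Longrightarrow> continuous_to (T i) X (g i)"
    and "\<And>i j x. i \<in> N \<Longrightarrow> j \<in> N \<Longrightarrow> x \<in> T i \<Longrightarrow> x \<in> T j \<Longrightarrow> g i x = g j x"
  obtains h where "continuous_to S X h" "\<And>i x. i \<in> N \<Longrightarrow> x \<in> T i \<Longrightarrow> h x = g i x"
proof -
  have "subtopology (top_of_set S) (T i) = top_of_set (T i)" if "i \<in> N" for i
  proof -
    have "S \<inter> T i = T i"
      using assms(2) that by blast
    then show ?thesis
      by (simp add: subtopology_subtopology)
  qed
  then have "continuous_map (subtopology (top_of_set S) (T i)) X (g i)" if "i \<in> N" for i
    using assms(4) that by metis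
  moreover have "topspace (top_of_set S) \<subseteq> \<Union> (T ` N)"
    unfolding assms(2) by simp
  ultimately obtain h where "continuous_to S X h"
      and h: "\<And>x i. \<lbrakk>i \<in> N; x \<in> topspace (top_of_set S) \<inter> T i\<rbrakk> \<Longrightarrow> h x = g i x"
    using pasting_lemma_exists_closed[of N "top_of_set S" T X g, OF assms(1) _ assms(3)] assms(5)
    by (metis IntE)
  moreover have "T i \<subseteq> topspace (top_of_set S)" if "i \<in> N" for i
    unfolding assms(2) using that by auto
  ultimately show ?thesis
    using that by (meson IntI subsetD)
qed

lemma continuous_to_paste2:
  assumes "closedin (top_of_set (S \<union> T)) S" "closedin (top_of_set (S \<union> T)) T"
    and "continuous_to S X g" "continuous_to T X g'"
    and "\<And>x. x \<in> S \<Longrightarrow> x \<in> T \<Longrightarrow> g x = g' x"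
  obtains h where "continuous_to (S \<union> T) X h" "\<And>x. x \<in> S \<Longrightarrow> h x = g x" "\<And>x. x \<in> T \<Longrightarrow> h x = g' x"
proof -
  obtain h where "continuous_to (S \<union> T) X h"
    and "\<And>i x. i \<in> UNIV \<Longrightarrow> x \<in> (if i then S else T) \<Longrightarrow> h x = (if i then g else g') x"
    by (rule continuous_to_paste[of UNIV "S \<union> T" "\<lambda>i. if i then S else T" X "\<lambda>i. if i then g else g'"])
       (use assms in \<open>auto simp: UNIV_bool split: if_splits\<close>)
  from this(1) this(2)[of True] this(2)[of False] show ?thesis
    using that by auto
qed

text \<open>Homotopy extension against all targets would quantify over types, which a definition
  cannot do; a retraction of the cylinder onto its bottom and side encodes it. Closedness of
  \<open>A\<close> permits pasting along bottom and side.\<close>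

definition cofibered_pair :: "'k::topological_space set \<Rightarrow> 'k set \<Rightarrow> bool" where
  "cofibered_pair K A \<longleftrightarrow> A \<subseteq> K \<and> closedin (top_of_set K) A \<and>
     (\<exists>r. continuous_on (\<I> \<times> K) r \<and> r ` (\<I> \<times> K) \<subseteq> ({0} \<times> K) \<union> (\<I> \<times> A) \<and>
        (\<forall>x\<in>K. r (0, x) = (0, x)) \<and> (\<forall>t\<in>\<I>. \<forall>a\<in>A. r (t, a) = (t, a)))"

text \<open>\<open>g\<close> on the bottom and \<open>h\<close> on the side paste to one map, and
  the retraction of the cylinder pulls it back to all of \<open>\<I> \<times> K\<close>.\<close>

lemma homotopy_extension:
  assumes cof: "cofibered_pair K A"
    and g: "continuous_to K X g" and h: "continuous_to (\<I> \<times> A) X h"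
    and agree: "\<And>a. a \<in> A \<Longrightarrow> h (0, a) = g a"
  obtains G where "continuous_to (\<I> \<times> K) X G" "\<And>x. x \<in> K \<Longrightarrow> G (0, x) = g x"
    "\<And>t a. t \<in> \<I> \<Longrightarrow> a \<in> A \<Longrightarrow> G (t, a) = h (t, a)"
proof -
  obtain r where A: "A \<subseteq> K" "closedin (top_of_set K) A"
    and r: "continuous_on (\<I> \<times> K) r" "r ` (\<I> \<times> K) \<subseteq> ({0} \<times> K) \<union> (\<I> \<times> A)"
      "\<And>x. x \<in> K \<Longrightarrow> r (0, x) = (0, x)" "\<And>t a. t \<in> \<I> \<Longrightarrow> a \<in> A \<Longrightarrow> r (t, a) = (t, a)"
    using cof unfolding cofibered_pair_def by blast
  let ?L = "({0} \<times> K) \<union> (\<I> \<times> A)"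
  have sub: "?L \<subseteq> \<I> \<times> K"
    using A by auto
  have "closedin (top_of_set (\<I> \<times> K)) ({0} \<times> K)" "closedin (top_of_set (\<I> \<times> K)) (\<I> \<times> A)"
    using A(2) by (auto intro!: closedin_Times simp: closedin_closed_eq)
  then have "closedin (top_of_set ?L) ({0} \<times> K)" "closedin (top_of_set ?L) (\<I> \<times> A)"
    using sub by (auto intro: closedin_subset_trans)
  moreover have "continuous_to ({0} \<times> K) X (\<lambda>z. g (snd z))"
    by (rule continuous_to_compose[OF g]) (auto intro!: continuous_intros)
  ultimately obtain k where k: "continuous_to ?L X k" "\<And>z. z \<in> {0} \<times> K \<Longrightarrow> k z = g (snd z)"
      "\<And>z. z \<in> \<I> \<times> A \<Longrightarrow> k z = h z"
    by (rule continuous_to_paste2[OF _ _ _ h]) (use agree in auto)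
  show ?thesis
  proof
    show "continuous_to (\<I> \<times> K) X (\<lambda>z. k (r z))"
      by (rule continuous_to_compose[OF k(1) r(1,2)])
  qed (use r k in auto)
qed

lemma homotopy_extension_reverse:
  assumes cof: "cofibered_pair K A"
    and g: "continuous_to K X g" and h: "continuous_to (\<I> \<times> A) X h"
    and agree: "\<And>a. a \<in> A \<Longrightarrow> h (1, a) = g a"
  obtains G where "continuous_to (\<I> \<times> K) X G" "\<And>x. x \<in> K \<Longrightarrow> G (1, x) = g x"
    "\<And>t a. t \<in> \<I> \<Longrightarrow> a \<in> A \<Longrightarrow> G (t, a) = h (t, a)"
proof -
  have "continuous_to (\<I> \<times> A) X (\<lambda>z. h (1 - fst z, snd z))"
    by (rule continuous_to_compose[OF h]) (auto intro!: continuous_intros)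
  then obtain G where G: "continuous_to (\<I> \<times> K) X G" "\<And>x. x \<in> K \<Longrightarrow> G (0, x) = g x"
    "\<And>t a. t \<in> \<I> \<Longrightarrow> a \<in> A \<Longrightarrow> G (t, a) = h (1 - t, a)"
    by (rule homotopy_extension[OF cof g]) (use agree in auto)
  show ?thesis
  proof
    show "continuous_to (\<I> \<times> K) X (\<lambda>z. G (1 - fst z, snd z))"
      by (rule continuous_to_compose[OF G(1)]) (auto intro!: continuous_intros)
  qed (use G in auto)
qed

text \<open>The square from \<open>A\<close> and \<open>K\<close> to \<open>f\<close> commutes only
  up to \<open>h\<close>, which runs from \<open>f\<close> after \<open>u\<close> at time 0 to
  \<open>v\<close> at time 1. A solution extends the lift and the homotopy together. Strict problems
  are those with constant \<open>h\<close>; the relaxed form is the one that survives deformation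
  and cell-by-cell extension.\<close>

definition lift_solution ::
  "('a \<Rightarrow> 'b) \<Rightarrow> 'a topology \<Rightarrow> 'b topology \<Rightarrow> 'k::topological_space set \<Rightarrow> 'k set \<Rightarrow>
     ('k \<Rightarrow> 'a) \<Rightarrow> (real \<times> 'k \<Rightarrow> 'b) \<Rightarrow> ('k \<Rightarrow> 'b) \<Rightarrow> bool" where
  "lift_solution f X Y K A u h v \<longleftrightarrow>
     (\<exists>u' h'. continuous_to K X u' \<and> continuous_to (\<I> \<times> K) Y h' \<and>
        (\<forall>a\<in>A. u' a = u a) \<and> (\<forall>t\<in>\<I>. \<forall>a\<in>A. h' (t, a) = h (t, a)) \<and>
        (\<forall>x\<in>K. h' (0, x) = f (u' x) \<and> h' (1, x) = v x))"

definition lift_problem ::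
  "('a \<Rightarrow> 'b) \<Rightarrow> 'a topology \<Rightarrow> 'b topology \<Rightarrow> 'k::topological_space set \<Rightarrow> 'k set \<Rightarrow>
     ('k \<Rightarrow> 'a) \<Rightarrow> (real \<times> 'k \<Rightarrow> 'b) \<Rightarrow> ('k \<Rightarrow> 'b) \<Rightarrow> bool" where
  "lift_problem f X Y K A u h v \<longleftrightarrow>
     continuous_to A X u \<and> continuous_to (\<I> \<times> A) Y h \<and> continuous_to K Y v \<and>
     (\<forall>a\<in>A. h (0, a) = f (u a) \<and> h (1, a) = v a)"

definition has_lifts ::
  "('a \<Rightarrow> 'b) \<Rightarrow> 'a topology \<Rightarrow> 'b topology \<Rightarrow> 'k::topological_space set \<Rightarrow> 'k set \<Rightarrow> bool" where
  "has_lifts f X Y K A \<longleftrightarrow>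
     (\<forall>u h v. lift_problem f X Y K A u h v \<longrightarrow> lift_solution f X Y K A u h v)"

text \<open>One composite being the identity suffices, since this makes the pair
  \<open>(K', A')\<close> a retract of \<open>(K, A)\<close>: pull the problem back along
  \<open>\<phi>\<close>, solve it and restrict the solution along \<open>\<psi>\<close>.\<close>

lemma has_lifts_homeomorphic:
  assumes L: "has_lifts f X Y K A"
    and \<phi>: "continuous_on K \<phi>" "\<phi> ` K \<subseteq> K'" "\<phi> ` A \<subseteq> A'"
    and \<psi>: "continuous_on K' \<psi>" "\<psi> ` K' \<subseteq> K" "\<psi> ` A' \<subseteq> A"
    and inv: "\<And>x. x \<in> K' \<Longrightarrow> \<phi> (\<psi> x) = x"
    and sub: "A \<subseteq> K" "A' \<subseteq> K'"
  shows "has_lifts f X Y K' A'"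
  unfolding has_lifts_def
proof (intro allI impI)
  fix u h v assume "lift_problem f X Y K' A' u h v"
  then have u: "continuous_to A' X u" and h: "continuous_to (\<I> \<times> A') Y h" and v: "continuous_to K' Y v"
    and e: "\<And>a. a \<in> A' \<Longrightarrow> h (0, a) = f (u a) \<and> h (1, a) = v a"
    by (auto simp: lift_problem_def)
  have "lift_problem f X Y K A (\<lambda>x. u (\<phi> x)) (\<lambda>z. h (fst z, \<phi> (snd z))) (\<lambda>x. v (\<phi> x))"
    unfolding lift_problem_def
  proof (intro conjI ballI)
    show "continuous_to A X (\<lambda>x. u (\<phi> x))"
      by (rule continuous_to_compose[OF u continuous_on_subset[OF \<phi>(1) sub(1)] \<phi>(3)])
    show "continuous_to (\<I> \<times> A) Y (\<lambda>z. h (fst z, \<phi> (snd z)))"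
      by (rule continuous_to_compose[OF h])
         (use \<phi> sub in \<open>auto intro!: continuous_intros continuous_on_compose2[OF \<phi>(1)]\<close>)
    show "continuous_to K Y (\<lambda>x. v (\<phi> x))"
      by (rule continuous_to_compose[OF v \<phi>(1,2)])
  qed (use e \<phi> in auto)
  with L have "lift_solution f X Y K A (\<lambda>x. u (\<phi> x)) (\<lambda>z. h (fst z, \<phi> (snd z))) (\<lambda>x. v (\<phi> x))"
    unfolding has_lifts_def by blast
  then obtain u' h' where s: "continuous_to K X u'" "continuous_to (\<I> \<times> K) Y h'"
    "\<forall>a\<in>A. u' a = u (\<phi> a)" "\<forall>t\<in>\<I>. \<forall>a\<in>A. h' (t, a) = h (t, \<phi> a)"
    "\<forall>x\<in>K. h' (0, x) = f (u' x) \<and> h' (1, x) = v (\<phi> x)"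
    unfolding lift_solution_def fst_conv snd_conv by (elim exE conjE)
  show "lift_solution f X Y K' A' u h v"
    unfolding lift_solution_def
  proof (intro exI conjI)
    show "continuous_to K' X (\<lambda>x. u' (\<psi> x))"
      by (rule continuous_to_compose[OF s(1) \<psi>(1,2)])
    show "continuous_to (\<I> \<times> K') Y (\<lambda>z. h' (fst z, \<psi> (snd z)))"
      by (rule continuous_to_compose[OF s(2)])
         (use \<psi> in \<open>auto intro!: continuous_intros continuous_on_compose2[OF \<psi>(1)]\<close>)
  qed (use s inv sub \<psi> in \<open>auto simp: image_subset_iff subset_iff\<close>)
qed

abbreviation cylinder_boundary :: "'k::topological_space set \<Rightarrow> 'k set \<Rightarrow> (real \<times> 'k) set" where
  "cylinder_boundary K A \<equiv> ({0, 1} \<times> K) \<union> (\<I> \<times> A)"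

text \<open>Solvability only depends on the homotopy class of the problem: fill first \<open>\<I> \<times> K\<close> and then
  \<open>\<I> \<times> (\<I> \<times> K)\<close>, starting from a solution at parameter 1.\<close>

lemma lift_solution_homotopic:
  assumes cof: "cofibered_pair K A" "cofibered_pair (\<I> \<times> K) (cylinder_boundary K A)"
    and f: "continuous_map X Y f"
    and U: "continuous_to (\<I> \<times> A) X U" and H: "continuous_to (\<I> \<times> (\<I> \<times> A)) Y H"
    and V: "continuous_to (\<I> \<times> K) Y V"
    and H0: "\<And>s a. s \<in> \<I> \<Longrightarrow> a \<in> A \<Longrightarrow> H (s, 0, a) = f (U (s, a))"
    and H1: "\<And>s a. s \<in> \<I> \<Longrightarrow> a \<in> A \<Longrightarrow> H (s, 1, a) = V (s, a)"
    and sol: "lift_solution f X Y K A (\<lambda>a. U (1, a)) (\<lambda>z. H (1, z)) (\<lambda>x. V (1, x))"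
  shows "lift_solution f X Y K A (\<lambda>a. U (0, a)) (\<lambda>z. H (0, z)) (\<lambda>x. V (0, x))"
proof -
  have AK: "A \<subseteq> K" and clA: "closedin (top_of_set K) A"
    using cof unfolding cofibered_pair_def by auto
  obtain u1 h1 where s: "continuous_to K X u1" "continuous_to (\<I> \<times> K) Y h1"
    "\<And>a. a \<in> A \<Longrightarrow> u1 a = U (1, a)" "\<And>t a. t \<in> \<I> \<Longrightarrow> a \<in> A \<Longrightarrow> h1 (t, a) = H (1, t, a)"
    "\<And>x. x \<in> K \<Longrightarrow> h1 (0, x) = f (u1 x) \<and> h1 (1, x) = V (1, x)"
    using sol unfolding lift_solution_def by auto
  obtain U' where U': "continuous_to (\<I> \<times> K) X U'" "\<And>x. x \<in> K \<Longrightarrow> U' (1, x) = u1 x"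
    "\<And>t a. t \<in> \<I> \<Longrightarrow> a \<in> A \<Longrightarrow> U' (t, a) = U (t, a)"
    by (rule homotopy_extension_reverse[OF cof(1) s(1) U]) (use s in auto)
  \<comment> \<open>The boundary of the cylinder, times the parameter interval, has three closed
    parts: bottom, top and side. There the homotopy is forced to be \<open>f\<close> after
    \<open>U'\<close>, \<open>V\<close> and \<open>H\<close> respectively; the assumptions
    \<open>H0\<close> and \<open>H1\<close> make these agree on overlaps.\<close>
  define T where "T i = (if i = (0::nat) then \<I> \<times> ({0::real} \<times> K) else if i = 1 then \<I> \<times> ({1} \<times> K) else \<I> \<times> (\<I> \<times> A))" for i
  define g where "g i = (if i = (0::nat) then (\<lambda>z. f (U' (fst z, snd (snd z))))
      else if i = 1 then (\<lambda>z. V (fst z, snd (snd z))) else H)" for i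
  let ?B = "\<I> \<times> cylinder_boundary K A"
  have Bsub: "?B \<subseteq> \<I> \<times> (\<I> \<times> K)"
    using AK by auto
  have cl: "closedin (top_of_set (\<I> \<times> (\<I> \<times> K))) (T i)" for i
    using clA unfolding T_def by (auto intro!: closedin_Times simp: closedin_closed_eq)
  obtain S where S: "continuous_to ?B Y S" "\<And>i x. i \<in> {0,1,2} \<Longrightarrow> x \<in> T i \<Longrightarrow> S x = g i x"
  proof (rule continuous_to_paste[of "{0,1,2::nat}" ?B T Y g])
    show "?B = (\<Union>i\<in>{0, 1, 2}. T i)"
      unfolding T_def by auto
    then have "T i \<subseteq> ?B" if "i \<in> {0,1,2}" for i
      using that by blast
    then show "closedin (top_of_set ?B) (T i)" if "i \<in> {0,1,2}" for i
      using closedin_subset_trans[OF cl[of i] _ Bsub] that by blast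
    have "continuous_to (\<I> \<times> ({0::real} \<times> K)) Y (\<lambda>z. f (U' (fst z, snd (snd z))))"
      by (rule continuous_to_compose[OF continuous_to_map[OF U'(1) f]]) (auto intro!: continuous_intros)
    moreover have "continuous_to (\<I> \<times> ({1::real} \<times> K)) Y (\<lambda>z. V (fst z, snd (snd z)))"
      by (rule continuous_to_compose[OF V]) (auto intro!: continuous_intros)
    ultimately show "continuous_to (T i) Y (g i)" if "i \<in> {0,1,2}" for i
      using that H unfolding T_def g_def by auto
    show "g i x = g j x" if "i \<in> {0,1,2}" "j \<in> {0,1,2}" "x \<in> T i" "x \<in> T j" for i j x
      using that H0 H1 U'(3) AK unfolding T_def g_def by (auto split: if_splits)
  qed auto
  have S0: "S (s, 0, x) = f (U' (s, x))" if "s \<in> \<I>" "x \<in> K" for s x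
    using S(2)[of 0 "(s, 0, x)"] that unfolding T_def g_def by auto
  have S1: "S (s, 1, x) = V (s, x)" if "s \<in> \<I>" "x \<in> K" for s x
    using S(2)[of 1 "(s, 1, x)"] that unfolding T_def g_def by auto
  have SA: "S (s, t, a) = H (s, t, a)" if "s \<in> \<I>" "t \<in> \<I>" "a \<in> A" for s t a
    using S(2)[of 2 "(s, t, a)"] that unfolding T_def g_def by auto
  obtain G where G: "continuous_to (\<I> \<times> (\<I> \<times> K)) Y G" "\<And>x. x \<in> \<I> \<times> K \<Longrightarrow> G (1, x) = h1 x"
    "\<And>s z. s \<in> \<I> \<Longrightarrow> z \<in> cylinder_boundary K A \<Longrightarrow> G (s, z) = S (s, z)"
    by (rule homotopy_extension_reverse[OF cof(2) s(2) S(1)]) (use s S0 S1 SA U' in auto)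
  show ?thesis
    unfolding lift_solution_def
  proof (intro exI conjI)
    show "continuous_to K X (\<lambda>x. U' (0, x))"
      by (rule continuous_to_compose[OF U'(1)]) (auto intro!: continuous_intros)
    show "continuous_to (\<I> \<times> K) Y (\<lambda>z. G (0, z))"
      by (rule continuous_to_compose[OF G(1)]) (auto intro!: continuous_intros)
    show "\<forall>x\<in>K. G (0, 0, x) = f (U' (0, x)) \<and> G (0, 1, x) = V (0, x)"
      using G(3) S0 S1 by auto
  qed (use U' G SA in auto)
qed

section \<open>Cubes\<close>

abbreviation cube_set :: "nat \<Rightarrow> (nat \<Rightarrow> real) set" where
  "cube_set n \<equiv> {..<n} \<rightarrow>\<^sub>E \<I>"

lemma topspace_cube: "topspace (cube n) = cube_set n"
  by (simp add: cube_def)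

text \<open>Coordinates from \<open>n\<close> on are constantly \<open>undefined\<close>, so the
  extensional product is a subspace of the full function space. This opens the way to
  \<open>continuous_on\<close> and its rules for everything on cubes.\<close>

lemma cube_eq_top_of_set: "cube n = top_of_set (cube_set n)"
proof -
  have "continuous_map (cube n) euclidean (\<lambda>x. x)"
    unfolding euclidean_product_topology[symmetric]
  proof (subst continuous_map_componentwise_UNIV, intro allI)
    fix k
    show "continuous_map (cube n) euclideanreal (\<lambda>x. x k)"
    proof (cases "k < n")
      case True
      then have "continuous_map (cube n) (top_of_set \<I>) (\<lambda>x. x k)"
        unfolding cube_def by (intro continuous_map_product_projection) simp
      then show ?thesis
        by (simp add: continuous_map_in_subtopology)
    next
      case False
      show ?thesis
        by (rule continuous_map_eq[of _ _ "\<lambda>_. undefined"])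
           (use False in \<open>auto simp: topspace_cube PiE_iff extensional_def\<close>)
    qed
  qed
  then have 1: "continuous_map (cube n) (top_of_set (cube_set n)) (\<lambda>x. x)"
    by (simp add: continuous_map_in_subtopology topspace_cube)
  have 2: "continuous_map (top_of_set (cube_set n)) (cube n) (\<lambda>x. x)"
    unfolding cube_def continuous_map_componentwise
  proof (intro conjI ballI, goal_cases)
    case 1
    then show ?case
      by (simp add: PiE_def image_subset_iff)
  next
    case (2 k)
    moreover have "continuous_on (cube_set n) (\<lambda>x. x k)"
      by (rule continuous_on_product_then_coordinatewise) (rule continuous_on_id)
    ultimately show ?case
      by (simp add: continuous_map_in_subtopology image_subset_iff Pi_iff PiE_iff)
  qed
  show ?thesis
    unfolding topology_eq
  proof (intro allI iffI)
    fix U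
    assume U: "openin (cube n) U"
    from openin_continuous_map_preimage[OF 2 U] openin_subset[OF U]
    show "openin (top_of_set (cube_set n)) U"
      by (simp add: topspace_cube Collect_conj_eq Int_absorb1)
  next
    fix U
    assume U: "openin (top_of_set (cube_set n)) U"
    from openin_continuous_map_preimage[OF 1 U] openin_subset[OF U]
    show "openin (cube n) U"
      by (simp add: topspace_cube Collect_conj_eq Int_absorb1)
  qed
qed

lemma cube_boundary_subset: "cube_boundary n \<subseteq> cube_set n"
  by (auto simp: cube_boundary_def topspace_cube)

lemma continuous_on_coordinate [continuous_intros]:
  fixes S :: "('i \<Rightarrow> 'b::topological_space) set" and T :: "('a::topological_space \<times> ('i \<Rightarrow> 'b)) set"
  shows "continuous_on S (\<lambda>x. x i)" "continuous_on T (\<lambda>z. snd z i)"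
  by (rule continuous_on_product_then_coordinatewise, intro continuous_intros)+

text \<open>On the cube this is the sup-norm distance to the boundary when \<open>n > 0\<close>. The
  value 1 for \<open>n = 0\<close> leaves the zero set empty, in accordance with the empty boundary
  of a point.\<close>

fun boundary_distance :: "nat \<Rightarrow> (nat \<Rightarrow> real) \<Rightarrow> real" where
  "boundary_distance 0 x = 1"
| "boundary_distance (Suc n) x = min (boundary_distance n x) (min (x n) (1 - x n))"

lemma continuous_on_boundary_distance [continuous_intros]:
  "continuous_on S f \<Longrightarrow> continuous_on S (\<lambda>x. boundary_distance n (f x))"
  by (induction n) (auto intro!: continuous_intros intro: continuous_on_product_then_coordinatewise)

lemma boundary_distance_le: "i < n \<Longrightarrow> boundary_distance n x \<le> min (x i) (1 - x i)"
  by (induction n) (auto simp: less_Suc_eq)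

lemma boundary_distance_eq:
  "boundary_distance n x = 1 \<or> (\<exists>i<n. boundary_distance n x = min (x i) (1 - x i))"
proof (induction n)
  case (Suc n)
  show ?case
  proof (cases "boundary_distance n x \<le> min (x n) (1 - x n)")
    case True
    then have "boundary_distance (Suc n) x = boundary_distance n x"
      by simp
    with Suc.IH show ?thesis
      by (metis less_SucI)
  next
    case False
    then have "boundary_distance (Suc n) x = min (x n) (1 - x n)"
      unfolding boundary_distance.simps by (intro min_absorb2) linarith
    then show ?thesis
      by blast
  qed
qed simp

lemma boundary_distance_nonneg: "x \<in> cube_set n \<Longrightarrow> 0 \<le> boundary_distance n x"
  using boundary_distance_eq[of n x] by (elim disjE exE conjE) (simp_all add: PiE_iff)

lemma cube_boundary_eq: "cube_boundary n = {x \<in> cube_set n. boundary_distance n x = 0}"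
proof -
  have "boundary_distance n x = 0 \<longleftrightarrow> (\<exists>i<n. x i = 0 \<or> x i = 1)" if "x \<in> cube_set n" for x
  proof
    assume "boundary_distance n x = 0"
    then obtain i where "i < n" "min (x i) (1 - x i) = 0"
      using boundary_distance_eq[of n x] by auto
    then show "\<exists>i<n. x i = 0 \<or> x i = 1"
      by (auto simp: min_def split: if_splits)
  next
    assume "\<exists>i<n. x i = 0 \<or> x i = 1"
    then obtain i where "i < n" "min (x i) (1 - x i) = 0"
      by auto
    then show "boundary_distance n x = 0"
      using boundary_distance_nonneg[OF that] boundary_distance_le[of i n x] by simp
  qed
  then show ?thesis
    by (auto simp: cube_boundary_def topspace_cube)
qed

lemma cofibered_pair_cube: "cofibered_pair (cube_set n) (cube_boundary n)"
proof -
  \<comment> \<open>Stretch the cube by \<open>1 + s\<close> about its centre, cut off at the faces, and lower the height by \<open>s\<close>.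
    If \<open>4 d < t\<close> for the distance \<open>d\<close> to the boundary, the point reaches the boundary, because
    \<open>(1 + 4 d) (1/2 - d) \<ge> 1/2\<close> for \<open>0 \<le> d \<le> 1/4\<close>.\<close>
  define s where "s t x = min t (4 * boundary_distance n x)" for t x
  define r where "r t x = (\<lambda>i. if i < n then max 0 (min 1 (1/2 + (1 + s t x) * (x i - 1/2))) else undefined)" for t x
  have cl: "closedin (top_of_set (cube_set n)) (cube_boundary n)"
    unfolding cube_boundary_eq
    by (intro continuous_closedin_preimage_constant continuous_intros)
  have "continuous_on S (\<lambda>z. r (fst z) (snd z) i)" for S i
    unfolding r_def s_def by (cases "i < n") (auto intro!: continuous_intros)
  then have c: "continuous_on (\<I> \<times> cube_set n) (\<lambda>z. (fst z - s (fst z) (snd z), r (fst z) (snd z)))"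
    unfolding s_def by (intro continuous_intros) auto
  have mem: "r t x \<in> cube_set n" for t x
    unfolding r_def PiE_iff extensional_def by simp
  have fixed: "r t x = x" if "s t x = 0" "x \<in> cube_set n" for t x
  proof
    fix i show "r t x i = x i"
      using that unfolding r_def PiE_iff extensional_def by simp
  qed
  have image: "(t - s t x, r t x) \<in> {0} \<times> cube_set n \<union> \<I> \<times> cube_boundary n"
    if t: "t \<in> \<I>" and x: "x \<in> cube_set n" for t x
  proof (cases "t \<le> 4 * boundary_distance n x")
    case False
    define d where "d = boundary_distance n x"
    have d: "0 \<le> d" "4 * d < t" "t \<le> 1"
      using boundary_distance_nonneg[OF x] False t by (auto simp: d_def)
    then obtain i where i: "i < n" "d = min (x i) (1 - x i)"
      using boundary_distance_eq[of n x] unfolding d_def by auto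
    have s: "s t x = 4 * d"
      using d by (simp add: s_def d_def)
    have q: "d * (4 * d) \<le> d * 1"
      using d by (intro mult_left_mono) auto
    have "x i = d \<or> x i = 1 - d"
      using i(2) by linarith
    then have "r t x i = 0 \<or> r t x i = 1"
    proof
      assume xi: "x i = d"
      have "1/2 + (1 + 4 * d) * (d - 1/2) \<le> 0"
        using q by (simp add: algebra_simps)
      then show ?thesis
        using i(1) unfolding r_def s xi by simp
    next
      assume xi: "x i = 1 - d"
      have "1 \<le> 1/2 + (1 + 4 * d) * (1 - d - 1/2)"
        using q by (simp add: algebra_simps)
      then show ?thesis
        using i(1) unfolding r_def s xi by simp
    qed
    with i(1) mem[of t x] have "r t x \<in> cube_boundary n"
      unfolding cube_boundary_def topspace_cube by blast
    with d s show ?thesis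
      by simp
  qed (use mem in \<open>simp add: s_def\<close>)
  show ?thesis
    unfolding cofibered_pair_def
  proof (intro conjI cube_boundary_subset cl exI)
    show "continuous_on (\<I> \<times> cube_set n) (\<lambda>z. (fst z - s (fst z) (snd z), r (fst z) (snd z)))"
      by (rule c)
    show "(\<lambda>z. (fst z - s (fst z) (snd z), r (fst z) (snd z))) ` (\<I> \<times> cube_set n)
        \<subseteq> {0} \<times> cube_set n \<union> \<I> \<times> cube_boundary n"
      using image by (intro image_subsetI) (simp only: mem_Times_iff)
    have "s 0 x = 0" if "x \<in> cube_set n" for x
      using boundary_distance_nonneg[OF that] by (simp add: s_def)
    then show "\<forall>x\<in>cube_set n. (fst (0, x) - s (fst (0, x)) (snd (0, x)), r (fst (0, x)) (snd (0, x))) = (0, x)"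
      using fixed by simp
    have "s t x = 0" "x \<in> cube_set n" if "x \<in> cube_boundary n" "t \<in> \<I>" for t x
      using that by (auto simp: s_def cube_boundary_eq)
    then show "\<forall>t\<in>\<I>. \<forall>x\<in>cube_boundary n.
        (fst (t, x) - s (fst (t, x)) (snd (t, x)), r (fst (t, x)) (snd (t, x))) = (t, x)"
      using fixed by simp
  qed
qed

text \<open>Conjugating the retraction by \<open>\<psi>\<close> and \<open>\<phi>\<close> works as
  soon as \<open>\<phi>\<close> is a left inverse of \<open>\<psi>\<close>. Then \<open>A'\<close>
  is the preimage of \<open>A\<close> under \<open>\<psi>\<close>, hence closed.\<close>

lemma cofibered_pair_homeomorphic:
  assumes cof: "cofibered_pair K A"
    and \<phi>: "continuous_on K \<phi>" "\<phi> ` K \<subseteq> K'" "\<phi> ` A \<subseteq> A'"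
    and \<psi>: "continuous_on K' \<psi>" "\<psi> ` K' \<subseteq> K" "\<psi> ` A' \<subseteq> A"
    and inv: "\<And>x. x \<in> K' \<Longrightarrow> \<phi> (\<psi> x) = x" and sub: "A' \<subseteq> K'"
  shows "cofibered_pair K' A'"
proof -
  obtain r where A: "A \<subseteq> K" "closedin (top_of_set K) A"
    and r: "continuous_on (\<I> \<times> K) r" "r ` (\<I> \<times> K) \<subseteq> ({0} \<times> K) \<union> (\<I> \<times> A)"
      "\<And>x. x \<in> K \<Longrightarrow> r (0, x) = (0, x)" "\<And>t a. t \<in> \<I> \<Longrightarrow> a \<in> A \<Longrightarrow> r (t, a) = (t, a)"
    using cof unfolding cofibered_pair_def by blast
  have "A' = K' \<inter> \<psi> -` A"
  proof (intro equalityI subsetI)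
    fix x assume x: "x \<in> K' \<inter> \<psi> -` A"
    then have "\<phi> (\<psi> x) \<in> A'"
      using \<phi>(3) by blast
    with x inv show "x \<in> A'"
      by auto
  qed (use \<psi>(3) sub in blast)
  then have cl: "closedin (top_of_set K') A'"
    using continuous_closedin_preimage_gen[of K' \<psi> K A] \<psi>(1,2) A(2) by auto
  let ?r = "\<lambda>z. r (fst z, \<psi> (snd z))"
  have im: "?r z \<in> ({0} \<times> K) \<union> (\<I> \<times> A)" if "z \<in> \<I> \<times> K'" for z
  proof -
    have "(fst z, \<psi> (snd z)) \<in> \<I> \<times> K"
      using that \<psi>(2) by auto
    then show ?thesis
      using r(2) by blast
  qed
  have c: "continuous_on (\<I> \<times> K') ?r"
    by (rule continuous_on_compose2[OF r(1)])
       (use \<psi> in \<open>auto intro!: continuous_intros continuous_on_compose2[OF \<psi>(1)]\<close>)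
  show ?thesis
    unfolding cofibered_pair_def
  proof (intro conjI sub cl exI)
    show "continuous_on (\<I> \<times> K') (\<lambda>z. (fst (?r z), \<phi> (snd (?r z))))"
      by (intro continuous_intros continuous_on_compose2[OF \<phi>(1)] c) (use im A in fastforce)
    show "(\<lambda>z. (fst (?r z), \<phi> (snd (?r z)))) ` (\<I> \<times> K') \<subseteq> {0} \<times> K' \<union> \<I> \<times> A'"
    proof (rule image_subsetI)
      fix z assume "z \<in> \<I> \<times> K'"
      from im[OF this] show "(fst (?r z), \<phi> (snd (?r z))) \<in> {0} \<times> K' \<union> \<I> \<times> A'"
        using \<phi>(2,3) by (auto simp: mem_Times_iff)
    qed
    show "\<forall>x\<in>K'. (fst (?r (0, x)), \<phi> (snd (?r (0, x)))) = (0, x)"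
    proof
      fix x assume x: "x \<in> K'"
      then have "\<psi> x \<in> K" using \<psi>(2) by blast
      with x show "(fst (?r (0, x)), \<phi> (snd (?r (0, x)))) = (0, x)"
        using r(3) inv by simp
    qed
    show "\<forall>t\<in>\<I>. \<forall>x\<in>A'. (fst (?r (t, x)), \<phi> (snd (?r (t, x)))) = (t, x)"
    proof (intro ballI)
      fix t :: real and x assume t: "t \<in> \<I>" and x: "x \<in> A'"
      then have "\<psi> x \<in> A" "x \<in> K'" using \<psi>(3) sub by auto
      with t show "(fst (?r (t, x)), \<phi> (snd (?r (t, x)))) = (t, x)"
        using r(4) inv by simp
    qed
  qed
qed

section \<open>The cylinder over a cube as a cube of one dimension more\<close>

definition cube_cons :: "nat \<Rightarrow> real \<times> (nat \<Rightarrow> real) \<Rightarrow> nat \<Rightarrow> real" where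
  "cube_cons n z = (snd z)(n := fst z)"

text \<open>The interval factor becomes the last coordinate, with index \<open>n\<close>. Splitting
  it off resets that coordinate to \<open>undefined\<close>, so that the remaining point is
  extensional again.\<close>

definition cube_uncons :: "nat \<Rightarrow> (nat \<Rightarrow> real) \<Rightarrow> real \<times> (nat \<Rightarrow> real)" where
  "cube_uncons n x = (x n, x(n := undefined))"

lemma cube_cons_uncons: "cube_cons n (cube_uncons n x) = x"
  by (simp add: cube_cons_def cube_uncons_def)

lemma cube_uncons_cons: "z \<in> \<I> \<times> cube_set n \<Longrightarrow> cube_uncons n (cube_cons n z) = z"
proof -
  assume "z \<in> \<I> \<times> cube_set n"
  then have "snd z \<in> cube_set n"
    by (simp only: mem_Times_iff)
  then have "snd z n = undefined"
    by (rule PiE_arb) simp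
  then have "(snd z)(n := undefined) = snd z"
    by (rule fun_upd_idem)
  then show ?thesis
    by (simp add: cube_cons_def cube_uncons_def)
qed

lemma continuous_on_cube_cons: "continuous_on S (cube_cons n)"
proof (rule continuous_on_coordinatewise_then_product)
  fix i show "continuous_on S (\<lambda>z. cube_cons n z i)"
    unfolding cube_cons_def by (cases "i = n") (auto intro!: continuous_intros)
qed

lemma continuous_on_cube_uncons: "continuous_on S (cube_uncons n)"
  unfolding cube_uncons_def
proof (intro continuous_intros continuous_on_coordinatewise_then_product)
  fix i show "continuous_on S (\<lambda>x. (x(n := undefined)) i)"
    by (cases "i = n") (auto intro!: continuous_intros)
qed

lemma cube_cons_mem: "cube_cons n ` (\<I> \<times> cube_set n) \<subseteq> cube_set (Suc n)"
  unfolding cube_cons_def lessThan_Suc by (rule image_subsetI) (intro PiE_fun_upd; simp only: mem_Times_iff)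

lemma cube_uncons_mem: "cube_uncons n ` cube_set (Suc n) \<subseteq> \<I> \<times> cube_set n"
proof (rule image_subsetI)
  fix x assume "x \<in> cube_set (Suc n)"
  then have x: "x \<in> insert n {..<n} \<rightarrow>\<^sub>E \<I>"
    by (simp only: lessThan_Suc)
  have "x(n := undefined) \<in> cube_set n"
    by (rule fun_upd_in_PiE[OF _ x]) simp
  moreover have "x n \<in> \<I>"
    by (rule PiE_mem[OF x]) simp
  ultimately show "cube_uncons n x \<in> \<I> \<times> cube_set n"
    unfolding cube_uncons_def by (rule_tac SigmaI)
qed

lemma cylinder_boundary_subset:
  "cylinder_boundary (cube_set n) (cube_boundary n) \<subseteq> \<I> \<times> cube_set n"
proof -
  have "{0, 1} \<subseteq> \<I>"
    by simp
  then show ?thesis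
    using cube_boundary_subset[of n] by blast
qed

lemma cube_cons_boundary:
  "cube_cons n ` cylinder_boundary (cube_set n) (cube_boundary n) \<subseteq> cube_boundary (Suc n)"
proof (rule image_subsetI)
  fix z assume z: "z \<in> cylinder_boundary (cube_set n) (cube_boundary n)"
  then have "cube_cons n z \<in> cube_set (Suc n)"
    using cube_cons_mem[of n] cylinder_boundary_subset[of n] by (meson imageI subsetD)
  moreover have "\<exists>i<Suc n. cube_cons n z i = 0 \<or> cube_cons n z i = 1"
  proof (cases "fst z \<in> {0, 1}")
    case True
    then have "cube_cons n z n = 0 \<or> cube_cons n z n = 1"
      by (simp add: cube_cons_def)
    then show ?thesis
      by blast
  next
    case False
    with z have "snd z \<in> cube_boundary n"
      by (simp only: Un_iff mem_Times_iff) blast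
    then obtain i where "i < n" "snd z i = 0 \<or> snd z i = 1"
      unfolding cube_boundary_def by blast
    then have "i < Suc n" "cube_cons n z i = 0 \<or> cube_cons n z i = 1"
      by (simp_all add: cube_cons_def)
    then show ?thesis
      by blast
  qed
  ultimately show "cube_cons n z \<in> cube_boundary (Suc n)"
    by (simp add: cube_boundary_def topspace_cube)
qed

lemma cube_uncons_boundary:
  "cube_uncons n ` cube_boundary (Suc n) \<subseteq> cylinder_boundary (cube_set n) (cube_boundary n)"
proof (rule image_subsetI)
  fix x assume x: "x \<in> cube_boundary (Suc n)"
  then have "cube_uncons n x \<in> \<I> \<times> cube_set n"
    using cube_uncons_mem[of n] cube_boundary_subset[of "Suc n"] by blast
  moreover obtain i where "i < Suc n" "x i = 0 \<or> x i = 1"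
    using x by (auto simp: cube_boundary_def)
  moreover have "fst (cube_uncons n x) = x n" "i \<noteq> n \<Longrightarrow> snd (cube_uncons n x) i = x i"
    by (simp_all add: cube_uncons_def)
  ultimately show "cube_uncons n x \<in> cylinder_boundary (cube_set n) (cube_boundary n)"
    unfolding Un_iff mem_Times_iff cube_boundary_def topspace_cube
    by (cases "i = n") (simp_all, metis less_antisym)
qed

lemmas cube_cons_facts =
  continuous_on_cube_cons cube_cons_mem cube_cons_boundary cube_cons_uncons
  continuous_on_cube_uncons cube_uncons_mem cube_uncons_boundary cube_uncons_cons
  cylinder_boundary_subset cube_boundary_subset

lemma cofibered_pair_cylinder:
  "cofibered_pair (\<I> \<times> cube_set n) (cylinder_boundary (cube_set n) (cube_boundary n))"
  by (rule cofibered_pair_homeomorphic[where \<phi>="cube_uncons n" and \<psi>="cube_cons n"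
        and K="cube_set (Suc n)" and A="cube_boundary (Suc n)"])
     (rule cofibered_pair_cube cube_cons_facts | assumption)+

lemma has_lifts_cylinder_iff:
  "has_lifts f X Y (\<I> \<times> cube_set n) (cylinder_boundary (cube_set n) (cube_boundary n)) \<longleftrightarrow>
     has_lifts f X Y (cube_set (Suc n)) (cube_boundary (Suc n))"
proof
  assume L: "has_lifts f X Y (\<I> \<times> cube_set n) (cylinder_boundary (cube_set n) (cube_boundary n))"
  show "has_lifts f X Y (cube_set (Suc n)) (cube_boundary (Suc n))"
    by (rule has_lifts_homeomorphic[where \<phi>="cube_cons n" and \<psi>="cube_uncons n", OF L])
       (rule cube_cons_facts | assumption)+
next
  assume L: "has_lifts f X Y (cube_set (Suc n)) (cube_boundary (Suc n))"
  show "has_lifts f X Y (\<I> \<times> cube_set n) (cylinder_boundary (cube_set n) (cube_boundary n))"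
    by (rule has_lifts_homeomorphic[where \<phi>="cube_uncons n" and \<psi>="cube_cons n", OF L])
       (rule cube_cons_facts | assumption)+
qed

section \<open>Strictly commuting problems and deformations of the boundary lift\<close>

lemma lift_solution_cong:
  assumes "lift_solution f X Y K A u h v" "\<And>a. a \<in> A \<Longrightarrow> u' a = u a"
    "\<And>t a. t \<in> \<I> \<Longrightarrow> a \<in> A \<Longrightarrow> h' (t, a) = h (t, a)" "\<And>x. x \<in> K \<Longrightarrow> v' x = v x"
  shows "lift_solution f X Y K A u' h' v'"
  using assms unfolding lift_solution_def by metis

text \<open>Homotopy extension pulls \<open>v\<close> back along the reversed \<open>h\<close> to a
  map that restricts to \<open>f\<close> after \<open>u\<close> on \<open>A\<close>. Meanwhile
  \<open>h\<close> is shrunk to a constant homotopy by reparametrising its time as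
  \<open>(1 - s) * t\<close>. The given problem is thus homotopic to a strict one.\<close>

lemma has_lifts_if_strict:
  assumes cof: "cofibered_pair K A" "cofibered_pair (\<I> \<times> K) (cylinder_boundary K A)"
    and f: "continuous_map X Y f"
    and strict: "\<And>u v. continuous_to A X u \<Longrightarrow> continuous_to K Y v \<Longrightarrow> (\<And>a. a \<in> A \<Longrightarrow> v a = f (u a)) \<Longrightarrow>
        lift_solution f X Y K A u (\<lambda>z. f (u (snd z))) v"
  shows "has_lifts f X Y K A"
  unfolding has_lifts_def
proof (intro allI impI)
  fix u h v assume "lift_problem f X Y K A u h v"
  then have u: "continuous_to A X u" and h: "continuous_to (\<I> \<times> A) Y h" and v: "continuous_to K Y v"
    and e0: "\<And>a. a \<in> A \<Longrightarrow> h (0, a) = f (u a)" and e1: "\<And>a. a \<in> A \<Longrightarrow> h (1, a) = v a"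
    by (simp_all add: lift_problem_def)
  have "continuous_to (\<I> \<times> A) Y (\<lambda>z. h (1 - fst z, snd z))"
    by (rule continuous_to_compose[OF h]) (auto intro!: continuous_intros)
  then obtain V where V: "continuous_to (\<I> \<times> K) Y V" "\<And>x. x \<in> K \<Longrightarrow> V (0, x) = v x"
    "\<And>t a. t \<in> \<I> \<Longrightarrow> a \<in> A \<Longrightarrow> V (t, a) = h (1 - t, a)"
    by (rule homotopy_extension[OF cof(1) v]) (use e1 in auto)
  have "A \<subseteq> K"
    using cof(1) by (simp add: cofibered_pair_def)
  have sol: "lift_solution f X Y K A u (\<lambda>z. f (u (snd z))) (\<lambda>x. V (1, x))"
  proof (rule strict[OF u])
    show "continuous_to K Y (\<lambda>x. V (1, x))"
      by (rule continuous_to_compose[OF V(1)]) (auto intro!: continuous_intros)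
  qed (simp add: V(3) e0)
  have "lift_solution f X Y K A (\<lambda>a. u (snd (0::real, a)))
      (\<lambda>z. h ((1 - fst (0, z)) * fst (snd (0::real, z)), snd (snd (0::real, z)))) (\<lambda>x. V (0, x))"
  proof (rule lift_solution_homotopic[OF cof f _ _ V(1)])
    show "continuous_to (\<I> \<times> A) X (\<lambda>z. u (snd z))"
      by (rule continuous_to_compose[OF u]) (auto intro!: continuous_intros)
    show "continuous_to (\<I> \<times> (\<I> \<times> A)) Y (\<lambda>z. h ((1 - fst z) * fst (snd z), snd (snd z)))"
      by (rule continuous_to_compose[OF h]) (auto intro!: continuous_intros mult_le_one)
    show "lift_solution f X Y K A (\<lambda>a. u (snd (1::real, a)))
      (\<lambda>z. h ((1 - fst (1, z)) * fst (snd (1::real, z)), snd (snd (1::real, z)))) (\<lambda>x. V (1, x))"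
      by (rule lift_solution_cong[OF sol]) (simp_all add: e0)
  qed (simp_all add: e0 V(3))
  then show "lift_solution f X Y K A u h v"
    by (rule lift_solution_cong) (simp_all add: V(2))
qed

text \<open>Only the lift is deformed explicitly; \<open>v\<close> is carried along by extending the
  homotopy \<open>f\<close> after \<open>U\<close> over \<open>K\<close>. The resulting map on
  \<open>K\<close> is not under control, which is why \<open>sol\<close> speaks of every strict
  \<open>v1\<close>.\<close>

lemma strict_lift_solution_homotopic:
  assumes cof: "cofibered_pair K A" "cofibered_pair (\<I> \<times> K) (cylinder_boundary K A)"
    and f: "continuous_map X Y f"
    and U: "continuous_to (\<I> \<times> A) X U" and v: "continuous_to K Y v"
    and e: "\<And>a. a \<in> A \<Longrightarrow> v a = f (U (0, a))"
    and sol: "\<And>v1. continuous_to K Y v1 \<Longrightarrow> (\<And>a. a \<in> A \<Longrightarrow> v1 a = f (U (1, a))) \<Longrightarrow>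
        lift_solution f X Y K A (\<lambda>a. U (1, a)) (\<lambda>z. f (U (1, snd z))) v1"
  shows "lift_solution f X Y K A (\<lambda>a. U (0, a)) (\<lambda>z. f (U (0, snd z))) v"
proof -
  obtain V where V: "continuous_to (\<I> \<times> K) Y V" "\<And>x. x \<in> K \<Longrightarrow> V (0, x) = v x"
    "\<And>t a. t \<in> \<I> \<Longrightarrow> a \<in> A \<Longrightarrow> V (t, a) = f (U (t, a))"
    by (rule homotopy_extension[OF cof(1) v continuous_to_map[OF U f]]) (use e in auto)
  have sol1: "lift_solution f X Y K A (\<lambda>a. U (1, a)) (\<lambda>z. f (U (1, snd z))) (\<lambda>x. V (1, x))"
  proof (rule sol)
    show "continuous_to K Y (\<lambda>x. V (1, x))"
      by (rule continuous_to_compose[OF V(1)]) (auto intro!: continuous_intros)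
  qed (simp add: V(3))
  have "lift_solution f X Y K A (\<lambda>a. U (0, a))
      (\<lambda>z. f (U (fst (0, z), snd (snd (0::real, z))))) (\<lambda>x. V (0, x))"
  proof (rule lift_solution_homotopic[OF cof f U _ V(1)])
    show "continuous_to (\<I> \<times> (\<I> \<times> A)) Y (\<lambda>z. f (U (fst z, snd (snd z))))"
      by (rule continuous_to_compose[OF continuous_to_map[OF U f]]) (auto intro!: continuous_intros)
    show "lift_solution f X Y K A (\<lambda>a. U (1, a))
      (\<lambda>z. f (U (fst (1, z), snd (snd (1::real, z))))) (\<lambda>x. V (1, x))"
      by (rule lift_solution_cong[OF sol1]) simp_all
  qed (simp_all add: V(3))
  then show ?thesis
    by (rule lift_solution_cong) (simp_all add: V(2))
qed

text \<open>The classical argument that the relative homotopy groups of \<open>f\<close> vanish: deform the boundary data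
  so that it is constant away from the bottom face, use \<open>inj\<close> to extend it over the cylinder, and
  deform it along this extension to a constant; the remaining problem is \<open>surj\<close>.\<close>

lemma has_lifts_cylinder:
  assumes cof: "cofibered_pair C B" "cofibered_pair (\<I> \<times> C) (cylinder_boundary C B)"
      "cofibered_pair (\<I> \<times> (\<I> \<times> C)) (cylinder_boundary (\<I> \<times> C) (cylinder_boundary C B))"
    and c: "continuous_on (\<I> \<times> C) c" "c ` (\<I> \<times> C) \<subseteq> C" "\<And>x. x \<in> C \<Longrightarrow> c (0, x) = x"
      "\<And>x. x \<in> C \<Longrightarrow> c (1, x) = p" "p \<in> C"
    and f: "continuous_map X Y f"
    and inj: "\<And>g v x. continuous_to C X g \<Longrightarrow> continuous_to (\<I> \<times> C) Y v \<Longrightarrow> x \<in> topspace X \<Longrightarrow>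
      (\<And>b. b \<in> B \<Longrightarrow> g b = x) \<Longrightarrow> (\<And>y. y \<in> C \<Longrightarrow> v (0, y) = f (g y)) \<Longrightarrow> (\<And>y. y \<in> C \<Longrightarrow> v (1, y) = f x) \<Longrightarrow>
      (\<And>t b. t \<in> \<I> \<Longrightarrow> b \<in> B \<Longrightarrow> v (t, b) = f x) \<Longrightarrow>
      \<exists>k. continuous_to (\<I> \<times> C) X k \<and> (\<forall>y\<in>C. k (0, y) = g y \<and> k (1, y) = x) \<and>
          (\<forall>t\<in>\<I>. \<forall>b\<in>B. k (t, b) = x)"
    and surj: "\<And>v x. continuous_to (\<I> \<times> C) Y v \<Longrightarrow> x \<in> topspace X \<Longrightarrow>
      (\<And>a. a \<in> cylinder_boundary C B \<Longrightarrow> v a = f x) \<Longrightarrow>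
      lift_solution f X Y (\<I> \<times> C) (cylinder_boundary C B) (\<lambda>_. x) (\<lambda>_. f x) v"
  shows "has_lifts f X Y (\<I> \<times> C) (cylinder_boundary C B)"
proof (rule has_lifts_if_strict[OF cof(2,3) f])
  let ?K = "\<I> \<times> C" and ?A = "cylinder_boundary C B" and ?J = "({1} \<times> C) \<union> (\<I> \<times> B)"
  fix u v assume u: "continuous_to ?A X u" and v: "continuous_to ?K Y v"
    and uv: "\<And>a. a \<in> ?A \<Longrightarrow> v a = f (u a)"
  obtain r where BC: "B \<subseteq> C" "closedin (top_of_set C) B"
    and r: "continuous_on ?K r" "r ` ?K \<subseteq> ({0} \<times> C) \<union> (\<I> \<times> B)"
      "\<forall>x\<in>C. r (0, x) = (0, x)" "\<forall>t\<in>\<I>. \<forall>a\<in>B. r (t, a) = (t, a)"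
    using cof(1) unfolding cofibered_pair_def by (elim exE conjE)
  \<comment> \<open>\<open>?J\<close> is the top together with the side. Turning the retraction
    \<open>r\<close> upside down gives a retraction \<open>\<rho>\<close> of the cylinder onto
    \<open>?J\<close>.\<close>
  define \<rho> where "\<rho> z = (1 - fst (r (1 - fst z, snd z)), snd (r (1 - fst z, snd z)))" for z
  have \<rho>_c: "continuous_on ?K \<rho>"
    unfolding \<rho>_def
    by (intro continuous_intros continuous_on_compose2[OF r(1)]) (auto intro!: continuous_intros)
  have \<rho>_J: "\<rho> z \<in> ?J" if "z \<in> ?K" for z
  proof -
    have "(1 - fst z, snd z) \<in> ?K"
      using that by auto
    then have "r (1 - fst z, snd z) \<in> ({0} \<times> C) \<union> (\<I> \<times> B)"
      using r(2) by blast
    then show ?thesis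
      unfolding \<rho>_def by auto
  qed
  have \<rho>_id: "\<rho> z = z" if "z \<in> ?J" for z
  proof (cases "fst z = 1")
    case True
    then have "snd z \<in> C"
      using that BC(1) by auto
    then show ?thesis
      using r(3) True by (simp add: \<rho>_def prod_eq_iff)
  next
    case False
    then have "1 - fst z \<in> \<I>" "snd z \<in> B"
      using that by auto
    then show ?thesis
      using r(4) by (simp add: \<rho>_def)
  qed
  \<comment> \<open>A contraction of the whole cylinder to the point \<open>(1, p)\<close> of
    \<open>?J\<close>: the height moves linearly to 1 while \<open>c\<close> contracts the
    base.\<close>
  define \<kappa> where "\<kappa> z = ((1 - fst z) * fst (snd z) + fst z, c (fst z, snd (snd z)))" for z
  have \<kappa>_c: "continuous_on (\<I> \<times> ?K) \<kappa>"
    unfolding \<kappa>_def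
    by (intro continuous_intros continuous_on_compose2[OF c(1)]) (auto intro!: continuous_intros)
  have \<kappa>_K: "\<kappa> z \<in> ?K" if "z \<in> \<I> \<times> ?K" for z
  proof -
    have "(1 - fst z) * fst (snd z) \<le> (1 - fst z) * 1" "0 \<le> (1 - fst z) * fst (snd z)"
      using that by (auto intro!: mult_left_mono mult_nonneg_nonneg simp del: mult_1_right)
    moreover have "c (fst z, snd (snd z)) \<in> C"
      using that c(2) by (auto simp: image_subset_iff mem_Times_iff)
    ultimately show ?thesis
      using that unfolding \<kappa>_def by auto
  qed
  have JK: "?J \<subseteq> ?K" and JA: "?J \<subseteq> ?A"
    using BC by auto
  have \<kappa>_J: "\<kappa> ` (\<I> \<times> ?J) \<subseteq> ?K"
  proof (rule image_subsetI)
    fix z assume "z \<in> \<I> \<times> ?J"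
    then show "\<kappa> z \<in> ?K"
      by (rule \<kappa>_K[OF subsetD[OF Sigma_mono[OF order_refl JK]]])
  qed
  define x0 where "x0 = u (1, p)"
  have x0: "x0 \<in> topspace X"
    unfolding x0_def by (rule continuous_to_mem[OF u]) (use c(5) in auto)
  \<comment> \<open>The contraction \<open>\<kappa>\<close> leaves \<open>?J\<close> on its way, and
    \<open>\<rho>\<close> brings it back. This deforms \<open>u\<close> on \<open>?J\<close> to the
    constant \<open>x0\<close>.\<close>
  have UJ: "continuous_to (\<I> \<times> ?J) X (\<lambda>z. u (\<rho> (\<kappa> z)))"
  proof (rule continuous_to_compose[OF u])
    show "continuous_on (\<I> \<times> ?J) (\<lambda>z. \<rho> (\<kappa> z))"
      by (rule continuous_on_compose2[OF \<rho>_c continuous_on_subset[OF \<kappa>_c Sigma_mono[OF order_refl JK]] \<kappa>_J])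
    show "(\<lambda>z. \<rho> (\<kappa> z)) ` (\<I> \<times> ?J) \<subseteq> ?A"
    proof (rule image_subsetI)
      fix z assume "z \<in> \<I> \<times> ?J"
      then have "\<kappa> z \<in> ?K"
        using \<kappa>_J by (rule_tac subsetD[OF \<kappa>_J imageI])
      then show "\<rho> (\<kappa> z) \<in> ?A"
        by (rule subsetD[OF JA \<rho>_J])
    qed
  qed
  have UJ0: "u (\<rho> (\<kappa> (0, z))) = u z" if "z \<in> ?J" for z
  proof -
    have "\<kappa> (0, z) = z"
      using subsetD[OF JK that] c(3) unfolding \<kappa>_def by (simp add: mem_Times_iff prod_eq_iff)
    then show ?thesis
      using \<rho>_id[OF that] by simp
  qed
  have UJ1: "u (\<rho> (\<kappa> (1, z))) = x0" if "z \<in> ?J" for z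
  proof -
    have "\<kappa> (1, z) = (1, p)"
      using subsetD[OF JK that] c(4) unfolding \<kappa>_def by (simp add: mem_Times_iff prod_eq_iff)
    then show ?thesis
      using \<rho>_id[of "(1, p)"] c(5) by (simp add: x0_def)
  qed
  \<comment> \<open>On the bottom face the deformation is already prescribed along \<open>B\<close>;
    homotopy extension supplies the rest. Bottom and \<open>?J\<close> together make up
    \<open>?A\<close>.\<close>
  have g0: "continuous_to C X (\<lambda>x. u (0, x))"
    by (rule continuous_to_compose[OF u]) (auto intro!: continuous_intros)
  have "continuous_to (\<I> \<times> B) X (\<lambda>z. u (\<rho> (\<kappa> (fst z, 0, snd z))))"
    by (rule continuous_to_compose[OF UJ]) (auto intro!: continuous_intros)
  then obtain F where F: "continuous_to (\<I> \<times> C) X F" "\<And>x. x \<in> C \<Longrightarrow> F (0, x) = u (0, x)"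
    "\<And>t a. t \<in> \<I> \<Longrightarrow> a \<in> B \<Longrightarrow> F (t, a) = u (\<rho> (\<kappa> (t, 0, a)))"
    by (rule homotopy_extension[OF cof(1) g0]) (use UJ0 in auto)
  have F': "continuous_to (\<I> \<times> ({0::real} \<times> C)) X (\<lambda>z. F (fst z, snd (snd z)))"
    by (rule continuous_to_compose[OF F(1)]) (auto intro!: continuous_intros)
  have sub: "\<I> \<times> ({0::real} \<times> C) \<union> \<I> \<times> ?J \<subseteq> \<I> \<times> ?K"
    using JK by auto
  have clJ: "closedin (top_of_set ?K) ?J" "closedin (top_of_set ?K) ({0} \<times> C)"
    using BC(2) by (auto intro!: closedin_Un closedin_Times simp: closedin_closed_eq)
  have cl: "closedin (top_of_set (\<I> \<times> ({0::real} \<times> C) \<union> \<I> \<times> ?J)) (\<I> \<times> ({0::real} \<times> C))"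
     "closedin (top_of_set (\<I> \<times> ({0::real} \<times> C) \<union> \<I> \<times> ?J)) (\<I> \<times> ?J)"
    by (rule closedin_subset_trans[OF _ _ sub], intro closedin_Times closedin_self clJ, blast)+
  have agree: "F (fst z, snd (snd z)) = u (\<rho> (\<kappa> z))"
    if "z \<in> \<I> \<times> ({0::real} \<times> C)" "z \<in> \<I> \<times> ?J" for z
  proof -
    have "fst z \<in> \<I>" "fst (snd z) = 0" "snd (snd z) \<in> B"
      using that by (simp_all add: mem_Times_iff)
    with F(3)[of "fst z" "snd (snd z)"] show ?thesis
      by (metis prod.collapse)
  qed
  obtain U' where U': "continuous_to (\<I> \<times> ({0::real} \<times> C) \<union> \<I> \<times> ?J) X U'"
    "\<And>z. z \<in> \<I> \<times> ({0::real} \<times> C) \<Longrightarrow> U' z = F (fst z, snd (snd z))"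
    "\<And>z. z \<in> \<I> \<times> ?J \<Longrightarrow> U' z = u (\<rho> (\<kappa> z))"
    by (rule continuous_to_paste2[OF cl F' UJ agree that])
  have eqA: "\<I> \<times> ({0::real} \<times> C) \<union> \<I> \<times> ?J = \<I> \<times> ?A"
    by auto
  have U: "continuous_to (\<I> \<times> ?A) X U'"
    using U'(1) unfolding eqA .
  have U0: "U' (0, a) = u a" if "a \<in> ?A" for a
  proof (cases "a \<in> ?J")
    case True
    then show ?thesis
      using U'(3)[of "(0, a)"] UJ0 by auto
  next
    case False
    then have "a \<in> {0} \<times> C"
      using that by auto
    then show ?thesis
      using U'(2)[of "(0, a)"] F(2) by auto
  qed
  have U1: "U' (1, a) = x0" if "a \<in> ?J" for a
    using U'(3)[of "(1, a)"] UJ1[OF that] that by auto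
  have "lift_solution f X Y ?K ?A (\<lambda>a. U' (0, a)) (\<lambda>z. f (U' (0, snd z))) v"
  proof (rule strict_lift_solution_homotopic[OF cof(2,3) f U v])
    fix v1 assume v1: "continuous_to ?K Y v1" and e1: "\<And>a. a \<in> ?A \<Longrightarrow> v1 a = f (U' (1, a))"
    \<comment> \<open>After the deformation the bottom face is a map that is \<open>x0\<close> on
      \<open>B\<close>, and \<open>v1\<close> is a homotopy, constant on \<open>B\<close>, from its
      image under \<open>f\<close> to \<open>f x0\<close>. Injectivity lifts this to a homotopy
      \<open>k\<close> in \<open>X\<close>.\<close>
    have "continuous_to C X (\<lambda>x. U' (1, 0, x))"
      by (rule continuous_to_compose[OF U]) (auto intro!: continuous_intros)
    then have "\<exists>k. continuous_to ?K X k \<and> (\<forall>y\<in>C. k (0, y) = U' (1, 0, y) \<and> k (1, y) = x0) \<and>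
          (\<forall>t\<in>\<I>. \<forall>b\<in>B. k (t, b) = x0)"
      by (rule inj[OF _ v1 x0]) (use e1 U1 in auto)
    then obtain k where k: "continuous_to ?K X k" "\<And>y. y \<in> C \<Longrightarrow> k (0, y) = U' (1, 0, y)"
        "\<And>y. y \<in> C \<Longrightarrow> k (1, y) = x0" "\<And>t b. t \<in> \<I> \<Longrightarrow> b \<in> B \<Longrightarrow> k (t, b) = x0"
      by blast
    have kU: "k a = U' (1, a)" if "a \<in> ?A" for a
      using that k(2-4) U1[of a] by auto
    \<comment> \<open>The boundary data now extend over the full cylinder by \<open>k\<close>.
      Sliding every height up to 1, where \<open>k\<close> is \<open>x0\<close>, deforms them to a
      constant.\<close>
    define W where "W z = k ((1 - fst z) * fst (snd z) + fst z, snd (snd z))" for z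
    have W: "continuous_to (\<I> \<times> ?A) X W"
      unfolding W_def
    proof (rule continuous_to_compose[OF k(1)])
      show "(\<lambda>z. ((1 - fst z) * fst (snd z) + fst z, snd (snd z))) ` (\<I> \<times> ?A) \<subseteq> ?K"
      proof (rule image_subsetI)
        fix z assume "z \<in> \<I> \<times> ?A"
        then have z: "0 \<le> fst z" "fst z \<le> 1" "0 \<le> fst (snd z)" "fst (snd z) \<le> 1" "snd (snd z) \<in> C"
          using BC by auto
        then have "(1 - fst z) * fst (snd z) \<le> (1 - fst z) * 1" "0 \<le> (1 - fst z) * fst (snd z)"
          by (auto intro!: mult_left_mono mult_nonneg_nonneg simp del: mult_1_right)
        with z show "((1 - fst z) * fst (snd z) + fst z, snd (snd z)) \<in> ?K"
          by auto
      qed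
    qed (intro continuous_intros)
    have W0: "W (0, a) = k a" for a
      by (simp add: W_def)
    have W1: "W (1, a) = x0" if "a \<in> ?A" for a
      using that k(3)[of "snd a"] BC by (auto simp: W_def)
    have "lift_solution f X Y ?K ?A (\<lambda>a. W (0, a)) (\<lambda>z. f (W (0, snd z))) v1"
    proof (rule strict_lift_solution_homotopic[OF cof(2,3) f W v1])
      fix v2 assume v2: "continuous_to ?K Y v2" and e2: "\<And>a. a \<in> ?A \<Longrightarrow> v2 a = f (W (1, a))"
      have "lift_solution f X Y ?K ?A (\<lambda>_. x0) (\<lambda>_. f x0) v2"
        by (rule surj[OF v2 x0]) (simp only: e2 W1)
      then show "lift_solution f X Y ?K ?A (\<lambda>a. W (1, a)) (\<lambda>z. f (W (1, snd z))) v2"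
        by (rule lift_solution_cong) (simp_all only: W1 snd_conv)
    qed (simp only: e1 W0 kU)
    then show "lift_solution f X Y ?K ?A (\<lambda>a. U' (1, a)) (\<lambda>z. f (U' (1, snd z))) v1"
      by (rule lift_solution_cong) (simp_all only: W0 kU snd_conv)
  qed (simp only: uv U0)
  then show "lift_solution f X Y ?K ?A u (\<lambda>z. f (u (snd z))) v"
    by (rule lift_solution_cong) (simp_all only: U0 snd_conv)
qed

section \<open>Weak homotopy equivalences and lifting\<close>

text \<open>Translates the bijections between sets of classes into statements about representatives,
  the only form in which they are used for path components and for homotopy groups.\<close>

lemma bij_betw_quotient_induced_iff:
  assumes R: "equiv A R" and S: "equiv B S" and h: "\<And>a. a \<in> A \<Longrightarrow> h a \<in> B"
    and resp: "\<And>y z. (y, z) \<in> R \<Longrightarrow> (h y, h z) \<in> S"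
  shows "bij_betw (quotient_induced S h) (A // R) (B // S) \<longleftrightarrow>
    (\<forall>b\<in>B. \<exists>a\<in>A. (h a, b) \<in> S) \<and> (\<forall>a\<in>A. \<forall>a'\<in>A. (h a, h a') \<in> S \<longrightarrow> (a, a') \<in> R)"
proof -
  have q: "quotient_induced S h (R `` {a}) = S `` {h a}" if "a \<in> A" for a
    by (rule quotient_induced_class[OF R S that resp])
  have eqS: "S `` {b} = S `` {b'} \<longleftrightarrow> (b, b') \<in> S" if "b \<in> B" "b' \<in> B" for b b'
    using eq_equiv_class_iff[OF S] that by blast
  have eqR: "R `` {a} = R `` {a'} \<longleftrightarrow> (a, a') \<in> R" if "a \<in> A" "a' \<in> A" for a a'
    using eq_equiv_class_iff[OF R] that by blast
  have "inj_on (quotient_induced S h) (A // R) \<longleftrightarrow>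
      (\<forall>a\<in>A. \<forall>a'\<in>A. S `` {h a} = S `` {h a'} \<longrightarrow> R `` {a} = R `` {a'})"
    unfolding inj_on_def quotient_def by (simp add: q)
  also have "\<dots> \<longleftrightarrow> (\<forall>a\<in>A. \<forall>a'\<in>A. (h a, h a') \<in> S \<longrightarrow> (a, a') \<in> R)"
    using eqS eqR h by (simp cong: ball_cong)
  finally have inj: "inj_on (quotient_induced S h) (A // R) \<longleftrightarrow>
      (\<forall>a\<in>A. \<forall>a'\<in>A. (h a, h a') \<in> S \<longrightarrow> (a, a') \<in> R)" .
  have e1: "quotient_induced S h ` (A // R) = (\<lambda>a. S `` {h a}) ` A"
    unfolding quotient_def by (auto simp: q image_iff)
  have e2: "B // S = (\<lambda>b. S `` {b}) ` B"
    unfolding quotient_def by blast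
  have "(\<lambda>a. S `` {h a}) ` A \<subseteq> (\<lambda>b. S `` {b}) ` B"
    using h by blast
  then have "quotient_induced S h ` (A // R) = B // S \<longleftrightarrow>
      (\<lambda>b. S `` {b}) ` B \<subseteq> (\<lambda>a. S `` {h a}) ` A"
    unfolding e1 e2 set_eq_subset by (simp only: simp_thms)
  also have "\<dots> \<longleftrightarrow> (\<forall>b\<in>B. S `` {b} \<in> (\<lambda>a. S `` {h a}) ` A)"
    by (rule image_subset_iff)
  also have "\<dots> \<longleftrightarrow> (\<forall>b\<in>B. \<exists>a\<in>A. S `` {h a} = S `` {b})"
    unfolding image_iff by (simp add: eq_commute)
  also have "\<dots> \<longleftrightarrow> (\<forall>b\<in>B. \<exists>a\<in>A. (h a, b) \<in> S)"
    using eqS h by (simp cong: ball_cong bex_cong)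
  finally show ?thesis
    unfolding bij_betw_def using inj by blast
qed

section \<open>Weak homotopy equivalences in terms of representatives\<close>

lemma equiv_path_component_rel: "equiv (topspace X) (path_component_rel X)"
proof (rule equivI)
  show "path_component_rel X \<subseteq> topspace X \<times> topspace X"
    by (auto simp: path_component_rel_def dest: path_component_in_topspace)
  show "refl_on (topspace X) (path_component_rel X)"
    by (auto simp: refl_on_def path_component_rel_def path_component_of_refl)
  show "sym (path_component_rel X)"
    by (auto simp: sym_def path_component_rel_def path_component_of_sym)
  show "trans (path_component_rel X)"
    by (auto simp: trans_def path_component_rel_def intro: path_component_of_trans)
qed

lemma path_components_of_eq_quotient: "path_components_of X = topspace X // path_component_rel X"
  unfolding path_components_of_def quotient_def path_component_rel_def by auto

lemma path_component_rel_iff: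
  "(x, y) \<in> path_component_rel X \<longleftrightarrow> (\<exists>p. continuous_to \<I> X p \<and> p 0 = x \<and> p 1 = y)"
  by (auto simp: path_component_rel_def path_component_of_def pathin_def)

lemma based_homotopy_iff:
  "(g, g') \<in> based_homotopy n X x \<longleftrightarrow>
    (\<exists>h. continuous_to (\<I> \<times> cube_set n) X h \<and> (\<forall>y\<in>cube_set n. h (0, y) = g y \<and> h (1, y) = g' y) \<and>
      (\<forall>t\<in>\<I>. \<forall>b\<in>cube_boundary n. h (t, b) = x))"
proof -
  have "(\<And>y. y \<in> topspace (cube n) \<Longrightarrow> h y = k y) \<Longrightarrow>
      (h ` cube_boundary n \<subseteq> {x}) = (k ` cube_boundary n \<subseteq> {x})" for h k :: "(nat \<Rightarrow> real) \<Rightarrow> 'a"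
    using cube_boundary_subset[of n] unfolding topspace_cube image_subset_iff by (metis subsetD)
  then have "(g, g') \<in> based_homotopy n X x \<longleftrightarrow>
     (\<exists>h. continuous_map (prod_topology (top_of_set \<I>) (cube n)) X h \<and>
        (\<forall>y\<in>topspace (cube n). h (0, y) = g y) \<and> (\<forall>y\<in>topspace (cube n). h (1, y) = g' y) \<and>
        (\<forall>t\<in>\<I>. (\<lambda>y. h (t, y)) ` cube_boundary n \<subseteq> {x}))"
    unfolding based_homotopy_def mem_Collect_eq case_prod_conv by (rule homotopic_with)
  moreover have "prod_topology (top_of_set \<I>) (cube n) = top_of_set (\<I> \<times> cube_set n)"
    unfolding cube_eq_top_of_set by simp
  ultimately show ?thesis
    unfolding topspace_cube image_subset_iff singleton_iff by (simp only: ball_conj_distrib conj_assoc)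
qed

lemma based_cubes_iff:
  "g \<in> based_cubes n X x \<longleftrightarrow> continuous_to (cube_set n) X g \<and> (\<forall>b\<in>cube_boundary n. g b = x)"
  unfolding based_cubes_def mem_Collect_eq image_subset_iff singleton_iff cube_eq_top_of_set ..

lemma equiv_based_homotopy: "equiv (based_cubes n X x) (based_homotopy n X x)"
proof (rule equivI)
  show "based_homotopy n X x \<subseteq> based_cubes n X x \<times> based_cubes n X x"
  proof (intro subrelI SigmaI)
    fix g h assume "(g, h) \<in> based_homotopy n X x"
    then have "homotopic_with (\<lambda>k. k ` cube_boundary n \<subseteq> {x}) (cube n) X g h"
      by (simp add: based_homotopy_def)
    from homotopic_with_imp_continuous_maps[OF this] homotopic_with_imp_property[OF this]
    show "g \<in> based_cubes n X x" "h \<in> based_cubes n X x"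
      by (simp_all add: based_cubes_def)
  qed
  show "refl_on (based_cubes n X x) (based_homotopy n X x)"
    by (simp add: refl_on_def based_homotopy_def based_cubes_def)
  show "sym (based_homotopy n X x)"
    unfolding sym_def based_homotopy_def by (simp add: homotopic_with_sym)
  show "trans (based_homotopy n X x)"
    unfolding trans_def based_homotopy_def by (auto intro: homotopic_with_trans)
qed

lemma weak_homotopy_equivalence_iff:
  "weak_homotopy_equivalence X Y f \<longleftrightarrow>
     continuous_map X Y f \<and>
     (\<forall>y\<in>topspace Y. \<exists>x\<in>topspace X. (f x, y) \<in> path_component_rel Y) \<and>
     (\<forall>x\<in>topspace X. \<forall>x'\<in>topspace X. (f x, f x') \<in> path_component_rel Y \<longrightarrow> (x, x') \<in> path_component_rel X) \<and>
     (\<forall>n\<ge>1. \<forall>x\<in>topspace X.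
        (\<forall>g\<in>based_cubes n Y (f x). \<exists>g'\<in>based_cubes n X x. (f \<circ> g', g) \<in> based_homotopy n Y (f x)) \<and>
        (\<forall>g\<in>based_cubes n X x. \<forall>g'\<in>based_cubes n X x.
            (f \<circ> g, f \<circ> g') \<in> based_homotopy n Y (f x) \<longrightarrow> (g, g') \<in> based_homotopy n X x))"
proof (cases "continuous_map X Y f")
  case f: True
  have "bij_betw (quotient_induced (path_component_rel Y) f) (path_components_of X) (path_components_of Y) \<longleftrightarrow>
      (\<forall>y\<in>topspace Y. \<exists>x\<in>topspace X. (f x, y) \<in> path_component_rel Y) \<and>
      (\<forall>x\<in>topspace X. \<forall>x'\<in>topspace X. (f x, f x') \<in> path_component_rel Y \<longrightarrow> (x, x') \<in> path_component_rel X)"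
    unfolding path_components_of_eq_quotient
  proof (rule bij_betw_quotient_induced_iff[OF equiv_path_component_rel equiv_path_component_rel])
    show "f a \<in> topspace Y" if "a \<in> topspace X" for a
      using that continuous_map_image_subset_topspace[OF f] by blast
    show "(f y, f z) \<in> path_component_rel Y" if "(y, z) \<in> path_component_rel X" for y z
      using that unfolding path_component_rel_iff by (metis continuous_to_map[OF _ f])
  qed
  moreover have "bij_betw (quotient_induced (based_homotopy n Y (f x)) (\<lambda>g. f \<circ> g))
          (homotopy_group n X x) (homotopy_group n Y (f x)) \<longleftrightarrow>
        (\<forall>g\<in>based_cubes n Y (f x). \<exists>g'\<in>based_cubes n X x. (f \<circ> g', g) \<in> based_homotopy n Y (f x)) \<and>
        (\<forall>g\<in>based_cubes n X x. \<forall>g'\<in>based_cubes n X x.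
            (f \<circ> g, f \<circ> g') \<in> based_homotopy n Y (f x) \<longrightarrow> (g, g') \<in> based_homotopy n X x)" for n x
    unfolding homotopy_group_def
  proof (rule bij_betw_quotient_induced_iff[OF equiv_based_homotopy equiv_based_homotopy])
    show "f \<circ> a \<in> based_cubes n Y (f x)" if "a \<in> based_cubes n X x" for a
      using that unfolding based_cubes_iff comp_apply o_def by (auto intro: continuous_to_map[OF _ f])
    show "(f \<circ> y, f \<circ> z) \<in> based_homotopy n Y (f x)" if yz: "(y, z) \<in> based_homotopy n X x" for y z
    proof -
      obtain h where "continuous_to (\<I> \<times> cube_set n) X h"
        "\<forall>w\<in>cube_set n. h (0, w) = y w \<and> h (1, w) = z w" "\<forall>t\<in>\<I>. \<forall>b\<in>cube_boundary n. h (t, b) = x"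
        using yz unfolding based_homotopy_iff by blast
      then have "continuous_to (\<I> \<times> cube_set n) Y (\<lambda>w. f (h w)) \<and>
          (\<forall>w\<in>cube_set n. f (h (0, w)) = (f \<circ> y) w \<and> f (h (1, w)) = (f \<circ> z) w) \<and>
          (\<forall>t\<in>\<I>. \<forall>b\<in>cube_boundary n. f (h (t, b)) = f x)"
        by (auto intro: continuous_to_map[OF _ f])
      then show ?thesis
        unfolding based_homotopy_iff by (intro exI[of _ "\<lambda>w. f (h w)"])
    qed
  qed
  ultimately show ?thesis
    unfolding weak_homotopy_equivalence_def by (simp only: simp_thms conj_assoc)
qed (simp add: weak_homotopy_equivalence_def)

text \<open>The pair for \<open>n = 0\<close> is a point with empty boundary and expresses
  surjectivity on path components. The pair for \<open>Suc n\<close> combines injectivity in degree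
  \<open>n\<close> with surjectivity in degree \<open>Suc n\<close>, for all base points at
  once.\<close>

definition lifting_equivalence :: "('a \<Rightarrow> 'b) \<Rightarrow> 'a topology \<Rightarrow> 'b topology \<Rightarrow> bool" where
  "lifting_equivalence f X Y \<longleftrightarrow>
     continuous_map X Y f \<and> (\<forall>n. has_lifts f X Y (cube_set n) (cube_boundary n))"

lemma cube_boundary_0: "cube_boundary 0 = {}"
  by (simp add: cube_boundary_def)

lemma cube_set_0: "cube_set 0 = {\<lambda>_. undefined}"
  by simp

section \<open>Comparison of weak equivalences with lifting on cubes\<close>

definition cube_contraction :: "nat \<Rightarrow> real \<times> (nat \<Rightarrow> real) \<Rightarrow> nat \<Rightarrow> real" where
  "cube_contraction n z i = (if i < n then (1 - fst z) * snd z i else undefined)"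

lemma continuous_on_cube_contraction: "continuous_on S (cube_contraction n)"
proof (rule continuous_on_coordinatewise_then_product)
  fix i show "continuous_on S (\<lambda>z. cube_contraction n z i)"
    unfolding cube_contraction_def by (cases "i < n") (auto intro!: continuous_intros)
qed

lemma cube_contraction_mem: "cube_contraction n ` (\<I> \<times> cube_set n) \<subseteq> cube_set n"
proof (rule image_subsetI)
  fix z assume z: "z \<in> \<I> \<times> cube_set n"
  show "cube_contraction n z \<in> cube_set n"
  proof (rule PiE_I)
    fix i assume "i \<in> {..<n}"
    moreover from this z have "snd z i \<in> \<I>" "fst z \<in> \<I>"
      by (metis PiE_mem mem_Times_iff)+
    ultimately show "cube_contraction n z i \<in> \<I>"
      by (simp add: cube_contraction_def mult_le_one)
  qed (simp add: cube_contraction_def)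
qed

lemma cube_contraction_0: "x \<in> cube_set n \<Longrightarrow> cube_contraction n (0, x) = x"
proof
  fix i assume "x \<in> cube_set n"
  then show "cube_contraction n (0, x) i = x i"
    using PiE_arb[of x "{..<n}" "\<lambda>_. \<I>" i] by (simp add: cube_contraction_def)
qed

lemma cube_contraction_1: "cube_contraction n (1, x) = (\<lambda>i. if i < n then 0 else undefined)"
  by (rule ext) (simp add: cube_contraction_def)

text \<open>The inner cylinder is traded for the cube of dimension \<open>Suc n\<close>, over which
  the cylinder pair is already known to be cofibered.\<close>

lemma cofibered_pair_cylinder2:
  "cofibered_pair (\<I> \<times> (\<I> \<times> cube_set n))
     (cylinder_boundary (\<I> \<times> cube_set n) (cylinder_boundary (cube_set n) (cube_boundary n)))"
proof (rule cofibered_pair_homeomorphic[where \<phi>="map_prod id (cube_uncons n)" and \<psi>="map_prod id (cube_cons n)"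
      and K="\<I> \<times> cube_set (Suc n)" and A="cylinder_boundary (cube_set (Suc n)) (cube_boundary (Suc n))"])
  let ?C = "cube_set n" and ?B = "cube_boundary n" and ?C' = "cube_set (Suc n)" and ?B' = "cube_boundary (Suc n)"
  show "cofibered_pair (\<I> \<times> ?C') (cylinder_boundary ?C' ?B')"
    by (rule cofibered_pair_cylinder)
  show "continuous_on (\<I> \<times> ?C') (map_prod id (cube_uncons n))"
    "continuous_on (\<I> \<times> (\<I> \<times> ?C)) (map_prod id (cube_cons n))"
    unfolding map_prod_def case_prod_unfold id_def
    by (intro continuous_intros continuous_on_compose2[OF continuous_on_cube_uncons[of UNIV]]
        continuous_on_compose2[OF continuous_on_cube_cons[of UNIV]] subset_UNIV)+
  have m: "map_prod id k ` (S \<times> P) \<subseteq> S \<times> Q" if "k ` P \<subseteq> Q" for k :: "'c \<Rightarrow> 'd" and P Q and S :: "real set"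
    using that by auto
  show "map_prod id (cube_uncons n) ` (\<I> \<times> ?C') \<subseteq> \<I> \<times> (\<I> \<times> ?C)"
    by (rule m[OF cube_uncons_mem])
  show "map_prod id (cube_cons n) ` (\<I> \<times> (\<I> \<times> ?C)) \<subseteq> \<I> \<times> ?C'"
    by (rule m[OF cube_cons_mem])
  show "map_prod id (cube_uncons n) ` cylinder_boundary ?C' ?B' \<subseteq> cylinder_boundary (\<I> \<times> ?C) (cylinder_boundary ?C ?B)"
    unfolding image_Un by (rule Un_mono[OF m[OF cube_uncons_mem] m[OF cube_uncons_boundary]])
  show "map_prod id (cube_cons n) ` cylinder_boundary (\<I> \<times> ?C) (cylinder_boundary ?C ?B) \<subseteq> cylinder_boundary ?C' ?B'"
    unfolding image_Un[of _ "{0, 1} \<times> (\<I> \<times> ?C)"] by (rule Un_mono[OF m[OF cube_cons_mem] m[OF cube_cons_boundary]])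
  show "map_prod id (cube_uncons n) (map_prod id (cube_cons n) x) = x" if "x \<in> \<I> \<times> (\<I> \<times> ?C)" for x
    using that cube_uncons_cons[of "snd x" n] by (simp add: map_prod_def case_prod_unfold mem_Times_iff)
  have "{0, 1} \<subseteq> \<I>"
    by simp
  then show "cylinder_boundary (\<I> \<times> ?C) (cylinder_boundary ?C ?B) \<subseteq> \<I> \<times> (\<I> \<times> ?C)"
    using cylinder_boundary_subset[of n] by blast
qed

text \<open>A cube of dimension \<open>Suc m\<close> is a cylinder over the cube of dimension
  \<open>m\<close>, so that injectivity in degree \<open>m\<close> and surjectivity in degree
  \<open>Suc m\<close> are exactly the two inputs of \<open>has_lifts_cylinder\<close>.\<close>

theorem lifting_equivalence_if_weak:
  assumes "weak_homotopy_equivalence X Y f"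
  shows "lifting_equivalence f X Y"
proof -
  have f: "continuous_map X Y f"
    and surj0: "\<And>y. y \<in> topspace Y \<Longrightarrow> \<exists>x\<in>topspace X. (f x, y) \<in> path_component_rel Y"
    and inj0: "\<And>x x'. x \<in> topspace X \<Longrightarrow> x' \<in> topspace X \<Longrightarrow> (f x, f x') \<in> path_component_rel Y \<Longrightarrow>
        (x, x') \<in> path_component_rel X"
    and surj: "\<And>n x g. n \<ge> 1 \<Longrightarrow> x \<in> topspace X \<Longrightarrow> g \<in> based_cubes n Y (f x) \<Longrightarrow>
        \<exists>g'\<in>based_cubes n X x. (f \<circ> g', g) \<in> based_homotopy n Y (f x)"
    and inj: "\<And>n x g g'. n \<ge> 1 \<Longrightarrow> x \<in> topspace X \<Longrightarrow> g \<in> based_cubes n X x \<Longrightarrow> g' \<in> based_cubes n X x \<Longrightarrow>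
        (f \<circ> g, f \<circ> g') \<in> based_homotopy n Y (f x) \<Longrightarrow> (g, g') \<in> based_homotopy n X x"
    using assms unfolding weak_homotopy_equivalence_iff by simp_all
  have "has_lifts f X Y (cube_set n) (cube_boundary n)" for n
  proof (cases n)
    case 0
    have "has_lifts f X Y {\<lambda>_. undefined} {}"
      unfolding has_lifts_def
    proof (intro allI impI)
      fix u h v assume "lift_problem f X Y {\<lambda>_. undefined} {} u h v"
      then have v: "continuous_to {\<lambda>_. undefined} Y v"
        by (simp only: lift_problem_def)
      then obtain x p where x: "x \<in> topspace X" and p: "continuous_to \<I> Y p" "p 0 = f x" "p 1 = v (\<lambda>_. undefined)"
        using surj0 continuous_to_mem[OF v] unfolding path_component_rel_iff by blast
      have "continuous_to (\<I> \<times> {\<lambda>_. undefined}) Y (\<lambda>z. p (fst z))"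
        by (rule continuous_to_compose[OF p(1)]) (auto intro!: continuous_intros)
      then show "lift_solution f X Y {\<lambda>_. undefined} {} u h v"
        unfolding lift_solution_def using x p by (intro exI[of _ "\<lambda>_. x"] exI[of _ "\<lambda>z. p (fst z)"]) simp
    qed
    then show ?thesis
      unfolding 0 cube_set_0 cube_boundary_0 .
  next
    case (Suc m)
    let ?C = "cube_set m" and ?B = "cube_boundary m"
    have "has_lifts f X Y (\<I> \<times> ?C) (cylinder_boundary ?C ?B)"
    proof (rule has_lifts_cylinder[where c="cube_contraction m" and p="\<lambda>i. if i < m then 0 else undefined",
          OF cofibered_pair_cube cofibered_pair_cylinder cofibered_pair_cylinder2
            continuous_on_cube_contraction cube_contraction_mem])
      show "cube_contraction m (0, x) = x" if "x \<in> ?C" for x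
        by (rule cube_contraction_0[OF that])
      show "cube_contraction m (1, x) = (\<lambda>i. if i < m then 0 else undefined)" for x
        by (rule cube_contraction_1)
      show "(\<lambda>i. if i < m then 0 else undefined) \<in> ?C"
        by (rule PiE_I) auto
      show "continuous_map X Y f"
        by (rule f)
    next
      fix g v x
      assume g: "continuous_to ?C X g" and v: "continuous_to (\<I> \<times> ?C) Y v" and x: "x \<in> topspace X"
        and gb: "\<And>b. b \<in> ?B \<Longrightarrow> g b = x" and v0: "\<And>y. y \<in> ?C \<Longrightarrow> v (0, y) = f (g y)"
        and v1: "\<And>y. y \<in> ?C \<Longrightarrow> v (1, y) = f x" and vb: "\<And>t b. t \<in> \<I> \<Longrightarrow> b \<in> ?B \<Longrightarrow> v (t, b) = f x"
      show "\<exists>k. continuous_to (\<I> \<times> ?C) X k \<and> (\<forall>y\<in>?C. k (0, y) = g y \<and> k (1, y) = x) \<and>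
          (\<forall>t\<in>\<I>. \<forall>b\<in>?B. k (t, b) = x)"
      \<comment> \<open>In degree 0 injectivity is the one on path components: the base of the
        cylinder is a single point without boundary, and \<open>v\<close> is a path.\<close>
      proof (cases "m = 0")
        case True
        define pt where "pt = (\<lambda>_::nat. undefined::real)"
        have C: "?C = {pt}" and B: "?B = {}"
          unfolding pt_def True by (simp_all add: cube_boundary_0)
        have "continuous_to \<I> Y (\<lambda>t. v (t, pt))"
          by (rule continuous_to_compose[OF v]) (auto intro!: continuous_intros simp: C)
        then have "(f (g pt), f x) \<in> path_component_rel Y"
          unfolding path_component_rel_iff using v0[of pt] v1[of pt] C by blast
        then have "(g pt, x) \<in> path_component_rel X"
          by (rule inj0[OF _ x, rotated]) (use continuous_to_mem[OF g] C in blast)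
        then obtain q where q: "continuous_to \<I> X q" "q 0 = g pt" "q 1 = x"
          unfolding path_component_rel_iff by blast
        have "continuous_to (\<I> \<times> {pt}) X (\<lambda>z. q (fst z))"
          by (rule continuous_to_compose[OF q(1)]) (auto intro!: continuous_intros)
        then show ?thesis
          unfolding C B using q by (intro exI[of _ "\<lambda>z. q (fst z)"]) simp
      next
        case False
        have "(g, \<lambda>_. x) \<in> based_homotopy m X x"
        proof (rule inj[OF _ x])
          show "g \<in> based_cubes m X x" "(\<lambda>_. x) \<in> based_cubes m X x"
            unfolding based_cubes_iff using g gb x by simp_all
          show "(f \<circ> g, f \<circ> (\<lambda>_. x)) \<in> based_homotopy m Y (f x)"
            unfolding based_homotopy_iff using v v0 v1 vb by (intro exI[of _ v]) simp
        qed (use False in simp)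
        then show ?thesis
          unfolding based_homotopy_iff .
      qed
    next
      fix v x
      assume v: "continuous_to (\<I> \<times> ?C) Y v" and x: "x \<in> topspace X"
        and vb: "\<And>a. a \<in> cylinder_boundary ?C ?B \<Longrightarrow> v a = f x"
      \<comment> \<open>Being constant on the boundary of the cylinder, \<open>v\<close> represents
        an element of the homotopy group of \<open>Y\<close> in degree \<open>Suc m\<close>.\<close>
      have "(\<lambda>y. v (cube_uncons m y)) \<in> based_cubes n Y (f x)"
        unfolding based_cubes_iff Suc
      proof (intro conjI ballI)
        show "continuous_to (cube_set (Suc m)) Y (\<lambda>y. v (cube_uncons m y))"
          by (rule continuous_to_compose[OF v continuous_on_cube_uncons cube_uncons_mem])
        show "v (cube_uncons m b) = f x" if "b \<in> cube_boundary (Suc m)" for b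
          by (rule vb) (use that cube_uncons_boundary[of m] in blast)
      qed
      then obtain w where w: "w \<in> based_cubes n X x" "(f \<circ> w, \<lambda>y. v (cube_uncons m y)) \<in> based_homotopy n Y (f x)"
        using surj[OF _ x] Suc by (metis le_add1 plus_1_eq_Suc)
      then obtain h where h: "continuous_to (\<I> \<times> cube_set (Suc m)) Y h"
        "\<And>y. y \<in> cube_set (Suc m) \<Longrightarrow> h (0, y) = f (w y)"
        "\<And>y. y \<in> cube_set (Suc m) \<Longrightarrow> h (1, y) = v (cube_uncons m y)"
        "\<And>t b. t \<in> \<I> \<Longrightarrow> b \<in> cube_boundary (Suc m) \<Longrightarrow> h (t, b) = f x"
        unfolding based_homotopy_iff Suc comp_apply by metis
      have cons: "cube_cons m z \<in> cube_set (Suc m)" if "z \<in> \<I> \<times> ?C" for z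
        using cube_cons_mem[of m] that by blast
      have consb: "cube_cons m z \<in> cube_boundary (Suc m)" if "z \<in> cylinder_boundary ?C ?B" for z
        using cube_cons_boundary[of m] that by blast
      show "lift_solution f X Y (\<I> \<times> ?C) (cylinder_boundary ?C ?B) (\<lambda>_. x) (\<lambda>_. f x) v"
        unfolding lift_solution_def
      proof (intro exI conjI ballI)
        show "continuous_to (\<I> \<times> ?C) X (\<lambda>z. w (cube_cons m z))"
          by (rule continuous_to_compose[OF _ continuous_on_cube_cons cube_cons_mem])
             (use w(1) Suc in \<open>simp add: based_cubes_iff\<close>)
        show "continuous_to (\<I> \<times> (\<I> \<times> ?C)) Y (\<lambda>z. h (fst z, cube_cons m (snd z)))"
        proof (rule continuous_to_compose[OF h(1)])
          show "continuous_on (\<I> \<times> (\<I> \<times> ?C)) (\<lambda>z. (fst z, cube_cons m (snd z)))"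
            by (intro continuous_intros continuous_on_compose2[OF continuous_on_cube_cons[of UNIV]] subset_UNIV)
          show "(\<lambda>z. (fst z, cube_cons m (snd z))) ` (\<I> \<times> (\<I> \<times> ?C)) \<subseteq> \<I> \<times> cube_set (Suc m)"
            using cons by (intro image_subsetI) (simp only: mem_Times_iff fst_conv snd_conv)
        qed
        show "w (cube_cons m a) = x" if "a \<in> cylinder_boundary ?C ?B" for a
          using w(1) consb[OF that] unfolding based_cubes_iff Suc by blast
      qed (simp_all only: fst_conv snd_conv h consb cons cube_uncons_cons)
    qed
    then show ?thesis
      unfolding Suc has_lifts_cylinder_iff .
  qed
  with f show ?thesis
    by (simp add: lifting_equivalence_def)
qed


text \<open>Surjectivity in degree \<open>n\<close> is the strict problem on the
  \<open>n\<close>-cube with constant lift on the boundary. Injectivity is the strict problem on the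
  cylinder over the \<open>n\<close>-cube, with the two representatives at its ends and a constant
  on its side.\<close>

theorem weak_if_lifting_equivalence:
  assumes "lifting_equivalence f X Y"
  shows "weak_homotopy_equivalence X Y f"
proof -
  have f: "continuous_map X Y f"
    and L: "\<And>n. has_lifts f X Y (cube_set n) (cube_boundary n)"
    using assms by (simp_all add: lifting_equivalence_def)
  have strict: "\<exists>u' h'. continuous_to K X u' \<and> continuous_to (\<I> \<times> K) Y h' \<and> (\<forall>a\<in>A. u' a = u a) \<and>
        (\<forall>t\<in>\<I>. \<forall>a\<in>A. h' (t, a) = f (u a)) \<and> (\<forall>x\<in>K. h' (0, x) = f (u' x) \<and> h' (1, x) = v x)"
    if "has_lifts f X Y K A" "continuous_to A X u" "continuous_to K Y v" "\<And>a. a \<in> A \<Longrightarrow> v a = f (u a)"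
    for K A :: "'k::topological_space set" and u v
  proof -
    have "continuous_to (\<I> \<times> A) Y (\<lambda>z. f (u (snd z)))"
      by (rule continuous_to_compose[OF continuous_to_map[OF that(2) f]]) (auto intro!: continuous_intros)
    then have "lift_problem f X Y K A u (\<lambda>z. f (u (snd z))) v"
      using that by (simp add: lift_problem_def)
    with that(1) have "lift_solution f X Y K A u (\<lambda>z. f (u (snd z))) v"
      by (simp add: has_lifts_def)
    then show ?thesis
      unfolding lift_solution_def snd_conv .
  qed
  define pt where "pt = (\<lambda>_::nat. undefined::real)"
  have C0: "cube_set 0 = {pt}" and B0: "cube_boundary 0 = {}"
    unfolding pt_def by (simp_all add: cube_boundary_0)
  have L1: "has_lifts f X Y (\<I> \<times> cube_set n) (cylinder_boundary (cube_set n) (cube_boundary n))" for n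
    unfolding has_lifts_cylinder_iff by (rule L)
  have bd_closed: "closedin (top_of_set (cylinder_boundary (cube_set n) (cube_boundary n))) ({t} \<times> cube_set n)"
     "closedin (top_of_set (cylinder_boundary (cube_set n) (cube_boundary n))) (\<I> \<times> cube_boundary n)"
    if "t \<in> {0, 1}" for n and t :: real
  proof -
    have clB: "closedin (top_of_set (cube_set n)) (cube_boundary n)"
      using cofibered_pair_cube[of n] by (simp add: cofibered_pair_def)
    have "t \<in> \<I>"
      using that by auto
    then have t: "closedin (top_of_set \<I>) {t}"
      by (simp add: closedin_closed_eq)
    have t_sub: "{t} \<subseteq> {0, 1}"
      using that by simp
    show "closedin (top_of_set (cylinder_boundary (cube_set n) (cube_boundary n))) ({t} \<times> cube_set n)"
      using Sigma_mono[OF t_sub order_refl]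
      by (rule_tac closedin_subset_trans[OF closedin_Times[OF t closedin_self] _ cylinder_boundary_subset]) blast
    show "closedin (top_of_set (cylinder_boundary (cube_set n) (cube_boundary n))) (\<I> \<times> cube_boundary n)"
      by (rule closedin_subset_trans[OF closedin_Times[OF closedin_self clB] _ cylinder_boundary_subset]) blast
  qed
  \<comment> \<open>Stated for all \<open>n\<close>: the case \<open>n = 0\<close>, with empty
    boundary, lifts paths between images of points and gives injectivity on path components.\<close>
  have extend: "\<exists>k. continuous_to (\<I> \<times> cube_set n) X k \<and> (\<forall>y\<in>cube_set n. k (0, y) = g y \<and> k (1, y) = g' y) \<and>
      (\<forall>t\<in>\<I>. \<forall>b\<in>cube_boundary n. k (t, b) = x)"
    if g: "continuous_to (cube_set n) X g" "\<And>b. b \<in> cube_boundary n \<Longrightarrow> g b = x"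
      and g': "continuous_to (cube_set n) X g'" "\<And>b. b \<in> cube_boundary n \<Longrightarrow> g' b = x"
      and x: "x \<in> topspace X"
      and v: "continuous_to (\<I> \<times> cube_set n) Y v" "\<And>y. y \<in> cube_set n \<Longrightarrow> v (0, y) = f (g y)"
        "\<And>y. y \<in> cube_set n \<Longrightarrow> v (1, y) = f (g' y)"
        "\<And>t b. t \<in> \<I> \<Longrightarrow> b \<in> cube_boundary n \<Longrightarrow> v (t, b) = f x"
    for n g g' x v
  proof -
    let ?C = "cube_set n" and ?B = "cube_boundary n"
    define T where "T i = (if i = (0::nat) then {0::real} \<times> ?C else if i = 1 then {1} \<times> ?C else \<I> \<times> ?B)" for i
    define k :: "nat \<Rightarrow> real \<times> (nat \<Rightarrow> real) \<Rightarrow> 'a"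
      where "k i = (if i = 0 then (\<lambda>z. g (snd z)) else if i = 1 then (\<lambda>z. g' (snd z)) else (\<lambda>_. x))" for i
    have T: "T 0 = {0} \<times> ?C" "T 1 = {1} \<times> ?C" "T 2 = \<I> \<times> ?B"
      by (simp_all add: T_def)
    have k: "k 0 = (\<lambda>z. g (snd z))" "k 1 = (\<lambda>z. g' (snd z))" "k 2 = (\<lambda>_. x)"
      by (simp_all add: k_def)
    have eq: "cylinder_boundary ?C ?B = (\<Union>i\<in>{0, 1, 2}. T i)"
      unfolding UN_insert T UN_empty by blast
    obtain u where u: "continuous_to (cylinder_boundary ?C ?B) X u"
      "\<And>i z. i \<in> {0, 1, 2} \<Longrightarrow> z \<in> T i \<Longrightarrow> u z = k i z"
    proof (rule continuous_to_paste[of "{0, 1, 2::nat}" "cylinder_boundary ?C ?B" T X k])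
      show "closedin (top_of_set (cylinder_boundary ?C ?B)) (T i)" if "i \<in> {0, 1, 2}" for i
        using that bd_closed[of 0 n] bd_closed[of 1 n] T by auto
      have "continuous_to ({0::real} \<times> ?C) X (\<lambda>z. g (snd z))" "continuous_to ({1::real} \<times> ?C) X (\<lambda>z. g' (snd z))"
        by (rule continuous_to_compose[OF g(1)] continuous_to_compose[OF g'(1)];
            force intro!: continuous_intros)+
      then show "continuous_to (T i) X (k i)" if "i \<in> {0, 1, 2}" for i
        using that T k x by auto
      show "k i z = k j z" if "i \<in> {0, 1, 2}" "j \<in> {0, 1, 2}" "z \<in> T i" "z \<in> T j" for i j z
        using that T k g(2) g'(2) by auto
    qed (use eq in simp_all)
    have u0: "u (0, y) = g y" and u1: "u (1, y) = g' y" if "y \<in> ?C" for y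
      using u(2)[of 0 "(0, y)"] u(2)[of 1 "(1, y)"] that T k by simp_all
    have ub: "u (t, b) = x" if "t \<in> \<I>" "b \<in> ?B" for t b
      using u(2)[of 2 "(t, b)"] that T k by simp
    have "v a = f (u a)" if a_mem: "a \<in> cylinder_boundary ?C ?B" for a
    proof -
      obtain t y where a: "a = (t, y)"
        by (cases a)
      consider "t = 0" "y \<in> ?C" | "t = 1" "y \<in> ?C" | "t \<in> \<I>" "y \<in> ?B"
        using a_mem unfolding a by blast
      then show ?thesis
        unfolding a by cases (simp_all only: v u0 u1 ub)
    qed
    from strict[OF L1 u(1) v(1) this] obtain u' where
      u': "continuous_to (\<I> \<times> ?C) X u'" "\<forall>a\<in>cylinder_boundary ?C ?B. u' a = u a"
      by blast
    show ?thesis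
    proof (intro exI[of _ u'] conjI ballI u'(1))
      show "u' (0, y) = g y" "u' (1, y) = g' y" if "y \<in> ?C" for y
        using u'(2) u0[OF that] u1[OF that] that by simp_all
      show "u' (t, b) = x" if "t \<in> \<I>" "b \<in> ?B" for t b
        using bspec[OF u'(2), of "(t, b)"] ub[OF that] that by simp
    qed
  qed
  show ?thesis
    unfolding weak_homotopy_equivalence_iff
  proof (intro conjI f ballI allI impI)
    fix y assume y: "y \<in> topspace Y"
    \<comment> \<open>The boundary of the 0-cube is empty, so any value serves as the lift on
      it.\<close>
    have "continuous_to {} X (\<lambda>_. undefined)"
      by simp
    from strict[OF L[of 0, unfolded C0 B0] this, of "\<lambda>_. y"] y obtain u h where
      u: "continuous_to {pt} X u" and h: "continuous_to (\<I> \<times> {pt}) Y h" "h (0, pt) = f (u pt)" "h (1, pt) = y"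
      by auto
    have "continuous_to \<I> Y (\<lambda>t. h (t, pt))"
      by (rule continuous_to_compose[OF h(1)]) (auto intro!: continuous_intros)
    then have "(f (u pt), y) \<in> path_component_rel Y"
      unfolding path_component_rel_iff using h(2,3) by blast
    then show "\<exists>x\<in>topspace X. (f x, y) \<in> path_component_rel Y"
      using continuous_to_mem[OF u] by blast
  next
    fix x x' assume x: "x \<in> topspace X" "x' \<in> topspace X" and "(f x, f x') \<in> path_component_rel Y"
    then obtain p where p: "continuous_to \<I> Y p" "p 0 = f x" "p 1 = f x'"
      unfolding path_component_rel_iff by blast
    have "continuous_to (\<I> \<times> {pt}) Y (\<lambda>z. p (fst z))"
      by (rule continuous_to_compose[OF p(1)]) (auto intro!: continuous_intros)
    then obtain k where k: "continuous_to (\<I> \<times> {pt}) X k" "k (0, pt) = x" "k (1, pt) = x'"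
      using extend[of 0 "\<lambda>_. x" x "\<lambda>_. x'" "\<lambda>z. p (fst z)", unfolded C0 B0] x p(2,3) by auto
    have "continuous_to \<I> X (\<lambda>t. k (t, pt))"
      by (rule continuous_to_compose[OF k(1)]) (auto intro!: continuous_intros)
    then show "(x, x') \<in> path_component_rel X"
      unfolding path_component_rel_iff using k(2,3) by blast
  next
    fix n :: nat and x g assume x: "x \<in> topspace X" and g: "g \<in> based_cubes n Y (f x)"
    have "continuous_to (cube_boundary n) X (\<lambda>_. x)"
      using x by simp
    from strict[OF L this, of g] g obtain u h where
      u: "continuous_to (cube_set n) X u" "\<forall>a\<in>cube_boundary n. u a = x"
      and h: "continuous_to (\<I> \<times> cube_set n) Y h" "\<forall>t\<in>\<I>. \<forall>a\<in>cube_boundary n. h (t, a) = f x"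
        "\<forall>y\<in>cube_set n. h (0, y) = f (u y) \<and> h (1, y) = g y"
      unfolding based_cubes_iff by blast
    then have "(f \<circ> u, g) \<in> based_homotopy n Y (f x)"
      unfolding based_homotopy_iff comp_apply by blast
    moreover have "u \<in> based_cubes n X x"
      unfolding based_cubes_iff using u by blast
    ultimately show "\<exists>g'\<in>based_cubes n X x. (f \<circ> g', g) \<in> based_homotopy n Y (f x)"
      by blast
  next
    fix n :: nat and x g g'
    assume x: "x \<in> topspace X" and g: "g \<in> based_cubes n X x" "g' \<in> based_cubes n X x"
      and "(f \<circ> g, f \<circ> g') \<in> based_homotopy n Y (f x)"
    then obtain v where "continuous_to (\<I> \<times> cube_set n) Y v"
      "\<forall>y\<in>cube_set n. v (0, y) = f (g y) \<and> v (1, y) = f (g' y)"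
      "\<forall>t\<in>\<I>. \<forall>b\<in>cube_boundary n. v (t, b) = f x"
      unfolding based_homotopy_iff comp_apply by blast
    with g x show "(g, g') \<in> based_homotopy n X x"
      unfolding based_cubes_iff based_homotopy_iff by (intro extend[of n g x g' v]) simp_all
  qed
qed

section \<open>Empty spaces and invariance under deformation\<close>

lemma lifting_equivalence_has_lifts:
  "lifting_equivalence f X Y \<Longrightarrow> has_lifts f X Y (cube_set n) (cube_boundary n)"
  by (simp add: lifting_equivalence_def)

lemma lifting_equivalenceI_strict:
  assumes f: "continuous_map X Y f"
    and strict: "\<And>n u v. continuous_to (cube_boundary n) X u \<Longrightarrow> continuous_to (cube_set n) Y v \<Longrightarrow>
        (\<And>a. a \<in> cube_boundary n \<Longrightarrow> v a = f (u a)) \<Longrightarrow>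
        lift_solution f X Y (cube_set n) (cube_boundary n) u (\<lambda>z. f (u (snd z))) v"
  shows "lifting_equivalence f X Y"
  unfolding lifting_equivalence_def
  by (intro conjI f allI has_lifts_if_strict[OF cofibered_pair_cube cofibered_pair_cylinder f] strict)

text \<open>Cubes are nonempty, so no problem has a map \<open>v\<close> into an empty target. The
  case occurs for overlaps of disjoint pieces and for pieces whose flag is realized by no
  point.\<close>

lemma lifting_equivalence_empty:
  assumes "topspace Y = {}" "topspace X = {}"
  shows "lifting_equivalence f X Y"
proof (rule lifting_equivalenceI_strict)
  show "continuous_map X Y f"
    using assms by (simp add: continuous_map_def)
  fix n u v assume "continuous_to (cube_set n) Y v"
  moreover have "(\<lambda>i. if i < n then 0 else undefined) \<in> cube_set n"
    by (rule PiE_I) auto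
  ultimately have "v (\<lambda>i. if i < n then 0 else undefined) \<in> topspace Y"
    by (rule continuous_to_mem)
  then show "lift_solution f X Y (cube_set n) (cube_boundary n) u (\<lambda>z. f (u (snd z))) v"
    using assms by simp
qed

text \<open>Project the problem to \<open>g\<close>, solve it there and include the solution back.
  This solves the problem at the far end of \<open>D\<close> and \<open>D'\<close>; compatibility of
  the two deformations with \<open>f\<close> makes them a homotopy of problems leading back to the
  given one.\<close>

lemma lifting_equivalence_deformation:
  assumes L: "lifting_equivalence g X' Y'" and f: "continuous_map X Y f"
    and r: "continuous_map X X' r" "continuous_map Y Y' r'"
    and i: "continuous_map X' X i" "continuous_map Y' Y i'"
    and D: "continuous_map (prod_topology (top_of_set \<I>) X) X D"
      "continuous_map (prod_topology (top_of_set \<I>) Y) Y D'"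
    and D0: "\<And>x. x \<in> topspace X \<Longrightarrow> D (0, x) = x" "\<And>y. y \<in> topspace Y \<Longrightarrow> D' (0, y) = y"
    and D1: "\<And>x. x \<in> topspace X \<Longrightarrow> D (1, x) = i (r x)" "\<And>y. y \<in> topspace Y \<Longrightarrow> D' (1, y) = i' (r' y)"
    and nat_r: "\<And>x. x \<in> topspace X \<Longrightarrow> r' (f x) = g (r x)"
    and nat_i: "\<And>x. x \<in> topspace X' \<Longrightarrow> f (i x) = i' (g x)"
    and nat_D: "\<And>t x. t \<in> \<I> \<Longrightarrow> x \<in> topspace X \<Longrightarrow> f (D (t, x)) = D' (t, f x)"
  shows "lifting_equivalence f X Y"
  unfolding lifting_equivalence_def has_lifts_def
proof (intro conjI f allI impI)
  fix n u h v
  let ?K = "cube_set n" and ?A = "cube_boundary n"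
  assume "lift_problem f X Y ?K ?A u h v"
  then have u: "continuous_to ?A X u" and h: "continuous_to (\<I> \<times> ?A) Y h" and v: "continuous_to ?K Y v"
    and e0: "\<And>a. a \<in> ?A \<Longrightarrow> h (0, a) = f (u a)" and e1: "\<And>a. a \<in> ?A \<Longrightarrow> h (1, a) = v a"
    by (simp_all add: lift_problem_def)
  have pair: "continuous_to (\<I> \<times> S) Z (\<lambda>z. E (fst z, w (snd z)))"
    if E: "continuous_map (prod_topology (top_of_set \<I>) Z) Z E" and w: "continuous_to S Z w"
    for S :: "'k::topological_space set" and Z :: "'z topology" and E w
  proof -
    have "continuous_map (prod_topology (top_of_set \<I>) (top_of_set S)) (prod_topology (top_of_set \<I>) Z)
        (\<lambda>z. (fst z, w (snd z)))"
      by (intro continuous_map_pairedI continuous_map_fst continuous_map_compose[OF continuous_map_snd w, unfolded o_def])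
    from continuous_map_compose[OF this E] show ?thesis
      by (simp add: o_def)
  qed
  have "lift_problem g X' Y' ?K ?A (\<lambda>x. r (u x)) (\<lambda>z. r' (h z)) (\<lambda>x. r' (v x))"
    unfolding lift_problem_def
    by (intro conjI continuous_to_map[OF u r(1)] continuous_to_map[OF h r(2)] continuous_to_map[OF v r(2)])
       (simp add: e0 e1 nat_r continuous_to_mem[OF u])
  then have "lift_solution g X' Y' ?K ?A (\<lambda>x. r (u x)) (\<lambda>z. r' (h z)) (\<lambda>x. r' (v x))"
    using lifting_equivalence_has_lifts[OF L] by (simp add: has_lifts_def)
  then obtain u1 h1 where s: "continuous_to ?K X' u1" "continuous_to (\<I> \<times> ?K) Y' h1"
    "\<forall>a\<in>?A. u1 a = r (u a)" "\<forall>t\<in>\<I>. \<forall>a\<in>?A. h1 (t, a) = r' (h (t, a))"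
    "\<forall>x\<in>?K. h1 (0, x) = g (u1 x) \<and> h1 (1, x) = r' (v x)"
    unfolding lift_solution_def by (elim exE conjE)
  have memu: "u a \<in> topspace X" if "a \<in> ?A" for a
    by (rule continuous_to_mem[OF u that])
  have memv: "v a \<in> topspace Y" if "a \<in> ?K" for a
    by (rule continuous_to_mem[OF v that])
  have memh: "h (t, a) \<in> topspace Y" if "t \<in> \<I>" "a \<in> ?A" for t a
    by (rule continuous_to_mem[OF h]) (use that in simp)
  have sol: "lift_solution f X Y ?K ?A (\<lambda>a. i (r (u a))) (\<lambda>z. i' (r' (h z))) (\<lambda>x. i' (r' (v x)))"
    unfolding lift_solution_def
  proof (intro exI conjI)
    show "continuous_to ?K X (\<lambda>x. i (u1 x))"
      by (rule continuous_to_map[OF s(1) i(1)])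
    show "continuous_to (\<I> \<times> ?K) Y (\<lambda>z. i' (h1 z))"
      by (rule continuous_to_map[OF s(2) i(2)])
    show "\<forall>x\<in>?K. i' (h1 (0, x)) = f (i (u1 x)) \<and> i' (h1 (1, x)) = i' (r' (v x))"
      using s(5) nat_i continuous_to_mem[OF s(1)] by simp
  qed (use s(3,4) in simp_all)
  have "lift_solution f X Y ?K ?A (\<lambda>a. D (fst (0::real, a), u (snd (0::real, a))))
     (\<lambda>z. D' (fst (0::real, z), h (snd (0::real, z)))) (\<lambda>x. D' (fst (0::real, x), v (snd (0::real, x))))"
  proof (rule lift_solution_homotopic[OF cofibered_pair_cube cofibered_pair_cylinder f
        pair[OF D(1) u] pair[OF D(2) h] pair[OF D(2) v]])
    show "lift_solution f X Y ?K ?A (\<lambda>a. D (fst (1::real, a), u (snd (1::real, a))))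
     (\<lambda>z. D' (fst (1::real, z), h (snd (1::real, z)))) (\<lambda>x. D' (fst (1::real, x), v (snd (1::real, x))))"
      by (rule lift_solution_cong[OF sol]) (simp_all add: D1 memu memv memh)
  qed (simp_all add: e0 e1 nat_D memu)
  then show "lift_solution f X Y ?K ?A u h v"
    by (rule lift_solution_cong) (simp_all add: D0 memu memv memh)
qed

section \<open>The lifting property is local on the target\<close>

text \<open>A cell of the cubical grid of mesh \<open>1/N\<close> is encoded by its lower corner \<open>a\<close> (in units of \<open>1/N\<close>)
  and the set \<open>J\<close> of its free directions.\<close>

definition grid_cell :: "nat \<Rightarrow> nat \<Rightarrow> (nat \<Rightarrow> nat) \<Rightarrow> nat set \<Rightarrow> (nat \<Rightarrow> real) set" where
  "grid_cell N n a J = {x \<in> extensional {..<n}. \<forall>i<n.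
     if i \<in> J then real (a i) \<le> real N * x i \<and> real N * x i \<le> real (a i) + 1 else real N * x i = real (a i)}"

definition grid_cell_boundary :: "nat \<Rightarrow> nat \<Rightarrow> (nat \<Rightarrow> nat) \<Rightarrow> nat set \<Rightarrow> (nat \<Rightarrow> real) set" where
  "grid_cell_boundary N n a J =
     {x \<in> grid_cell N n a J. \<exists>i\<in>J. real N * x i = real (a i) \<or> real N * x i = real (a i) + 1}"

definition grid_cells :: "nat \<Rightarrow> nat \<Rightarrow> ((nat \<Rightarrow> nat) \<times> nat set) set" where
  "grid_cells N n = {(a, J). a \<in> {..<n} \<rightarrow>\<^sub>E {..N} \<and> J \<subseteq> {..<n} \<and> (\<forall>i\<in>J. a i < N)}"

lemma finite_grid_cells: "finite (grid_cells N n)"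
proof (rule finite_subset)
  show "grid_cells N n \<subseteq> ({..<n} \<rightarrow>\<^sub>E {..N}) \<times> Pow {..<n}"
    unfolding grid_cells_def by blast
  show "finite (({..<n} \<rightarrow>\<^sub>E {..N}) \<times> Pow {..<n})"
    by (intro finite_cartesian_product finite_PiE) simp_all
qed

lemma grid_cell_subset:
  assumes "(a, J) \<in> grid_cells N n" "N > 0"
  shows "grid_cell N n a J \<subseteq> cube_set n"
proof
  fix x assume x: "x \<in> grid_cell N n a J"
  show "x \<in> cube_set n"
  proof (rule PiE_I)
    fix i assume "i \<in> {..<n}"
    then have i: "i < n" by simp
    have a: "a i \<le> N" "i \<in> J \<Longrightarrow> a i + 1 \<le> N"
      using assms i unfolding grid_cells_def by (auto simp: Suc_le_eq)
    have "0 \<le> real N * x i \<and> real N * x i \<le> real N"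
    proof (cases "i \<in> J")
      case True
      then have "real (a i) \<le> real N * x i" "real N * x i \<le> real (a i) + 1"
        using x i unfolding grid_cell_def by auto
      moreover have "real (a i) + 1 \<le> real N"
        using a(2)[OF True] by linarith
      ultimately show ?thesis
        by (meson of_nat_0_le_iff order_trans)
    next
      case False
      then have "real N * x i = real (a i)"
        using x i unfolding grid_cell_def by auto
      then show ?thesis
        using a(1) by simp
    qed
    then show "x i \<in> \<I>"
      using assms(2) by (simp add: zero_le_mult_iff mult_le_cancel_left1)
  qed (use x in \<open>simp add: grid_cell_def extensional_def\<close>)
qed

lemma closed_grid_cell: "closedin (top_of_set (cube_set n)) (cube_set n \<inter> grid_cell N n a J)"
proof -
  define P where "P i = (if i \<in> J then {x. real (a i) \<le> real N * x i} \<inter> {x. real N * x i \<le> real (a i) + 1}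
      else {x. real N * x i = real (a i)})" for i
  have "closed (P i)" for i
    unfolding P_def by (auto intro!: closed_Int closed_Collect_le closed_Collect_eq continuous_intros)
  then have "closed (\<Inter>i\<in>{..<n}. P i)"
    by blast
  moreover have "cube_set n \<inter> grid_cell N n a J = cube_set n \<inter> (\<Inter>i\<in>{..<n}. P i)"
  proof -
    have "x \<in> grid_cell N n a J \<longleftrightarrow> x \<in> (\<Inter>i\<in>{..<n}. P i)" if "x \<in> cube_set n" for x
    proof -
      have "x \<in> extensional {..<n}"
        using that by (simp add: PiE_def)
      moreover have "x \<in> P i \<longleftrightarrow>
         (if i \<in> J then real (a i) \<le> real N * x i \<and> real N * x i \<le> real (a i) + 1 else real N * x i = real (a i))" for i
        by (simp add: P_def)
      ultimately show ?thesis
        unfolding grid_cell_def by auto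
    qed
    then show ?thesis
      by blast
  qed
  ultimately show ?thesis
    by (simp add: closedin_closed_Int)
qed

text \<open>At a point off the boundary of its cell, the rescaled free coordinates lie strictly
  between consecutive integers. Any other cell through the point must be free there with the same
  corner, and hence contains the whole cell. In this sense a cell is the smallest one through its
  interior points.\<close>

lemma grid_cell_meet:
  assumes x: "x \<in> grid_cell N n a J" "x \<notin> grid_cell_boundary N n a J"
    and x': "x \<in> grid_cell N n a' J'" and J: "J \<subseteq> {..<n}"
  shows "J \<subseteq> J'" "\<And>i. i \<in> J \<Longrightarrow> a' i = a i"
    "\<And>i. i < n \<Longrightarrow> i \<notin> J \<Longrightarrow> i \<in> J' \<Longrightarrow> a i = a' i \<or> a i = a' i + 1"
    "\<And>i. i < n \<Longrightarrow> i \<notin> J' \<Longrightarrow> a i = a' i"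
    "grid_cell N n a J \<subseteq> grid_cell N n a' J'"
proof -
  have J1: "real (a i) < real N * x i" "real N * x i < real (a i) + 1" "i < n" if "i \<in> J" for i
  proof -
    show "i < n" using J that by auto
    then have "real (a i) \<le> real N * x i" "real N * x i \<le> real (a i) + 1"
      using x(1) that unfolding grid_cell_def by auto
    moreover have "real N * x i \<noteq> real (a i)" "real N * x i \<noteq> real (a i) + 1"
      using x that unfolding grid_cell_boundary_def by blast+
    ultimately show "real (a i) < real N * x i" "real N * x i < real (a i) + 1"
      by linarith+
  qed
  have nJ: "real N * x i = real (a i)" if "i \<notin> J" "i < n" for i
    using x(1) that unfolding grid_cell_def by auto
  have J1': "real (a' i) \<le> real N * x i" "real N * x i \<le> real (a' i) + 1" if "i \<in> J'" "i < n" for i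
    using x' that unfolding grid_cell_def by auto
  have nJ': "real N * x i = real (a' i)" if "i \<notin> J'" "i < n" for i
    using x' that unfolding grid_cell_def by auto
  show A: "J \<subseteq> J'"
  proof
    fix i assume i: "i \<in> J"
    show "i \<in> J'"
    proof (rule ccontr)
      assume "i \<notin> J'"
      from nJ'[OF this J1(3)[OF i]] J1(1,2)[OF i] have "a i < a' i" "a' i < a i + 1"
        by simp_all
      then show False
        by simp
    qed
  qed
  show B: "a' i = a i" if "i \<in> J" for i
  proof -
    have "i \<in> J'" using A that by blast
    from J1[OF that] J1'[OF this J1(3)[OF that]] show ?thesis
      by linarith
  qed
  show C: "a i = a' i \<or> a i = a' i + 1" if "i < n" "i \<notin> J" "i \<in> J'" for i
    using nJ[OF that(2,1)] J1'[OF that(3,1)] by linarith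
  show D: "a i = a' i" if "i < n" "i \<notin> J'" for i
  proof -
    have "i \<notin> J" using A that by blast
    from nJ[OF this that(1)] nJ'[OF that(2,1)] show ?thesis
      by linarith
  qed
  show "grid_cell N n a J \<subseteq> grid_cell N n a' J'"
  proof
    fix y assume y: "y \<in> grid_cell N n a J"
    have "if i \<in> J' then real (a' i) \<le> real N * y i \<and> real N * y i \<le> real (a' i) + 1
        else real N * y i = real (a' i)" if i: "i < n" for i
    proof (cases "i \<in> J")
      case True
      then have "i \<in> J'" "a' i = a i"
        using A B by auto
      then show ?thesis
        using y True i unfolding grid_cell_def by auto
    next
      case False
      then have "real N * y i = real (a i)"
        using y i unfolding grid_cell_def by auto
      then show ?thesis
        using C[OF i False] D[OF i] by auto
    qed
    then show "y \<in> grid_cell N n a' J'"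
      using y unfolding grid_cell_def by blast
  qed
qed

text \<open>After rescaling, the cell is a cube of dimension \<open>card J\<close>, whose
  coordinates are matched with the free directions by an arbitrary enumeration
  \<open>b\<close>.\<close>

lemma has_lifts_grid_cell:
  assumes L: "lifting_equivalence f X Y" and c: "(a, J) \<in> grid_cells N n" and N: "N > 0"
  shows "has_lifts f X Y (grid_cell N n a J) (grid_cell_boundary N n a J)"
proof -
  have J: "finite J" "J \<subseteq> {..<n}"
    using c unfolding grid_cells_def by (auto intro: finite_subset)
  define d where "d = card J"
  obtain b where b: "bij_betw b {..<d} J"
    using ex_bij_betw_nat_finite[OF J(1)] unfolding d_def atLeast0LessThan by blast
  define b' where "b' = inv_into {..<d} b"
  have b_in: "b j \<in> J" "b j < n" "b' (b j) = j" if "j < d" for j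
    using that b J(2) unfolding b'_def by (auto simp: bij_betw_def)
  have b'_in: "b' i < d" "b (b' i) = i" if "i \<in> J" for i
    using bij_betwE[OF bij_betw_inv_into[OF b]] bij_betw_inv_into_right[OF b] that unfolding b'_def by auto
  define \<phi> where "\<phi> y i = (if i < n then if i \<in> J then (real (a i) + y (b' i)) / real N else real (a i) / real N
      else undefined)" for y i
  define \<psi> where "\<psi> x j = (if j < d then real N * x (b j) - real (a (b j)) else undefined)" for x j
  have N\<phi>: "real N * \<phi> y i = (if i \<in> J then real (a i) + y (b' i) else real (a i))" if "i < n" for y i
    using that N unfolding \<phi>_def by simp
  have \<phi>_c: "continuous_on S \<phi>" for S
  proof (rule continuous_on_coordinatewise_then_product)
    fix i show "continuous_on S (\<lambda>y. \<phi> y i)"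
      unfolding \<phi>_def by (cases "i < n"; cases "i \<in> J") (use N in \<open>auto intro!: continuous_intros\<close>)
  qed
  have \<psi>_c: "continuous_on S \<psi>" for S
  proof (rule continuous_on_coordinatewise_then_product)
    fix j show "continuous_on S (\<lambda>x. \<psi> x j)"
      unfolding \<psi>_def by (cases "j < d") (auto intro!: continuous_intros)
  qed
  have \<phi>_ext: "\<phi> y \<in> extensional {..<n}" for y
    unfolding extensional_def \<phi>_def by simp
  have \<phi>_mem: "\<phi> y \<in> grid_cell N n a J" if y: "y \<in> cube_set d" for y
    unfolding grid_cell_def
  proof (intro CollectI conjI \<phi>_ext allI impI)
    fix i assume i: "i < n"
    have "0 \<le> y (b' i) \<and> y (b' i) \<le> 1" if "i \<in> J"
      using PiE_mem[OF y, of "b' i"] b'_in(1)[OF that] by simp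
    then show "if i \<in> J then real (a i) \<le> real N * \<phi> y i \<and> real N * \<phi> y i \<le> real (a i) + 1
        else real N * \<phi> y i = real (a i)"
      unfolding N\<phi>[OF i] by simp
  qed
  have \<phi>_bd: "\<phi> y \<in> grid_cell_boundary N n a J" if y: "y \<in> cube_boundary d" for y
  proof -
    obtain j where j: "j < d" "y j = 0 \<or> y j = 1"
      using y unfolding cube_boundary_def by blast
    have "real N * \<phi> y (b j) = real (a (b j)) + y j"
      using N\<phi>[of "b j" y] b_in[OF j(1)] by simp
    with j b_in(1)[OF j(1)] have "\<exists>i\<in>J. real N * \<phi> y i = real (a i) \<or> real N * \<phi> y i = real (a i) + 1"
      by (intro bexI[of _ "b j"]) auto
    then show ?thesis
      unfolding grid_cell_boundary_def using \<phi>_mem cube_boundary_subset y by blast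
  qed
  have \<psi>_mem: "\<psi> x \<in> cube_set d" if x: "x \<in> grid_cell N n a J" for x
  proof (rule PiE_I)
    fix j assume "j \<in> {..<d}"
    then have j: "j < d" by simp
    have "real (a (b j)) \<le> real N * x (b j) \<and> real N * x (b j) \<le> real (a (b j)) + 1"
      using x b_in(1,2)[OF j] unfolding grid_cell_def by auto
    then show "\<psi> x j \<in> \<I>"
      using j unfolding \<psi>_def by simp
  qed (simp add: \<psi>_def)
  have \<psi>_bd: "\<psi> x \<in> cube_boundary d" if x: "x \<in> grid_cell_boundary N n a J" for x
  proof -
    obtain i where i: "i \<in> J" "real N * x i = real (a i) \<or> real N * x i = real (a i) + 1"
      using x unfolding grid_cell_boundary_def by blast
    then have "\<psi> x (b' i) = 0 \<or> \<psi> x (b' i) = 1"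
      using b'_in[OF i(1)] unfolding \<psi>_def by auto
    moreover have "\<psi> x \<in> cube_set d"
      using \<psi>_mem x unfolding grid_cell_boundary_def by blast
    ultimately show ?thesis
      unfolding cube_boundary_def topspace_cube using b'_in(1)[OF i(1)] by blast
  qed
  have inv: "\<phi> (\<psi> x) = x" if x: "x \<in> grid_cell N n a J" for x
  proof
    fix i
    show "\<phi> (\<psi> x) i = x i"
    proof (cases "i < n")
      case True
      have "real N * \<phi> (\<psi> x) i = real N * x i"
      proof (cases "i \<in> J")
        case iJ: True
        then show ?thesis
          unfolding N\<phi>[OF True] \<psi>_def using b'_in[OF iJ] by simp
      next
        case False
        then show ?thesis
          unfolding N\<phi>[OF True] using x True unfolding grid_cell_def by auto
      qed
      then show ?thesis
        using N by simp
    next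
      case False
      then show ?thesis
        using x unfolding grid_cell_def extensional_def \<phi>_def by auto
    qed
  qed
  show ?thesis
  proof (rule has_lifts_homeomorphic[where \<phi>=\<phi> and \<psi>=\<psi>, OF lifting_equivalence_has_lifts[OF L, of d]])
    show "\<phi> ` cube_set d \<subseteq> grid_cell N n a J"
      by (rule image_subsetI) (rule \<phi>_mem)
    show "\<phi> ` cube_boundary d \<subseteq> grid_cell_boundary N n a J"
      by (rule image_subsetI) (rule \<phi>_bd)
    show "\<psi> ` grid_cell N n a J \<subseteq> cube_set d"
      by (rule image_subsetI) (rule \<psi>_mem)
    show "\<psi> ` grid_cell_boundary N n a J \<subseteq> cube_boundary d"
      by (rule image_subsetI) (rule \<psi>_bd)
    show "\<phi> (\<psi> x) = x" if "x \<in> grid_cell N n a J" for x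
      by (rule inv[OF that])
    show "grid_cell_boundary N n a J \<subseteq> grid_cell N n a J"
      unfolding grid_cell_boundary_def by blast
  qed (rule \<phi>_c \<psi>_c cube_boundary_subset)+
qed

text \<open>Freeze one free direction in which the point sits at an end of its interval. The new
  corner stays within the grid because \<open>a i < N\<close> in free directions.\<close>

lemma grid_cell_boundary_in_face:
  assumes c: "(a, J) \<in> grid_cells N n" and x: "x \<in> grid_cell_boundary N n a J"
  obtains a' J' where "(a', J') \<in> grid_cells N n" "card J' < card J" "x \<in> grid_cell N n a' J'"
proof -
  have aJ: "a \<in> {..<n} \<rightarrow>\<^sub>E {..N}" "J \<subseteq> {..<n}" "\<And>i. i \<in> J \<Longrightarrow> a i < N"
    using c unfolding grid_cells_def by auto
  obtain i where i: "i \<in> J" and xi: "real N * x i = real (a i) \<or> real N * x i = real (a i) + 1"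
    and xc: "x \<in> grid_cell N n a J"
    using x unfolding grid_cell_boundary_def by blast
  define k where "k = (if real N * x i = real (a i) then a i else a i + 1)"
  have k: "real N * x i = real k" "k \<le> N"
    using xi aJ(3)[OF i] unfolding k_def by (auto split: if_splits)
  have "i < n"
    using i aJ(2) by auto
  have "a(i := k) \<in> insert i {..<n} \<rightarrow>\<^sub>E {..N}"
    by (rule PiE_fun_upd[OF _ aJ(1)]) (use k in simp)
  then have "a(i := k) \<in> {..<n} \<rightarrow>\<^sub>E {..N}"
    using \<open>i < n\<close> by (simp add: insert_absorb)
  then have "(a(i := k), J - {i}) \<in> grid_cells N n"
    using aJ unfolding grid_cells_def by auto
  moreover have "card (J - {i}) < card J"
    using i finite_subset[OF aJ(2)] by (intro card_Diff1_less) simp_all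
  moreover have "x \<in> grid_cell N n (a(i := k)) (J - {i})"
    using xc k(1) unfolding grid_cell_def by auto
  ultimately show ?thesis
    by (rule that)
qed

text \<open>An interior point of the first cell would force \<open>J \<subseteq> J'\<close> by
  \<open>grid_cell_meet\<close>; the comparison of dimensions then makes the two cells
  equal.\<close>

lemma grid_cell_inter_smaller:
  assumes c: "(a, J) \<in> grid_cells N n" and c': "(a', J') \<in> grid_cells N n"
    and card: "card J' \<le> card J" and ne: "(a, J) \<noteq> (a', J')"
    and x: "x \<in> grid_cell N n a J" "x \<in> grid_cell N n a' J'"
  shows "x \<in> grid_cell_boundary N n a J"
proof (rule ccontr)
  assume nb: "x \<notin> grid_cell_boundary N n a J"
  have J: "J \<subseteq> {..<n}" "J' \<subseteq> {..<n}" and ext: "a \<in> extensional {..<n}" "a' \<in> extensional {..<n}"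
    using c c' unfolding grid_cells_def by (auto simp: PiE_def)
  note meet = grid_cell_meet[OF x(1) nb x(2) J(1)]
  have "J = J'"
    using meet(1) card J(2) by (meson card_seteq finite_lessThan finite_subset)
  moreover have "a = a'"
  proof (rule extensionalityI[OF ext])
    show "a i = a' i" if "i \<in> {..<n}" for i
      using that meet(2,4)[of i] \<open>J = J'\<close> by (cases "i \<in> J") auto
  qed
  ultimately show False
    using ne by simp
qed

text \<open>At an interior point of the cell, free coordinates lie strictly between 0 and 1. So the
  coordinate that is 0 or 1 is a frozen one, and all points of the cell share it.\<close>

lemma grid_cell_inter_cube_boundary:
  assumes c: "(a, J) \<in> grid_cells N n" and N: "N > 0" and x: "x \<in> grid_cell N n a J" "x \<in> cube_boundary n"
    and nb: "\<not> grid_cell N n a J \<subseteq> cube_boundary n"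
  shows "x \<in> grid_cell_boundary N n a J"
proof (rule ccontr)
  assume nb': "x \<notin> grid_cell_boundary N n a J"
  obtain i where i: "i < n" "x i = 0 \<or> x i = 1"
    using x(2) unfolding cube_boundary_def by blast
  have "i \<notin> J"
  proof
    assume iJ: "i \<in> J"
    then have "real (a i) \<le> real N * x i" "real N * x i \<le> real (a i) + 1"
      using x(1) i(1) unfolding grid_cell_def by auto
    moreover have "real N * x i \<noteq> real (a i)" "real N * x i \<noteq> real (a i) + 1"
      using x(1) nb' iJ unfolding grid_cell_boundary_def by blast+
    moreover have "a i < N"
      using c iJ unfolding grid_cells_def by auto
    ultimately show False
      using i(2) by auto
  qed
  have "y \<in> cube_boundary n" if y: "y \<in> grid_cell N n a J" for y
  proof -
    have "real N * y i = real (a i)" "real N * x i = real (a i)"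
      using y x(1) i(1) \<open>i \<notin> J\<close> unfolding grid_cell_def by auto
    then have "real N * y i = real N * x i"
      by simp
    then have "y i = x i"
      using N by simp
    moreover have "y \<in> cube_set n"
      using y grid_cell_subset[OF c N] by blast
    ultimately show ?thesis
      unfolding cube_boundary_def topspace_cube using i by auto
  qed
  with nb show False
    by blast
qed

lemma top_grid_cell: "c \<in> {..<n} \<rightarrow>\<^sub>E {..<N} \<Longrightarrow> (c, {..<n}) \<in> grid_cells N n"
  unfolding grid_cells_def by (auto simp: PiE_iff less_imp_le)

lemma grid_cell_in_top:
  assumes c: "(a, J) \<in> grid_cells N n" and N: "N > 0"
  obtains c where "c \<in> {..<n} \<rightarrow>\<^sub>E {..<N}" "grid_cell N n a J \<subseteq> grid_cell N n c {..<n}"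
proof -
  \<comment> \<open>A frozen coordinate at \<open>N\<close> is the upper end of the last interval,
    whose lower corner is \<open>N - 1\<close>.\<close>
  define c where "c i = (if i < n then if a i = N then N - 1 else a i else undefined)" for i
  have aJ: "\<And>i. i < n \<Longrightarrow> a i \<le> N" "\<And>i. i \<in> J \<Longrightarrow> a i < N"
    using assms unfolding grid_cells_def by (auto simp: PiE_iff)
  have "c \<in> {..<n} \<rightarrow>\<^sub>E {..<N}"
  proof (rule PiE_I)
    show "c i \<in> {..<N}" if "i \<in> {..<n}" for i
      using that aJ(1)[of i] N unfolding c_def by auto
  qed (simp add: c_def)
  moreover have "grid_cell N n a J \<subseteq> grid_cell N n c {..<n}"
  proof
    fix x assume x: "x \<in> grid_cell N n a J"
    have "real (c i) \<le> real N * x i \<and> real N * x i \<le> real (c i) + 1" if i: "i < n" for i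
    proof (cases "i \<in> J")
      case True
      then have "c i = a i"
        using aJ(2)[OF True] i unfolding c_def by simp
      then show ?thesis
        using x True i unfolding grid_cell_def by auto
    next
      case False
      then have "real N * x i = real (a i)"
        using x i unfolding grid_cell_def by auto
      moreover have "c i = a i \<or> c i + 1 = a i"
        using i N unfolding c_def by auto
      ultimately show ?thesis
        by auto
    qed
    then show "x \<in> grid_cell N n c {..<n}"
      using x unfolding grid_cell_def by auto
  qed
  ultimately show ?thesis
    by (rule that)
qed

lemma cube_set_top_grid_cell:
  assumes x: "x \<in> cube_set n" and N: "N > 0"
  obtains c where "c \<in> {..<n} \<rightarrow>\<^sub>E {..<N}" "x \<in> grid_cell N n c {..<n}"
proof -
  \<comment> \<open>The floor alone would give \<open>N\<close> when \<open>x i = 1\<close>; capping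
    it at \<open>N - 1\<close> selects the last interval.\<close>
  define c where "c i = (if i < n then min (N - 1) (nat \<lfloor>real N * x i\<rfloor>) else undefined)" for i
  have "c \<in> {..<n} \<rightarrow>\<^sub>E {..<N}"
  proof (rule PiE_I)
    show "c i \<in> {..<N}" if "i \<in> {..<n}" for i
      using that N unfolding c_def by auto
  qed (simp add: c_def)
  moreover have "x \<in> grid_cell N n c {..<n}"
    unfolding grid_cell_def
  proof (intro CollectI conjI allI impI)
    show "x \<in> extensional {..<n}"
      using x by (simp add: PiE_def)
    fix i assume i: "i < n"
    have xi: "0 \<le> x i" "x i \<le> 1"
      using PiE_mem[OF x, of i] i by simp_all
    define y where "y = real N * x i"
    have y: "0 \<le> y" "y \<le> real N"
      using xi N unfolding y_def by (simp_all add: mult_left_le)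
    have ci: "c i = min (N - 1) (nat \<lfloor>y\<rfloor>)"
      using i unfolding c_def y_def by simp
    have f: "real (nat \<lfloor>y\<rfloor>) \<le> y" "y \<le> real (nat \<lfloor>y\<rfloor>) + 1"
      using y(1) by linarith+
    have "real (c i) \<le> y \<and> y \<le> real (c i) + 1"
    proof (cases "nat \<lfloor>y\<rfloor> \<le> N - 1")
      case True
      then show ?thesis
        unfolding ci using f by (simp add: min_absorb2)
    next
      case False
      then have "c i = N - 1" "real N \<le> real (nat \<lfloor>y\<rfloor>)"
        unfolding ci using N by auto
      moreover from this(1) N have "real (c i) = real N - 1"
        by (simp add: of_nat_diff)
      ultimately show ?thesis
        using f y by linarith
    qed
    then show "if i \<in> {..<n} then real (c i) \<le> real N * x i \<and> real N * x i \<le> real (c i) + 1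
      else real N * x i = real (c i)"
      using i unfolding y_def by simp
  qed
  ultimately show ?thesis
    by (rule that)
qed

section \<open>Grids subordinate to an open cover\<close>

lemma compact_cube_set: "compact (cube_set n)"
proof -
  have "compact_space (cube n)"
    unfolding cube_def by (simp add: compact_space_product_topology compact_space_subtopology)
  then show ?thesis
    unfolding cube_eq_top_of_set by (metis compactin_euclidean_iff compactin_subspace subset_UNIV topspace_euclidean)
qed

text \<open>The metric on functions is bounded by twice the maximum over finitely many coordinates,
  here at most \<open>1 / N\<close> each, plus a geometric tail depending on how many of them are
  inspected.\<close>

lemma dist_grid_cell_le:
  assumes N: "N > 0" and x: "x \<in> grid_cell N n c {..<n}" and y: "y \<in> grid_cell N n c {..<n}"
  shows "dist x y \<le> 2 * (1 / real N) + (1/2) ^ k"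
proof -
  have "dist (x i) (y i) \<le> 1 / real N" for i
  proof (cases "i < n")
    case True
    then have "\<bar>real N * x i - real N * y i\<bar> \<le> 1"
      using x y unfolding grid_cell_def by (auto simp: abs_le_iff) (smt (verit))+
    then have "real N * \<bar>x i - y i\<bar> \<le> 1"
      by (metis abs_mult abs_of_nat right_diff_distrib)
    then show ?thesis
      using N by (simp add: dist_real_def field_simps)
  next
    case False
    then have "x i = y i"
      using x y unfolding grid_cell_def extensional_def by auto
    then show ?thesis
      by simp
  qed
  then have "Max {dist (x (from_nat j)) (y (from_nat j)) | j. j \<le> k} \<le> 1 / real N"
    by (subst Max_le_iff) (auto simp: setcompr_eq_image)
  then show ?thesis
    using dist_fun_le_dist_first_terms[of x y k] by linarith
qed

text \<open>A Lebesgue number argument: the preimages of the cover are relatively open in the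
  compact cube, and small cells fit into balls around their corners.\<close>

lemma fine_grid:
  assumes v: "continuous_to (cube_set n) Y v" and V: "\<And>i. i \<in> M \<Longrightarrow> openin Y (V i)"
    and cover: "topspace Y \<subseteq> (\<Union>i\<in>M. V i)"
  obtains N \<iota> where "N > 0" "\<And>c. c \<in> {..<n} \<rightarrow>\<^sub>E {..<N} \<Longrightarrow> \<iota> c \<in> M \<and> v ` grid_cell N n c {..<n} \<subseteq> V (\<iota> c)"
proof -
  have "\<exists>O'. open O' \<and> {x \<in> cube_set n. v x \<in> V i} = O' \<inter> cube_set n" if "i \<in> M" for i
    using openin_continuous_map_preimage[OF v V[OF that]] by (simp add: openin_subtopology)
  then have "\<forall>i\<in>M. \<exists>O'. open O' \<and> {x \<in> cube_set n. v x \<in> V i} = O' \<inter> cube_set n"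
    by blast
  from bchoice[OF this] obtain U where U0: "\<forall>i\<in>M. open (U i) \<and> {x \<in> cube_set n. v x \<in> V i} = U i \<inter> cube_set n" ..
  then have U: "open (U i)" "{x \<in> cube_set n. v x \<in> V i} = U i \<inter> cube_set n" if "i \<in> M" for i
    using that by simp_all
  have cov: "cube_set n \<subseteq> \<Union> (U ` M)"
  proof
    fix x assume x: "x \<in> cube_set n"
    then obtain i where "i \<in> M" "v x \<in> V i"
      using continuous_to_mem[OF v x] cover by blast
    then show "x \<in> \<Union> (U ` M)"
      using U(2)[of i] x by blast
  qed
  have "\<And>G. G \<in> U ` M \<Longrightarrow> open G"
    using U(1) by blast
  then obtain e where e: "e > 0" "\<And>x. x \<in> cube_set n \<Longrightarrow> \<exists>G\<in>U ` M. ball x e \<subseteq> G"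
    using Heine_Borel_lemma[OF compact_cube_set cov] by metis
  \<comment> \<open>One half of \<open>e\<close> is spent on the tail \<open>(1/2) ^ k\<close>, the
    other half on \<open>2 / N\<close>, which explains \<open>e / 4\<close> below.\<close>
  obtain k where k: "(1/2::real) ^ k < e / 2"
    using e(1) real_arch_pow_inv[of "e / 2" "1/2"] by auto
  obtain N where N: "N > 0" "inverse (real N) < e / 4"
    using e(1) real_arch_inverse[of "e / 4"] by (metis half_gt_zero_iff divide_pos_pos gr0I less_irrefl of_nat_0_eq_iff zero_less_numeral)
  have "\<exists>i\<in>M. v ` grid_cell N n c {..<n} \<subseteq> V i" if c: "c \<in> {..<n} \<rightarrow>\<^sub>E {..<N}" for c
  proof -
    have sub: "grid_cell N n c {..<n} \<subseteq> cube_set n"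
      by (rule grid_cell_subset[OF top_grid_cell[OF c] N(1)])
    define x where "x i = (if i < n then real (c i) / real N else undefined)" for i
    have x: "x \<in> grid_cell N n c {..<n}"
      using N(1) unfolding grid_cell_def extensional_def x_def by simp
    then obtain i where i: "i \<in> M" "ball x e \<subseteq> U i"
      using e(2) sub by blast
    have "grid_cell N n c {..<n} \<subseteq> ball x e"
    proof
      fix y assume "y \<in> grid_cell N n c {..<n}"
      from dist_grid_cell_le[OF N(1) x this, of k] have "dist x y < e"
        using k N(2) unfolding inverse_eq_divide by linarith
      then show "y \<in> ball x e"
        by simp
    qed
    then show ?thesis
      using i U(2)[OF i(1)] sub by blast
  qed
  then obtain \<iota> where "\<And>c. c \<in> {..<n} \<rightarrow>\<^sub>E {..<N} \<Longrightarrow> \<iota> c \<in> M \<and> v ` grid_cell N n c {..<n} \<subseteq> V (\<iota> c)"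
    by metis
  with N(1) show ?thesis
    by (rule that)
qed

text \<open>Induction over the skeleta of a fine grid. At every point \<open>x\<close>, the homotopy stays inside the sets
  \<open>V (\<iota> c)\<close> of all top cells \<open>c\<close> containing \<open>x\<close>; on an open cell this is a finite intersection of
  members of the cover, the same for all of its points.\<close>

theorem lifting_equivalence_open_cover:
  assumes f: "continuous_map X Y f" and V: "\<And>i. i \<in> M \<Longrightarrow> openin Y (V i)"
    and cover: "topspace Y \<subseteq> (\<Union>i\<in>M. V i)"
    and loc: "\<And>S. finite S \<Longrightarrow> S \<noteq> {} \<Longrightarrow> S \<subseteq> M \<Longrightarrow>
      lifting_equivalence f (subtopology X {x \<in> topspace X. f x \<in> (\<Inter>i\<in>S. V i)}) (subtopology Y (\<Inter>i\<in>S. V i))"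
  shows "lifting_equivalence f X Y"
proof (rule lifting_equivalenceI_strict[OF f])
  fix n u0 v
  let ?C = "cube_set n" and ?B = "cube_boundary n"
  assume u0: "continuous_to ?B X u0" and v: "continuous_to ?C Y v" and uv: "\<And>b. b \<in> ?B \<Longrightarrow> v b = f (u0 b)"
  obtain N \<iota> where N: "N > 0"
    and \<iota>: "\<And>c. c \<in> {..<n} \<rightarrow>\<^sub>E {..<N} \<Longrightarrow> \<iota> c \<in> M \<and> v ` grid_cell N n c {..<n} \<subseteq> V (\<iota> c)"
    using fine_grid[OF v V cover] by blast
  define cells where "cells = grid_cells N n"
  define cell where "cell e = grid_cell N n (fst e) (snd e)" for e
  define bd where "bd e = grid_cell_boundary N n (fst e) (snd e)" for e
  define dim where "dim e = card (snd e)" for e :: "(nat \<Rightarrow> nat) \<times> nat set"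
  define idx where "idx x = \<iota> ` {c \<in> {..<n} \<rightarrow>\<^sub>E {..<N}. x \<in> grid_cell N n c {..<n}}" for x
  \<comment> \<open>Indices of the top cells containing all of \<open>e\<close>. At interior points
    of \<open>e\<close> this set equals \<open>idx\<close>; at boundary points \<open>idx\<close>
    can be larger, so data on the boundary satisfy at least the constraints of
    \<open>e\<close>.\<close>
  define S where "S e = \<iota> ` {c \<in> {..<n} \<rightarrow>\<^sub>E {..<N}. cell e \<subseteq> grid_cell N n c {..<n}}" for e
  \<comment> \<open>Strict inequality on dimensions makes \<open>A 0\<close> the boundary of the
    cube, where the data are prescribed, and \<open>A (Suc n)\<close> everything.\<close>
  define A where "A d = ?B \<union> \<Union> (cell ` {e \<in> cells. dim e < d})" for d
  have fin: "finite cells"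
    unfolding cells_def by (rule finite_grid_cells)
  have cell_sub: "cell e \<subseteq> ?C" if "e \<in> cells" for e
    using grid_cell_subset[of "fst e" "snd e", OF _ N] that unfolding cells_def cell_def by simp
  have bd_sub: "bd e \<subseteq> cell e" for e
    unfolding bd_def cell_def grid_cell_boundary_def by blast
  have A_sub: "A d \<subseteq> ?C" for d
    unfolding A_def using cell_sub cube_boundary_subset by blast
  have cl_cell: "closedin (top_of_set ?C) (cell e)" if "e \<in> cells" for e
    using closed_grid_cell[of n N "fst e" "snd e"] cell_sub[OF that] unfolding cell_def by (simp add: Int_absorb1)
  have clB: "closedin (top_of_set ?C) ?B"
    using cofibered_pair_cube[of n] by (simp add: cofibered_pair_def)
  have cl_A: "closedin (top_of_set ?C) (A d)" for d
    unfolding A_def using fin by (intro closedin_Un clB closedin_Union finite_imageI) (auto intro: cl_cell)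
  have bd_A: "bd e \<subseteq> A (dim e)" if e: "e \<in> cells" for e
  proof
    fix x assume x: "x \<in> bd e"
    have "(fst e, snd e) \<in> grid_cells N n"
      using e unfolding cells_def by simp
    then obtain a' J' where "(a', J') \<in> cells" "card J' < dim e" "x \<in> cell (a', J')"
      using grid_cell_boundary_in_face x unfolding bd_def cells_def dim_def cell_def fst_conv snd_conv by metis
    then show "x \<in> A (dim e)"
      unfolding A_def dim_def by force
  qed
  have meet_le: "x \<in> bd e" if "e \<in> cells" "e' \<in> cells" "dim e' \<le> dim e" "e \<noteq> e'" "x \<in> cell e" "x \<in> cell e'" for e e' x
    using grid_cell_inter_smaller[of "fst e" "snd e" N n "fst e'" "snd e'" x] that
    unfolding cells_def dim_def cell_def bd_def by (simp add: prod_eq_iff)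
  have meet_A: "x \<in> bd e" if m: "e \<in> cells" "\<not> cell e \<subseteq> ?B" "x \<in> cell e" "x \<in> A (dim e)" for e x
  proof (cases "x \<in> ?B")
    case True
    then show ?thesis
      using grid_cell_inter_cube_boundary[of "fst e" "snd e" N n x] m N
      unfolding cells_def cell_def bd_def by simp
  next
    case False
    then obtain e' where e': "e' \<in> cells" "dim e' < dim e" "x \<in> cell e'"
      using m(4) unfolding A_def by blast
    show ?thesis
      by (rule meet_le[OF m(1) e'(1) _ _ m(3) e'(3)]) (use e'(2) in auto)
  qed
  have fin_top: "finite ({..<n} \<rightarrow>\<^sub>E {..<N})"
    by (intro finite_PiE) simp_all
  have S_fin: "finite (S e)" "S e \<subseteq> M" for e
    unfolding S_def using fin_top \<iota> by auto
  have S_ne: "S e \<noteq> {}" if e: "e \<in> cells" for e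
  proof -
    have "(fst e, snd e) \<in> grid_cells N n"
      using e unfolding cells_def by simp
    from grid_cell_in_top[OF this N] obtain c where
      "c \<in> {..<n} \<rightarrow>\<^sub>E {..<N}" "grid_cell N n (fst e) (snd e) \<subseteq> grid_cell N n c {..<n}" .
    then show ?thesis
      unfolding S_def cell_def by blast
  qed
  have idx_S: "idx x \<subseteq> S e" if "e \<in> cells" "x \<in> cell e" "x \<notin> bd e" for x e
  proof -
    have "snd e \<subseteq> {..<n}"
      using that(1) unfolding cells_def grid_cells_def by auto
    then have "cell e \<subseteq> grid_cell N n c {..<n}" if "x \<in> grid_cell N n c {..<n}" for c
      using grid_cell_meet(5)[of x N n "fst e" "snd e" c "{..<n}"] \<open>x \<in> cell e\<close> \<open>x \<notin> bd e\<close> that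
      unfolding cell_def bd_def by blast
    then show ?thesis
      unfolding idx_def S_def by blast
  qed
  have S_idx: "S e \<subseteq> idx x" if "x \<in> cell e" for x e
    using that unfolding idx_def S_def by blast
  have v_idx: "v x \<in> V j" if "j \<in> idx x" "x \<in> ?C" for x j
    using that \<iota> unfolding idx_def by blast
  have skeleton: "\<exists>u h. continuous_to (A d) X u \<and> continuous_to (\<I> \<times> A d) Y h \<and>
      (\<forall>b\<in>?B. u b = u0 b) \<and> (\<forall>t\<in>\<I>. \<forall>b\<in>?B. h (t, b) = f (u0 b)) \<and>
      (\<forall>x\<in>A d. h (0, x) = f (u x) \<and> h (1, x) = v x) \<and>
      (\<forall>t\<in>\<I>. \<forall>x\<in>A d. \<forall>j\<in>idx x. h (t, x) \<in> V j)" for d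
  proof (induction d)
    case 0
    have A0: "A 0 = ?B"
      unfolding A_def by simp
    have "continuous_to (\<I> \<times> ?B) Y (\<lambda>z. f (u0 (snd z)))"
      by (rule continuous_to_compose[OF continuous_to_map[OF u0 f]]) (auto intro!: continuous_intros)
    moreover have "f (u0 b) \<in> V j" if "b \<in> ?B" "j \<in> idx b" for b j
      using v_idx[OF that(2)] uv[OF that(1)] that(1) cube_boundary_subset by (metis subsetD)
    ultimately show ?case
      unfolding A0 using u0 uv by (intro exI[of _ u0] exI[of _ "\<lambda>z. f (u0 (snd z))"]) simp
  next
    case (Suc d)
    then obtain u h where u: "continuous_to (A d) X u" and h: "continuous_to (\<I> \<times> A d) Y h"
      and ub: "\<forall>b\<in>?B. u b = u0 b" and hb: "\<forall>t\<in>\<I>. \<forall>b\<in>?B. h (t, b) = f (u0 b)"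
      and h01: "\<forall>x\<in>A d. h (0, x) = f (u x) \<and> h (1, x) = v x"
      and hV: "\<forall>t\<in>\<I>. \<forall>x\<in>A d. \<forall>j\<in>idx x. h (t, x) \<in> V j"
      by blast
    \<comment> \<open>Cells within the boundary of the cube are left out: lift and homotopy are
      prescribed there from the start.\<close>
    define E where "E = {e \<in> cells. dim e = d \<and> \<not> cell e \<subseteq> ?B}"
    have E: "e \<in> cells" "dim e = d" "\<not> cell e \<subseteq> ?B" if "e \<in> E" for e
      using that unfolding E_def by auto
    have bdA: "bd e \<subseteq> A d" if "e \<in> E" for e
      using bd_A[OF E(1)[OF that]] E(2)[OF that] by simp
    define good where "good e u' h' \<longleftrightarrow> continuous_to (cell e) X u' \<and> continuous_to (\<I> \<times> cell e) Y h' \<and>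
        (\<forall>x\<in>bd e. u' x = u x) \<and> (\<forall>t\<in>\<I>. \<forall>x\<in>bd e. h' (t, x) = h (t, x)) \<and>
        (\<forall>x\<in>cell e. h' (0, x) = f (u' x) \<and> h' (1, x) = v x) \<and>
        (\<forall>t\<in>\<I>. \<forall>x\<in>cell e. \<forall>j\<in>S e. h' (t, x) \<in> V j)" for e u' h'
    have "\<exists>u' h'. good e u' h'" if e: "e \<in> E" for e
    proof -
      \<comment> \<open>Solving the problem over this intersection keeps the new homotopy inside
        every required member of the cover, which is the last clause of the induction.\<close>
      let ?W = "\<Inter>j\<in>S e. V j"
      let ?X = "subtopology X {x \<in> topspace X. f x \<in> ?W}" and ?Y = "subtopology Y ?W"
      have "(fst e, snd e) \<in> grid_cells N n"
        using E(1)[OF e] unfolding cells_def by simp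
      from has_lifts_grid_cell[OF loc[OF S_fin(1) S_ne[OF E(1)[OF e]] S_fin(2)] this N]
      have lifts: "has_lifts f ?X ?Y (cell e) (bd e)"
        unfolding cell_def bd_def .
      have hW: "h (t, x) \<in> ?W" if "t \<in> \<I>" "x \<in> bd e" for t x
        using hV that bdA[OF e] S_idx[of x e] bd_sub[of e] by blast
      have "lift_problem f ?X ?Y (cell e) (bd e) u h v"
        unfolding lift_problem_def
      proof (intro conjI ballI)
        have "u x \<in> {x \<in> topspace X. f x \<in> ?W}" if x: "x \<in> bd e" for x
        proof -
          have xA: "x \<in> A d"
            using x bdA[OF e] by blast
          have "f (u x) = h (0, x)"
            using h01 xA by simp
          then have "f (u x) \<in> ?W"
            using hW[of 0 x] x by simp
          with continuous_to_mem[OF u xA] show ?thesis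
            by simp
        qed
        then show "continuous_to (bd e) ?X u"
          using continuous_to_subset[OF u bdA[OF e]] by (auto simp: continuous_map_in_subtopology)
        have "continuous_to (\<I> \<times> bd e) Y h"
          by (rule continuous_to_subset[OF h Sigma_mono[OF order_refl bdA[OF e]]])
        moreover have "h z \<in> ?W" if "z \<in> \<I> \<times> bd e" for z
          using hW[of "fst z" "snd z"] that by (simp only: mem_Times_iff prod.collapse)
        ultimately show "continuous_to (\<I> \<times> bd e) ?Y h"
          by (auto simp: continuous_map_in_subtopology)
        have "v x \<in> ?W" if "x \<in> cell e" for x
          using v_idx[of _ x] S_idx[OF that] cell_sub[OF E(1)[OF e]] that by blast
        then show "continuous_to (cell e) ?Y v"
          using continuous_to_subset[OF v cell_sub[OF E(1)[OF e]]] by (auto simp: continuous_map_in_subtopology)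
        show "h (0, x) = f (u x)" "h (1, x) = v x" if "x \<in> bd e" for x
          using h01 that bdA[OF e] by auto
      qed
      with lifts have "lift_solution f ?X ?Y (cell e) (bd e) u h v"
        unfolding has_lifts_def by blast
      then obtain u' h' where s: "continuous_to (cell e) ?X u'" "continuous_to (\<I> \<times> cell e) ?Y h'"
        "\<forall>x\<in>bd e. u' x = u x" "\<forall>t\<in>\<I>. \<forall>x\<in>bd e. h' (t, x) = h (t, x)"
        "\<forall>x\<in>cell e. h' (0, x) = f (u' x) \<and> h' (1, x) = v x"
        unfolding lift_solution_def by (elim exE conjE)
      have "h' (t, x) \<in> V j" if "t \<in> \<I>" "x \<in> cell e" "j \<in> S e" for t x j
        using continuous_to_mem[OF s(2), of "(t, x)"] that by simp
      then show ?thesis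
        unfolding good_def using s
        by (intro exI[of _ u'] exI[of _ h']) (simp add: continuous_map_in_subtopology)
    qed
    then obtain ue he where good: "\<And>e. e \<in> E \<Longrightarrow> good e (ue e) (he e)"
      by metis
    then have s1: "\<And>e. e \<in> E \<Longrightarrow> continuous_to (cell e) X (ue e)"
      and s2: "\<And>e. e \<in> E \<Longrightarrow> continuous_to (\<I> \<times> cell e) Y (he e)"
      and s3: "\<And>e x. e \<in> E \<Longrightarrow> x \<in> bd e \<Longrightarrow> ue e x = u x"
      and s4: "\<And>e t x. e \<in> E \<Longrightarrow> t \<in> \<I> \<Longrightarrow> x \<in> bd e \<Longrightarrow> he e (t, x) = h (t, x)"
      and s5: "\<And>e x. e \<in> E \<Longrightarrow> x \<in> cell e \<Longrightarrow> he e (0, x) = f (ue e x) \<and> he e (1, x) = v x"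
      and s6: "\<And>e t x j. e \<in> E \<Longrightarrow> t \<in> \<I> \<Longrightarrow> x \<in> cell e \<Longrightarrow> j \<in> S e \<Longrightarrow> he e (t, x) \<in> V j"
      unfolding good_def by simp_all
    \<comment> \<open>\<open>None\<close> stands for the old skeleton and \<open>Some e\<close> for
      a new cell.\<close>
    define T where "T k = (case k of None \<Rightarrow> A d | Some e \<Rightarrow> cell e)" for k
    define U where "U k = (case k of None \<Rightarrow> u | Some e \<Rightarrow> ue e)" for k
    define H where "H k = (case k of None \<Rightarrow> h | Some e \<Rightarrow> he e)" for k
    let ?N = "insert None (Some ` E)"
    have finN: "finite ?N"
      using fin unfolding E_def by simp
    have A_Suc: "A (Suc d) = (\<Union>k\<in>?N. T k)"
    proof -
      have "(\<Union>k\<in>?N. T k) = A d \<union> \<Union> (cell ` E)"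
        unfolding T_def by simp
      also have "\<dots> = A (Suc d)"
      proof
        show "A d \<union> \<Union> (cell ` E) \<subseteq> A (Suc d)"
          unfolding A_def E_def by force
        show "A (Suc d) \<subseteq> A d \<union> \<Union> (cell ` E)"
        proof
          fix x assume "x \<in> A (Suc d)"
          then consider "x \<in> ?B" | e where "e \<in> cells" "dim e < Suc d" "x \<in> cell e"
            unfolding A_def by blast
          then show "x \<in> A d \<union> \<Union> (cell ` E)"
          proof cases
            case 1
            then show ?thesis unfolding A_def by blast
          next
            case (2 e)
            show ?thesis
            proof (cases "dim e < d \<or> cell e \<subseteq> ?B")
              case True
              then show ?thesis
                using 2 unfolding A_def by blast
            next
              case False
              then have "e \<in> E"
                using 2 unfolding E_def by simp
              then show ?thesis
                using 2 by blast
            qed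
          qed
        qed
      qed
      finally show ?thesis
        by simp
    qed
    have T_sub: "T k \<subseteq> A (Suc d)" if "k \<in> ?N" for k
      unfolding A_Suc using that by blast
    have clT: "closedin (top_of_set ?C) (T k)" if "k \<in> ?N" for k
      using that cl_A cl_cell E(1) unfolding T_def by (auto split: option.split)
    \<comment> \<open>Distinct pieces meet only in boundaries of new cells, hence in the old
      skeleton, where all the maps coincide with \<open>u\<close> and \<open>h\<close>.\<close>
    have overlap: "(k = l) \<or> (x \<in> A d \<and> (\<forall>e. k = Some e \<longrightarrow> x \<in> bd e) \<and> (\<forall>e. l = Some e \<longrightarrow> x \<in> bd e))"
      if kl: "k \<in> ?N" "l \<in> ?N" "x \<in> T k" "x \<in> T l" for k l x
    proof -
      consider "k = None" "l = None" | e where "k = None" "l = Some e" "e \<in> E"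
        | e where "k = Some e" "l = None" "e \<in> E" | e e' where "k = Some e" "l = Some e'" "e \<in> E" "e' \<in> E"
        using kl(1,2) by blast
      then show ?thesis
      proof cases
        case (2 e)
        then have "x \<in> bd e"
          using meet_A[of e x] E[of e] kl(3,4) unfolding T_def by simp
        with 2 kl(3) show ?thesis
          unfolding T_def by simp
      next
        case (3 e)
        then have "x \<in> bd e"
          using meet_A[of e x] E[of e] kl(3,4) unfolding T_def by simp
        with 3 kl(4) show ?thesis
          unfolding T_def by simp
      next
        case (4 e e')
        show ?thesis
        proof (cases "e = e'")
          case False
          then have "x \<in> bd e" "x \<in> bd e'"
            using 4 meet_le[of e e' x] meet_le[of e' e x] E[of e] E[of e'] kl(3,4) unfolding T_def by simp_all
          with 4 bdA[of e] show ?thesis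
            by auto
        qed (use 4 in simp)
      qed simp
    qed
    have U_old: "U k x = u x" if "k \<in> ?N" "\<forall>e. k = Some e \<longrightarrow> x \<in> bd e" for k x
      using that s3 unfolding U_def by (auto split: option.split)
    have H_old: "H k (t, x) = h (t, x)" if "k \<in> ?N" "\<forall>e. k = Some e \<longrightarrow> x \<in> bd e" "t \<in> \<I>" for k t x
      using that(1,2) s4[OF _ that(3)] unfolding H_def by (auto split: option.split)
    obtain u1 where u1: "continuous_to (A (Suc d)) X u1" "\<And>k x. k \<in> ?N \<Longrightarrow> x \<in> T k \<Longrightarrow> u1 x = U k x"
    proof (rule continuous_to_paste[OF finN A_Suc, of X U])
      show "closedin (top_of_set (A (Suc d))) (T k)" if "k \<in> ?N" for k
        by (rule closedin_subset_trans[OF clT[OF that] T_sub[OF that] A_sub])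
      show "continuous_to (T k) X (U k)" if "k \<in> ?N" for k
        using that u s1 unfolding T_def U_def by (auto split: option.split)
      show "U k x = U l x" if "k \<in> ?N" "l \<in> ?N" "x \<in> T k" "x \<in> T l" for k l x
        using overlap[OF that] U_old[OF that(1)] U_old[OF that(2)] by metis
    qed (rule that)
    have prod: "\<I> \<times> A (Suc d) = (\<Union>k\<in>?N. \<I> \<times> T k)"
      unfolding A_Suc by blast
    obtain h1 where h1: "continuous_to (\<I> \<times> A (Suc d)) Y h1"
      "\<And>k z. k \<in> ?N \<Longrightarrow> z \<in> \<I> \<times> T k \<Longrightarrow> h1 z = H k z"
    proof (rule continuous_to_paste[OF finN prod, of Y H])
      show "closedin (top_of_set (\<I> \<times> A (Suc d))) (\<I> \<times> T k)" if "k \<in> ?N" for k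
        by (rule closedin_Times[OF closedin_self closedin_subset_trans[OF clT[OF that] T_sub[OF that] A_sub]])
      show "continuous_to (\<I> \<times> T k) Y (H k)" if "k \<in> ?N" for k
        using that h s2 unfolding T_def H_def by (auto split: option.split)
      show "H k z = H l z" if "k \<in> ?N" "l \<in> ?N" "z \<in> \<I> \<times> T k" "z \<in> \<I> \<times> T l" for k l z
      proof -
        have z: "fst z \<in> \<I>" "snd z \<in> T k" "snd z \<in> T l"
          using that(3,4) by (simp_all only: mem_Times_iff)
        show ?thesis
          using overlap[OF that(1,2) z(2,3)] H_old[OF that(1) _ z(1), of "snd z"] H_old[OF that(2) _ z(1), of "snd z"]
          by (metis prod.collapse)
      qed
    qed (rule that)
    have h1': "h1 (t, x) = H k (t, x)" if "k \<in> ?N" "x \<in> T k" "t \<in> \<I>" for k x t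
      using h1(2)[OF that(1), of "(t, x)"] that by simp
    have NoneT: "None \<in> ?N" "T None = A d" "U None = u" "H None = h"
      by (simp_all add: T_def U_def H_def)
    have B_A: "?B \<subseteq> A d"
      unfolding A_def by blast
    show ?case
    proof (intro exI[of _ u1] exI[of _ h1] conjI ballI u1(1) h1(1))
      show "u1 b = u0 b" if "b \<in> ?B" for b
        using u1(2)[OF NoneT(1), of b] ub that B_A NoneT by auto
      show "h1 (t, b) = f (u0 b)" if "t \<in> \<I>" "b \<in> ?B" for t b
        using h1'[OF NoneT(1) _ that(1), of b] hb that B_A NoneT by auto
    next
      fix x assume "x \<in> A (Suc d)"
      then obtain k where k: "k \<in> ?N" "x \<in> T k"
        unfolding A_Suc by blast
      have "H k (0, x) = f (U k x)" "H k (1, x) = v x"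
        using k h01 s5 unfolding T_def H_def U_def by auto
      then show "h1 (0, x) = f (u1 x)" "h1 (1, x) = v x"
        using h1'[OF k, of 0] h1'[OF k, of 1] u1(2)[OF k] by simp_all
    next
      fix t :: real and x j assume t: "t \<in> \<I>" and x: "x \<in> A (Suc d)" and j: "j \<in> idx x"
      show "h1 (t, x) \<in> V j"
      proof (cases "x \<in> A d")
        case True
        then show ?thesis
          using h1'[OF NoneT(1) _ t, of x] hV t j NoneT by auto
      next
        case False
        with x obtain e where e: "e \<in> E" "x \<in> cell e"
          unfolding A_Suc T_def by auto
        \<comment> \<open>A point that is new in this step is interior to its cell, where the
          constraints \<open>idx x\<close> are covered by \<open>S e\<close>.\<close>
        have "x \<notin> bd e"
          using False bdA[OF e(1)] by blast
        then have "j \<in> S e"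
          using idx_S[OF E(1)[OF e(1)] e(2)] j by blast
        moreover have "h1 (t, x) = he e (t, x)"
          using h1'[of "Some e" x t] e t unfolding T_def H_def by simp
        ultimately show ?thesis
          using s6[OF e(1) t e(2)] by simp
      qed
    qed
  qed
  have "A (Suc n) = ?C"
  proof
    show "?C \<subseteq> A (Suc n)"
    proof
      fix x assume "x \<in> ?C"
      from cube_set_top_grid_cell[OF this N] obtain c where
        c: "c \<in> {..<n} \<rightarrow>\<^sub>E {..<N}" "x \<in> grid_cell N n c {..<n}" .
      have "(c, {..<n}) \<in> cells"
        unfolding cells_def by (rule top_grid_cell[OF c(1)])
      moreover have "x \<in> cell (c, {..<n})" "dim (c, {..<n}) < Suc n"
        using c(2) by (simp_all add: cell_def dim_def)
      ultimately show "x \<in> A (Suc n)"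
        unfolding A_def by blast
    qed
  qed (rule A_sub)
  with skeleton[of "Suc n"] show "lift_solution f X Y ?C ?B u0 (\<lambda>z. f (u0 (snd z))) v"
    unfolding lift_solution_def snd_conv by metis
qed

section \<open>Dominant faces\<close>

lemma Delta_plus_homD:
  assumes "\<theta> \<in> Delta_plus_hom m n"
  shows "inj_on \<theta> {..m}" "i \<le> m \<Longrightarrow> \<theta> i \<le> n" "\<theta> \<in> extensional {..m}"
    "i \<le> m \<Longrightarrow> j \<le> m \<Longrightarrow> \<theta> i < \<theta> j \<longleftrightarrow> i < j"
proof -
  have m: "mono_on {..m} \<theta>" and i: "inj_on \<theta> {..m}" and e: "\<theta> \<in> {..m} \<rightarrow>\<^sub>E {..n}"
    using assms unfolding Delta_plus_hom_def Delta_hom_def by auto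
  show "inj_on \<theta> {..m}" "i \<le> m \<Longrightarrow> \<theta> i \<le> n" "\<theta> \<in> extensional {..m}"
    using i e by (auto simp: PiE_iff)
  show "\<theta> i < \<theta> j \<longleftrightarrow> i < j" if ij: "i \<le> m" "j \<le> m"
  proof
    assume "\<theta> i < \<theta> j"
    then show "i < j"
      using mono_onD[OF m, of j i] ij by force
  next
    assume "i < j"
    then have "\<theta> i \<le> \<theta> j" "\<theta> i \<noteq> \<theta> j"
      using mono_onD[OF m, of i j] inj_onD[OF i, of i j] ij by auto
    then show "\<theta> i < \<theta> j"
      by simp
  qed
qed

lemma Delta_plus_homI:
  assumes "\<And>i. i \<le> m \<Longrightarrow> \<theta> i \<le> n" "\<theta> \<in> extensional {..m}"
    "\<And>i j. i < j \<Longrightarrow> j \<le> m \<Longrightarrow> \<theta> i < \<theta> j"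
  shows "\<theta> \<in> Delta_plus_hom m n"
proof -
  have "\<theta> i \<le> \<theta> j" if "i \<le> j" "j \<le> m" for i j
    using assms(3)[of i j] that by (cases "i = j") auto
  then have "mono_on {..m} \<theta>"
    by (intro mono_onI) auto
  moreover have "inj_on \<theta> {..m}"
  proof (rule inj_onI)
    show "i = j" if "i \<in> {..m}" "j \<in> {..m}" "\<theta> i = \<theta> j" for i j
      using assms(3)[of i j] assms(3)[of j i] that by (cases i j rule: linorder_cases) auto
  qed
  ultimately show ?thesis
    using assms(1,2) unfolding Delta_plus_hom_def Delta_hom_def by (auto simp: PiE_iff)
qed

lemma Delta_plus_hom_id: "restrict id {..m} \<in> Delta_plus_hom m m"
  by (rule Delta_plus_homI) auto

lemma Delta_plus_hom_compose:
  assumes "\<phi> \<in> Delta_plus_hom l m" "\<theta> \<in> Delta_plus_hom m n"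
  shows "compose {..l} \<theta> \<phi> \<in> Delta_plus_hom l n"
proof (rule Delta_plus_homI)
  note \<phi> = Delta_plus_homD[OF assms(1)] and \<theta> = Delta_plus_homD[OF assms(2)]
  show "compose {..l} \<theta> \<phi> i \<le> n" if "i \<le> l" for i
    using that \<phi>(2) \<theta>(2) by (simp add: compose_def)
  show "compose {..l} \<theta> \<phi> i < compose {..l} \<theta> \<phi> j" if "i < j" "j \<le> l" for i j
    using that \<phi>(2) \<phi>(4)[of i j] \<theta>(4)[of "\<phi> i" "\<phi> j"] by (simp add: compose_def)
qed (simp add: compose_def)

text \<open>A strictly increasing map lists its image in increasing order, and a finite set has only
  one sorted list without repetitions.\<close>

lemma Delta_plus_hom_unique:
  assumes "\<theta> \<in> Delta_plus_hom m n" "\<theta>' \<in> Delta_plus_hom m n'" "\<theta> ` {..m} = \<theta>' ` {..m}"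
  shows "\<theta> = \<theta>'"
proof -
  have srt: "sorted (map f [0..<Suc m]) \<and> distinct (map f [0..<Suc m])" if "f \<in> Delta_plus_hom m k" for f k
  proof
    have "f i \<le> f j" if "i \<le> j" "j \<le> m" for i j
      using Delta_plus_homD(4)[OF \<open>f \<in> _\<close>, of j i] that by (meson leD leI le_trans)
    then show "sorted (map f [0..<Suc m])"
      by (auto simp: sorted_iff_nth_mono simp del: upt_Suc)
    show "distinct (map f [0..<Suc m])"
      using Delta_plus_homD(1)[OF that] by (auto simp: distinct_map atLeast0LessThan lessThan_Suc_atMost simp del: upt_Suc)
  qed
  have "map \<theta> [0..<Suc m] = map \<theta>' [0..<Suc m]"
    using srt[OF assms(1)] srt[OF assms(2)] assms(3)
    by (intro sorted_distinct_set_unique) (auto simp: atLeast0LessThan lessThan_Suc_atMost simp del: upt_Suc)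
  then have "\<theta> i = \<theta>' i" if "i \<le> m" for i
    using that by (auto simp: less_Suc_eq_le simp del: upt_Suc)
  then show ?thesis
    by (intro extensionalityI[OF Delta_plus_homD(3)[OF assms(1)] Delta_plus_homD(3)[OF assms(2)]]) simp
qed

lemma standard_simplexD:
  assumes "t \<in> standard_simplex n"
  shows "0 \<le> t i" "t i \<le> 1" "i > n \<Longrightarrow> t i = 0" "(\<Sum>i\<le>n. t i) = 1"
  using assms unfolding standard_simplex_def by auto

lemma standard_simplexI:
  assumes "\<And>i. 0 \<le> t i" "\<And>i. i > n \<Longrightarrow> t i = 0" "(\<Sum>i\<le>n. t i) = 1"
  shows "t \<in> standard_simplex n"
proof -
  have "t i \<le> 1" for i
  proof (cases "i \<le> n")
    case True
    then have "t i \<le> (\<Sum>i\<le>n. t i)"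
      using assms(1) by (intro member_le_sum) auto
    then show ?thesis
      using assms(3) by simp
  qed (use assms(2) in simp)
  then show ?thesis
    using assms unfolding standard_simplex_def by auto
qed

lemma simplex_push_image:
  assumes "\<theta> \<in> Delta_plus_hom m n" "i \<le> m"
  shows "simplex_push m \<theta> t (\<theta> i) = t i"
proof -
  have "{k. k \<le> m \<and> \<theta> k = \<theta> i} = {i}"
    using inj_onD[OF Delta_plus_homD(1)[OF assms(1)]] assms(2) by auto
  then show ?thesis
    unfolding simplex_push_def by simp
qed

lemma simplex_push_outside: "j \<notin> \<theta> ` {..m} \<Longrightarrow> simplex_push m \<theta> t j = 0"
  unfolding simplex_push_def by (rule sum.neutral) auto

lemma simplex_push_eqI:
  assumes "\<theta> \<in> Delta_plus_hom m n" "\<And>i. i \<le> m \<Longrightarrow> s (\<theta> i) = t i" "\<And>j. j \<notin> \<theta> ` {..m} \<Longrightarrow> s j = 0"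
  shows "simplex_push m \<theta> t = s"
proof
  fix j show "simplex_push m \<theta> t j = s j"
    using assms(2,3) simplex_push_image[OF assms(1)] simplex_push_outside[of j \<theta> m t]
    by (cases "j \<in> \<theta> ` {..m}") auto
qed

lemma simplex_push_mem:
  assumes \<theta>: "\<theta> \<in> Delta_plus_hom m n" and t: "t \<in> standard_simplex m"
  shows "simplex_push m \<theta> t \<in> standard_simplex n"
proof (rule standard_simplexI)
  show "0 \<le> simplex_push m \<theta> t i" for i
    unfolding simplex_push_def by (rule sum_nonneg) (use standard_simplexD(1)[OF t] in auto)
  have im: "\<theta> ` {..m} \<subseteq> {..n}"
    using Delta_plus_homD(2)[OF \<theta>] by auto
  show "simplex_push m \<theta> t i = 0" if "i > n" for i
    by (rule simplex_push_outside) (use im that in auto)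
  have "(\<Sum>i\<le>n. simplex_push m \<theta> t i) = (\<Sum>i\<in>\<theta> ` {..m}. simplex_push m \<theta> t i)"
    by (rule sum.mono_neutral_right) (use im simplex_push_outside in auto)
  also have "\<dots> = (\<Sum>i\<le>m. simplex_push m \<theta> t (\<theta> i))"
    by (simp add: sum.reindex[OF Delta_plus_homD(1)[OF \<theta>]])
  also have "\<dots> = 1"
    using standard_simplexD(4)[OF t] by (simp add: simplex_push_image[OF \<theta>])
  finally show "(\<Sum>i\<le>n. simplex_push m \<theta> t i) = 1" .
qed

lemma simplex_push_compose:
  assumes \<phi>: "\<phi> \<in> Delta_plus_hom l m" and \<theta>: "\<theta> \<in> Delta_plus_hom m n"
  shows "simplex_push l (compose {..l} \<theta> \<phi>) t = simplex_push m \<theta> (simplex_push l \<phi> t)"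
proof (rule simplex_push_eqI[OF Delta_plus_hom_compose[OF assms]])
  show "simplex_push m \<theta> (simplex_push l \<phi> t) (compose {..l} \<theta> \<phi> i) = t i" if "i \<le> l" for i
    using that Delta_plus_homD(2)[OF \<phi> that]
    by (simp add: compose_def simplex_push_image[OF \<theta>] simplex_push_image[OF \<phi>])
  show "simplex_push m \<theta> (simplex_push l \<phi> t) j = 0" if "j \<notin> compose {..l} \<theta> \<phi> ` {..l}" for j
  proof (cases "j \<in> \<theta> ` {..m}")
    case True
    then obtain i where i: "i \<le> m" "j = \<theta> i"
      by auto
    with that have "i \<notin> \<phi> ` {..l}"
      by (auto simp: compose_def image_iff)
    then show ?thesis
      unfolding i(2) simplex_push_image[OF \<theta> i(1)] by (rule simplex_push_outside)
  qed (rule simplex_push_outside)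
qed

definition convex_comb :: "real \<Rightarrow> (nat \<Rightarrow> real) \<Rightarrow> (nat \<Rightarrow> real) \<Rightarrow> nat \<Rightarrow> real" where
  "convex_comb s t t' = (\<lambda>j. (1 - s) * t j + s * t' j)"

lemma convex_comb_mem:
  assumes "s \<in> \<I>" "t \<in> standard_simplex n" "t' \<in> standard_simplex n"
  shows "convex_comb s t t' \<in> standard_simplex n"
proof (rule standard_simplexI)
  show "0 \<le> convex_comb s t t' i" for i
    using assms standard_simplexD(1)[of t n i] standard_simplexD(1)[of t' n i] by (simp add: convex_comb_def)
  show "convex_comb s t t' i = 0" if "i > n" for i
    using that standard_simplexD(3)[OF assms(2)] standard_simplexD(3)[OF assms(3)] by (simp add: convex_comb_def)
  show "(\<Sum>i\<le>n. convex_comb s t t' i) = 1"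
    unfolding convex_comb_def sum.distrib sum_distrib_left[symmetric]
    using standard_simplexD(4)[OF assms(2)] standard_simplexD(4)[OF assms(3)] by simp
qed

lemma simplex_push_convex_comb:
  assumes "\<theta> \<in> Delta_plus_hom m n"
  shows "simplex_push m \<theta> (convex_comb s t t') = convex_comb s (simplex_push m \<theta> t) (simplex_push m \<theta> t')"
  by (rule simplex_push_eqI[OF assms])
     (simp_all add: convex_comb_def simplex_push_image[OF assms] simplex_push_outside)

text \<open>For \<open>t\<close> in a simplex this says that \<open>t\<close> lies in the open star of the barycentre of the face \<open>T\<close>
  in the barycentric subdivision.\<close>

definition dominant :: "nat set \<Rightarrow> (nat \<Rightarrow> real) \<Rightarrow> bool" where
  "dominant T t \<longleftrightarrow> (\<forall>i\<in>T. \<forall>j. j \<notin> T \<longrightarrow> t j < t i)"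

text \<open>Dominance compares with every natural number outside \<open>T\<close>, also beyond
  \<open>n\<close>, where \<open>t\<close> vanishes. For a finite \<open>T\<close> this forces
  positive coordinates on \<open>T\<close>, and thereby makes \<open>T\<close> a face of the
  simplex.\<close>

lemma dominant_pos:
  assumes "dominant T t" "finite T" "i \<in> T" "t \<in> standard_simplex n"
  shows "0 < t i" "i \<le> n"
proof -
  obtain j where "j \<notin> T"
    using assms(2) ex_new_if_finite infinite_UNIV_nat by blast
  then have "t j < t i"
    using assms(1,3) unfolding dominant_def by blast
  then show "0 < t i"
    using standard_simplexD(1)[OF assms(4), of j] by simp
  then show "i \<le> n"
    using standard_simplexD(3)[OF assms(4), of i] by force
qed

text \<open>An element of \<open>T\<close> outside \<open>T'\<close> and one of \<open>T'\<close>
  outside \<open>T\<close> would each have the strictly larger coordinate. So finite dominant sets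
  are nested, with at most one for each cardinality.\<close>

lemma dominant_subset:
  assumes "dominant T t" "dominant T' t" "finite T" "finite T'" "card T \<le> card T'"
  shows "T \<subseteq> T'"
proof (rule ccontr)
  assume "\<not> T \<subseteq> T'"
  then obtain i where i: "i \<in> T" "i \<notin> T'"
    by blast
  have "T' \<subseteq> T"
  proof
    fix j assume j: "j \<in> T'"
    show "j \<in> T"
    proof (rule ccontr)
      assume "j \<notin> T"
      then have "t j < t i" "t i < t j"
        using assms(1,2) i j unfolding dominant_def by blast+
      then show False
        by simp
    qed
  qed
  with i have "card T' < card T"
    using assms(3) by (intro psubset_card_mono) auto
  with assms(5) show False
    by simp
qed

lemma dominant_unique:
  assumes "dominant T t" "dominant T' t" "finite T" "finite T'" "card T = card T'"
  shows "T = T'"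
  using dominant_subset[of T t T'] dominant_subset[of T' t T] assms by auto

text \<open>Pushing along an injection relabels the coordinates and inserts zeros. The inserted
  zeros lose every comparison because coordinates on a finite dominant set are positive.\<close>

lemma dominant_push_iff:
  assumes \<theta>: "\<theta> \<in> Delta_plus_hom m n" and t: "t \<in> standard_simplex m" and T: "T \<subseteq> {..m}"
  shows "dominant (\<theta> ` T) (simplex_push m \<theta> t) \<longleftrightarrow> dominant T t"
proof
  assume d: "dominant (\<theta> ` T) (simplex_push m \<theta> t)"
  show "dominant T t"
    unfolding dominant_def
  proof (intro ballI allI impI)
    fix i j assume i: "i \<in> T" and j: "j \<notin> T"
    have im: "i \<le> m" using i T by auto
    show "t j < t i"
    proof (cases "j \<le> m")
      case True
      then have "\<theta> j \<notin> \<theta> ` T"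
        using j T inj_on_image_mem_iff[OF Delta_plus_homD(1)[OF \<theta>], of j T] by auto
      then have "simplex_push m \<theta> t (\<theta> j) < simplex_push m \<theta> t (\<theta> i)"
        using d i unfolding dominant_def by blast
      then show ?thesis
        using True im by (simp add: simplex_push_image[OF \<theta>])
    next
      case False
      have "finite (\<theta> ` T)"
        using T finite_subset by blast
      from dominant_pos(1)[OF d this _ simplex_push_mem[OF \<theta> t], of "\<theta> i"]
      have "0 < t i"
        using i im by (simp add: simplex_push_image[OF \<theta>])
      then show ?thesis
        using False standard_simplexD(3)[OF t, of j] by simp
    qed
  qed
next
  assume d: "dominant T t"
  show "dominant (\<theta> ` T) (simplex_push m \<theta> t)"
    unfolding dominant_def
  proof (intro ballI allI impI)
    fix k j assume "k \<in> \<theta> ` T" and j: "j \<notin> \<theta> ` T"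
    then obtain i where i: "i \<in> T" "k = \<theta> i"
      by blast
    have im: "i \<le> m" using i T by auto
    have ti: "simplex_push m \<theta> t k = t i"
      unfolding i(2) by (rule simplex_push_image[OF \<theta> im])
    show "simplex_push m \<theta> t j < simplex_push m \<theta> t k"
    proof (cases "j \<in> \<theta> ` {..m}")
      case True
      then obtain j' where j': "j' \<le> m" "j = \<theta> j'"
        by auto
      then have "j' \<notin> T"
        using j by blast
      then have "t j' < t i"
        using d i unfolding dominant_def by blast
      then show ?thesis
        unfolding ti j'(2) simplex_push_image[OF \<theta> j'(1)] .
    next
      case False
      have "finite T"
        using T finite_subset by blast
      from dominant_pos(1)[OF d this i(1) t] show ?thesis
        unfolding ti simplex_push_outside[OF False] .
    qed
  qed
qed

lemma dominant_convex_comb: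
  assumes "dominant T t" "dominant T t'" "s \<in> \<I>"
  shows "dominant T (convex_comb s t t')"
  unfolding dominant_def convex_comb_def
proof (intro ballI allI impI)
  fix i j assume ij: "i \<in> T" "j \<notin> T"
  then have lt: "t j < t i" "t' j < t' i"
    using assms(1,2) unfolding dominant_def by blast+
  show "(1 - s) * t j + s * t' j < (1 - s) * t i + s * t' i"
  \<comment> \<open>For \<open>s > 0\<close> the comparison for \<open>t'\<close> stays strict after
    scaling; for \<open>s = 0\<close> only the comparison for \<open>t\<close> is left.\<close>
  proof (cases "s = 0")
    case False
    then have "s * t' j < s * t' i" "(1 - s) * t j \<le> (1 - s) * t i"
      using assms(3) lt by (auto intro: mult_left_mono)
    then show ?thesis
      by simp
  qed (use lt in simp)
qed

lemma dominant_push_in_image: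
  assumes \<theta>: "\<theta> \<in> Delta_plus_hom m n" and t: "t \<in> standard_simplex m"
    and T: "finite T" "dominant T (simplex_push m \<theta> t)"
  shows "T \<subseteq> \<theta> ` {..m}"
proof
  fix i assume "i \<in> T"
  from dominant_pos(1)[OF T(2,1) this simplex_push_mem[OF \<theta> t]] show "i \<in> \<theta> ` {..m}"
    using simplex_push_outside[of i \<theta> m t] by force
qed

text \<open>This condition cuts out the member V_k of the open cover; a face of dimension
  \<open>k\<close> has \<open>Suc k\<close> vertices.\<close>

definition has_dominant :: "nat \<Rightarrow> nat \<Rightarrow> (nat \<Rightarrow> real) \<Rightarrow> bool" where
  "has_dominant k n t \<longleftrightarrow> (\<exists>T. finite T \<and> card T = Suc k \<and> dominant T t)"

text \<open>The flag of dominant faces of \<open>t\<close> is the image of the flag \<open>\<C>\<close> of faces of \<open>[m]\<close> under a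
  (necessarily unique) injection \<open>[m] \<rightarrow> [n]\<close>.\<close>

definition flag_map :: "nat \<Rightarrow> nat set set \<Rightarrow> nat \<Rightarrow> (nat \<Rightarrow> real) \<Rightarrow> (nat \<Rightarrow> nat) \<Rightarrow> bool" where
  "flag_map m \<C> n t \<theta> \<longleftrightarrow> \<theta> \<in> Delta_plus_hom m n \<and> (\<forall>C\<in>\<C>. dominant (\<theta> ` C) t)"

definition flag_type :: "nat \<Rightarrow> nat set set \<Rightarrow> nat \<Rightarrow> (nat \<Rightarrow> real) \<Rightarrow> bool" where
  "flag_type m \<C> n t \<longleftrightarrow> (\<exists>\<theta>. flag_map m \<C> n t \<theta>)"

lemma card_image_Delta_plus: "\<theta> \<in> Delta_plus_hom m n \<Longrightarrow> C \<subseteq> {..m} \<Longrightarrow> card (\<theta> ` C) = card C"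
  by (meson Delta_plus_homD(1) card_image inj_on_subset)

text \<open>Membership of \<open>{..m}\<close> in the flag makes the image of
  \<open>\<theta>\<close> the unique dominant set with \<open>Suc m\<close> elements, and a strictly
  increasing map is determined by its image.\<close>

lemma flag_map_unique:
  assumes "flag_map m \<C> n t \<theta>" "flag_map m \<C> n' t \<theta>'" "{..m} \<in> \<C>"
  shows "\<theta> = \<theta>'"
proof (rule Delta_plus_hom_unique)
  show \<theta>: "\<theta> \<in> Delta_plus_hom m n" and \<theta>': "\<theta>' \<in> Delta_plus_hom m n'"
    using assms(1,2) unfolding flag_map_def by auto
  show "\<theta> ` {..m} = \<theta>' ` {..m}"
    by (rule dominant_unique[of _ t])
       (use assms card_image_Delta_plus[OF \<theta>] card_image_Delta_plus[OF \<theta>'] in \<open>auto simp: flag_map_def\<close>)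
qed

lemma flag_map_push:
  assumes \<phi>: "\<phi> \<in> Delta_plus_hom n n'" and t: "t \<in> standard_simplex n" and \<C>: "\<C> \<subseteq> Pow {..m}"
    and \<theta>: "flag_map m \<C> n t \<theta>"
  shows "flag_map m \<C> n' (simplex_push n \<phi> t) (compose {..m} \<phi> \<theta>)"
proof -
  have \<theta>_hom: "\<theta> \<in> Delta_plus_hom m n"
    using \<theta> unfolding flag_map_def by auto
  have "dominant (compose {..m} \<phi> \<theta> ` C) (simplex_push n \<phi> t)" if C: "C \<in> \<C>" for C
  proof -
    have Cm: "C \<subseteq> {..m}" using C \<C> by blast
    have "compose {..m} \<phi> \<theta> ` C = \<phi> ` (\<theta> ` C)"
      using Cm by (force simp: compose_def image_iff)
    moreover have "\<theta> ` C \<subseteq> {..n}"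
      using Delta_plus_homD(2)[OF \<theta>_hom] Cm by auto
    ultimately show ?thesis
      using dominant_push_iff[OF \<phi> t] \<theta> C unfolding flag_map_def by simp
  qed
  then show ?thesis
    unfolding flag_map_def using Delta_plus_hom_compose[OF \<theta>_hom \<phi>] by blast
qed

text \<open>For the direction from the larger simplex back: dominant coordinates are positive, while
  those outside the image of \<open>\<phi>\<close> vanish. Hence \<open>\<theta>'\<close> takes
  values in that image and factors through \<open>\<phi>\<close>.\<close>

lemma flag_type_push_iff:
  assumes \<phi>: "\<phi> \<in> Delta_plus_hom n n'" and t: "t \<in> standard_simplex n" and \<C>: "\<C> \<subseteq> Pow {..m}" "{..m} \<in> \<C>"
  shows "flag_type m \<C> n' (simplex_push n \<phi> t) \<longleftrightarrow> flag_type m \<C> n t"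
proof
  assume "flag_type m \<C> n t"
  then show "flag_type m \<C> n' (simplex_push n \<phi> t)"
    using flag_map_push[OF \<phi> t \<C>(1)] unfolding flag_type_def by blast
next
  assume "flag_type m \<C> n' (simplex_push n \<phi> t)"
  then obtain \<theta>' where \<theta>': "\<theta>' \<in> Delta_plus_hom m n'" and d: "\<And>C. C \<in> \<C> \<Longrightarrow> dominant (\<theta>' ` C) (simplex_push n \<phi> t)"
    unfolding flag_type_def flag_map_def by blast
  have "\<theta>' ` {..m} \<subseteq> \<phi> ` {..n}"
    by (rule dominant_push_in_image[OF \<phi> t _ d[OF \<C>(2)]]) simp
  then have "\<forall>i\<le>m. \<exists>k\<le>n. \<phi> k = \<theta>' i"
    by (force simp: image_subset_iff)
  then obtain \<psi> where \<psi>: "\<And>i. i \<le> m \<Longrightarrow> \<psi> i \<le> n \<and> \<phi> (\<psi> i) = \<theta>' i"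
    by metis
  define \<theta> where "\<theta> = restrict \<psi> {..m}"
  have \<theta>: "\<theta> \<in> Delta_plus_hom m n"
  proof (rule Delta_plus_homI)
    show "\<theta> i \<le> n" if "i \<le> m" for i
      using \<psi>[OF that] that by (simp add: \<theta>_def)
    show "\<theta> i < \<theta> j" if "i < j" "j \<le> m" for i j
      using \<psi>[of i] \<psi>[of j] that Delta_plus_homD(4)[OF \<theta>', of i j] Delta_plus_homD(4)[OF \<phi>, of "\<psi> i" "\<psi> j"]
      by (simp add: \<theta>_def)
  qed (simp add: \<theta>_def)
  have "dominant (\<theta> ` C) t" if C: "C \<in> \<C>" for C
  proof -
    have Cm: "C \<subseteq> {..m}" using C \<C> by blast
    have "\<theta>' ` C = \<phi> ` (\<theta> ` C)"
    proof -
      have "\<theta>' i = \<phi> (\<theta> i)" if "i \<in> C" for i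
        using \<psi>[of i] Cm that by (auto simp: \<theta>_def)
      then show ?thesis
        by (simp add: image_image)
    qed
    moreover have "\<theta> ` C \<subseteq> {..n}"
      using Delta_plus_homD(2)[OF \<theta>] Cm by auto
    ultimately show ?thesis
      using dominant_push_iff[OF \<phi> t] d[OF C] by simp
  qed
  then show "flag_type m \<C> n t"
    unfolding flag_type_def flag_map_def using \<theta> by blast
qed

lemma has_dominant_push_iff:
  assumes \<phi>: "\<phi> \<in> Delta_plus_hom n n'" and t: "t \<in> standard_simplex n"
  shows "has_dominant k n' (simplex_push n \<phi> t) \<longleftrightarrow> has_dominant k n t"
proof
  assume "has_dominant k n t"
  then obtain T where T: "finite T" "card T = Suc k" "dominant T t"
    unfolding has_dominant_def by blast
  have Tn: "T \<subseteq> {..n}"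
    using dominant_pos(2)[OF T(3,1) _ t] by auto
  have "dominant (\<phi> ` T) (simplex_push n \<phi> t)" "card (\<phi> ` T) = Suc k"
    using dominant_push_iff[OF \<phi> t Tn] card_image_Delta_plus[OF \<phi> Tn] T by auto
  then show "has_dominant k n' (simplex_push n \<phi> t)"
    unfolding has_dominant_def using T(1) by blast
next
  assume "has_dominant k n' (simplex_push n \<phi> t)"
  then obtain T where T: "finite T" "card T = Suc k" "dominant T (simplex_push n \<phi> t)"
    unfolding has_dominant_def by blast
  obtain T' where T': "T' \<subseteq> {..n}" "T = \<phi> ` T'"
    using dominant_push_in_image[OF \<phi> t T(1,3)] by (meson subset_imageE)
  have "dominant T' t" "card T' = Suc k" "finite T'"
    using dominant_push_iff[OF \<phi> t T'(1)] card_image_Delta_plus[OF \<phi> T'(1)] T T' finite_subset by auto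
  then show "has_dominant k n t"
    unfolding has_dominant_def by blast
qed

lemma ex_has_dominant:
  assumes t: "t \<in> standard_simplex n"
  shows "\<exists>k. has_dominant k n t"
proof -
  \<comment> \<open>The support of \<open>t\<close>: coordinates are positive inside and zero
    outside, so it is dominant.\<close>
  define T where "T = {i. 0 < t i}"
  have "T \<subseteq> {..n}"
    using standard_simplexD(3)[OF t] unfolding T_def by (force simp: not_less[symmetric])
  then have fin: "finite T"
    using finite_subset by blast
  have "T \<noteq> {}"
  proof
    assume "T = {}"
    then have "t i \<le> 0" for i
      unfolding T_def by (auto simp: not_less)
    then have "(\<Sum>i\<le>n. t i) \<le> 0"
      by (simp add: sum_nonpos)
    then show False
      using standard_simplexD(4)[OF t] by simp
  qed
  then obtain k where "card T = Suc k"
    using fin by (metis card_gt_0_iff gr0_implies_Suc)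
  moreover have "dominant T t"
    using standard_simplexD(1)[OF t] unfolding dominant_def T_def by (auto simp: not_less intro: le_less_trans)
  ultimately show ?thesis
    unfolding has_dominant_def using fin by blast
qed

text \<open>The condition on cardinalities is all that is recorded. Nestedness comes from the
  points: sets dominant at a common point form a chain, and a family that is not a chain describes
  an empty piece.\<close>

definition flags :: "nat set \<Rightarrow> nat set set set" where
  "flags S = {\<C>. \<C> \<subseteq> Pow {..Max S} \<and> {..Max S} \<in> \<C> \<and> card ` \<C> = Suc ` S}"

lemma flag_type_dominant:
  assumes \<C>: "\<C> \<in> flags S" and ft: "flag_type (Max S) \<C> n t" and k: "k \<in> S"
  shows "has_dominant k n t"
proof -
  obtain \<theta> where \<theta>: "\<theta> \<in> Delta_plus_hom (Max S) n" "\<And>C. C \<in> \<C> \<Longrightarrow> dominant (\<theta> ` C) t"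
    using ft unfolding flag_type_def flag_map_def by blast
  have "Suc k \<in> card ` \<C>"
    using \<C> k unfolding flags_def by simp
  then obtain C where C: "C \<in> \<C>" "card C = Suc k"
    by auto
  have Cm: "C \<subseteq> {..Max S}"
    using \<C> C(1) unfolding flags_def by blast
  have "finite C"
    using Cm finite_subset by blast
  then show ?thesis
    unfolding has_dominant_def
    using \<theta>(2)[OF C(1)] card_image_Delta_plus[OF \<theta>(1) Cm] C(2) by (intro exI[of _ "\<theta> ` C"]) simp
qed

text \<open>Dominant sets are nested, so the one of cardinality \<open>Suc (Max S)\<close> contains
  all others. Enumerating it in increasing order gives the injection, and the flag consists of the
  preimages of the dominant sets.\<close>

lemma flag_type_exists:
  assumes S: "finite S" "S \<noteq> {}" and t: "t \<in> standard_simplex n" and dom: "\<And>k. k \<in> S \<Longrightarrow> has_dominant k n t"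
  shows "\<exists>\<C>\<in>flags S. flag_type (Max S) \<C> n t"
proof -
  let ?m = "Max S"
  obtain T where T: "\<And>k. k \<in> S \<Longrightarrow> finite (T k) \<and> card (T k) = Suc k \<and> dominant (T k) t"
    using dom unfolding has_dominant_def by metis
  have m: "?m \<in> S"
    using S by simp
  have sub: "T k \<subseteq> T ?m" if "k \<in> S" for k
    using dominant_subset[of "T k" t "T ?m"] T[OF that] T[OF m] that S by simp
  obtain h where h: "bij_betw h {..<Suc ?m} (T ?m)" "strict_mono_on {..<Suc ?m} h"
    using ex_bij_betw_strict_mono_card[of "T ?m"] T[OF m] by metis
  define \<theta> where "\<theta> = restrict h {..?m}"
  have h_im: "h ` {..?m} = T ?m"
    using h(1) unfolding bij_betw_def lessThan_Suc_atMost by simp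
  have Tn: "T ?m \<subseteq> {..n}"
    using dominant_pos(2)[of "T ?m" t _ n] T[OF m] t by auto
  have \<theta>: "\<theta> \<in> Delta_plus_hom ?m n"
  proof (rule Delta_plus_homI)
    show "\<theta> i \<le> n" if "i \<le> ?m" for i
      using that h_im Tn unfolding \<theta>_def by auto
    show "\<theta> i < \<theta> j" if "i < j" "j \<le> ?m" for i j
      using that strict_mono_onD[OF h(2), of i j] unfolding \<theta>_def by simp
  qed (simp add: \<theta>_def)
  have \<theta>_im: "\<theta> ` {..?m} = T ?m"
    using h_im unfolding \<theta>_def by simp
  define C where "C k = {i. i \<le> ?m \<and> \<theta> i \<in> T k}" for k
  have C: "C k \<subseteq> {..?m}" for k
    unfolding C_def by auto
  have \<theta>C: "\<theta> ` C k = T k" if kS: "k \<in> S" for k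
  proof
    show "T k \<subseteq> \<theta> ` C k"
    proof
      fix i assume i: "i \<in> T k"
      then obtain j where "j \<le> ?m" "i = \<theta> j"
        using sub[OF kS] \<theta>_im by auto
      then show "i \<in> \<theta> ` C k"
        using i unfolding C_def by blast
    qed
  qed (auto simp: C_def)
  have cardC: "card (C k) = Suc k" if "k \<in> S" for k
    using card_image_Delta_plus[OF \<theta> C, of k] \<theta>C[OF that] T[OF that] by simp
  have "C ?m = {..?m}"
    using \<theta>_im unfolding C_def by auto
  then have "{..?m} \<in> C ` S"
    using m by blast
  moreover have "card ` (C ` S) = Suc ` S"
    unfolding image_image using cardC by (intro image_cong) simp_all
  ultimately have "C ` S \<in> flags S"
    using C unfolding flags_def by blast
  moreover have "flag_map ?m (C ` S) n t \<theta>"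
    unfolding flag_map_def using \<theta> \<theta>C T by simp
  ultimately show ?thesis
    unfolding flag_type_def by blast
qed

text \<open>Both types come with the same injection, which is determined by the top face. Members of
  equal cardinality then have equal images, by uniqueness of dominant sets, and are equal by
  injectivity.\<close>

lemma flag_type_disjoint:
  assumes \<C>: "\<C> \<in> flags S" and \<C>': "\<C>' \<in> flags S" and ft: "flag_type (Max S) \<C> n t" "flag_type (Max S) \<C>' n t"
  shows "\<C> = \<C>'"
proof -
  have sub: "\<D> \<subseteq> \<D>'" if D: "\<D> \<in> flags S" "\<D>' \<in> flags S" and dt: "flag_type (Max S) \<D> n t" "flag_type (Max S) \<D>' n t" for \<D> \<D>'
  proof
    fix C assume C: "C \<in> \<D>"
    obtain \<theta> where \<theta>: "flag_map (Max S) \<D> n t \<theta>"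
      using dt(1) unfolding flag_type_def by blast
    obtain \<theta>' where \<theta>': "flag_map (Max S) \<D>' n t \<theta>'"
      using dt(2) unfolding flag_type_def by blast
    have top: "flag_map (Max S) {{..Max S}} n t \<theta>" "flag_map (Max S) {{..Max S}} n t \<theta>'"
      using \<theta> \<theta>' D unfolding flag_map_def flags_def by auto
    have eq: "\<theta> = \<theta>'"
      by (rule flag_map_unique[OF top]) simp
    have hom: "\<theta> \<in> Delta_plus_hom (Max S) n"
      using \<theta> unfolding flag_map_def by blast
    have "card C \<in> card ` \<D>'"
      using C D unfolding flags_def by blast
    then obtain C' where C': "C' \<in> \<D>'" "card C' = card C"
      by auto
    have Cm: "C \<subseteq> {..Max S}" "C' \<subseteq> {..Max S}"
      using C C' D unfolding flags_def by auto
    have fin: "finite C" "finite C'"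
      using Cm finite_subset by blast+
    have "\<theta> ` C = \<theta> ` C'"
    proof (rule dominant_unique[of _ t])
      show "dominant (\<theta> ` C) t" "dominant (\<theta> ` C') t"
        using \<theta> \<theta>' C C' eq unfolding flag_map_def by auto
      show "card (\<theta> ` C) = card (\<theta> ` C')"
        using card_image_Delta_plus[OF hom] Cm C'(2) by simp
    qed (use fin in auto)
    then have "C = C'"
      using inj_on_image_eq_iff[OF Delta_plus_homD(1)[OF hom] Cm] by simp
    then show "C \<in> \<D>'"
      using C' by simp
  qed
  show ?thesis
    using sub[OF \<C> \<C>' ft] sub[OF \<C>' \<C> ft(2,1)] by blast
qed

text \<open>Restricting \<open>t\<close> to the face named by \<open>\<theta>\<close> and rescaling
  to total mass 1 gives a point of the \<open>m\<close>-simplex at which the flag itself is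
  dominant. Such a point exists whenever the piece is nonempty and serves as the target of its
  contraction.\<close>

lemma flag_centre:
  assumes fm: "flag_map m \<C> n t \<theta>" and \<C>: "\<C> \<subseteq> Pow {..m}" "{..m} \<in> \<C>" and t: "t \<in> standard_simplex n"
  shows "\<exists>\<tau>\<in>standard_simplex m. \<forall>C\<in>\<C>. dominant C \<tau>"
proof -
  have \<theta>: "\<theta> \<in> Delta_plus_hom m n" and d: "\<And>C. C \<in> \<C> \<Longrightarrow> dominant (\<theta> ` C) t"
    using fm unfolding flag_map_def by auto
  have pos: "0 < t (\<theta> i)" if "i \<le> m" for i
    by (rule dominant_pos(1)[OF d[OF \<C>(2)] _ _ t]) (use that in auto)
  define \<sigma> where "\<sigma> = (\<Sum>i\<le>m. t (\<theta> i))"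
  have \<sigma>: "\<sigma> > 0"
    unfolding \<sigma>_def by (rule sum_pos) (use pos in auto)
  define \<tau> where "\<tau> i = (if i \<le> m then t (\<theta> i) / \<sigma> else 0)" for i
  have "\<tau> \<in> standard_simplex m"
  proof (rule standard_simplexI)
    show "0 \<le> \<tau> i" for i
      using pos[of i] \<sigma> unfolding \<tau>_def by (simp add: less_imp_le)
    have "(\<Sum>i\<le>m. \<tau> i) = (\<Sum>i\<le>m. t (\<theta> i)) / \<sigma>"
      unfolding \<tau>_def sum_divide_distrib by simp
    then show "(\<Sum>i\<le>m. \<tau> i) = 1"
      using \<sigma> unfolding \<sigma>_def by simp
  qed (simp add: \<tau>_def)
  moreover have "dominant C \<tau>" if C: "C \<in> \<C>" for C
    unfolding dominant_def
  proof (intro ballI allI impI)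
    fix i j assume i: "i \<in> C" and j: "j \<notin> C"
    have Cm: "C \<subseteq> {..m}" using C \<C> by blast
    have im: "i \<le> m" using i Cm by auto
    show "\<tau> j < \<tau> i"
    proof (cases "j \<le> m")
      case True
      then have "\<theta> j \<notin> \<theta> ` C"
        using j Cm inj_on_image_mem_iff[OF Delta_plus_homD(1)[OF \<theta>], of j C] by auto
      then have "t (\<theta> j) < t (\<theta> i)"
        using d[OF C] i unfolding dominant_def by blast
      then show ?thesis
        using True im \<sigma> unfolding \<tau>_def by (simp add: divide_strict_right_mono)
    next
      case False
      then show ?thesis
        using im pos[OF im] \<sigma> unfolding \<tau>_def by simp
    qed
  qed
  ultimately show ?thesis
    by blast
qed

section \<open>Open pieces of the realization\<close>

abbreviation realization_class ::
    "'a space_diagram \<Rightarrow> nat \<times> 'a \<times> (nat \<Rightarrow> real) \<Rightarrow> (nat \<times> 'a \<times> (nat \<Rightarrow> real)) set" where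
  "realization_class X z \<equiv> realization_rel X `` {z}"

section \<open>Points of the realization and their representatives\<close>

lemma topspace_simplex_space [simp]: "topspace (simplex_space n) = standard_simplex n"
  by (simp add: simplex_space_def)

lemma mem_realization_sum_iff:
  "(n, x, t) \<in> topspace (realization_sum X) \<longleftrightarrow> x \<in> topspace (level X n) \<and> t \<in> standard_simplex n"
  by (simp add: realization_sum_def)

lemma semi_simplicial_spaceD:
  assumes "semi_simplicial_space X"
  shows "\<theta> \<in> Delta_plus_hom m n \<Longrightarrow> continuous_map (level X n) (level X m) (act X m n \<theta>)"
    "x \<in> topspace (level X n) \<Longrightarrow> act X n n (restrict id {..n}) x = x"
    "\<phi> \<in> Delta_plus_hom l m \<Longrightarrow> \<theta> \<in> Delta_plus_hom m n \<Longrightarrow> x \<in> topspace (level X n) \<Longrightarrow>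
      act X l n (compose {..l} \<theta> \<phi>) x = act X l m \<phi> (act X m n \<theta> x)"
    "\<theta> \<in> Delta_plus_hom m n \<Longrightarrow> x \<in> topspace (level X n) \<Longrightarrow> act X m n \<theta> x \<in> topspace (level X m)"
proof -
  show c: "continuous_map (level X n) (level X m) (act X m n \<theta>)" if "\<theta> \<in> Delta_plus_hom m n" for m n \<theta>
    using assms that unfolding semi_simplicial_space_def contravariant_functor_def by blast
  show "x \<in> topspace (level X n) \<Longrightarrow> act X n n (restrict id {..n}) x = x"
    using assms unfolding semi_simplicial_space_def contravariant_functor_def by blast
  show "\<phi> \<in> Delta_plus_hom l m \<Longrightarrow> \<theta> \<in> Delta_plus_hom m n \<Longrightarrow> x \<in> topspace (level X n) \<Longrightarrow>
      act X l n (compose {..l} \<theta> \<phi>) x = act X l m \<phi> (act X m n \<theta> x)"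
    using assms unfolding semi_simplicial_space_def contravariant_functor_def by blast
  show "act X m n \<theta> x \<in> topspace (level X m)" if "\<theta> \<in> Delta_plus_hom m n" "x \<in> topspace (level X n)"
    using continuous_map_image_subset_topspace[OF c[OF that(1)]] that(2) by blast
qed

lemma realization_class_eq_iff:
  "z \<in> topspace (realization_sum X) \<Longrightarrow> z' \<in> topspace (realization_sum X) \<Longrightarrow>
     realization_class X z = realization_class X z' \<longleftrightarrow> (z, z') \<in> realization_rel X"
  by (rule eq_equiv_class_iff[OF equiv_realization_rel])

lemma realization_class_glue:
  assumes X: "semi_simplicial_space X" and \<theta>: "\<theta> \<in> Delta_plus_hom m n"
    and x: "x \<in> topspace (level X n)" and t: "t \<in> standard_simplex m"
  shows "realization_class X (m, act X m n \<theta> x, t) = realization_class X (n, x, simplex_push m \<theta> t)"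
proof -
  have mem: "(m, act X m n \<theta> x, t) \<in> topspace (realization_sum X)"
      "(n, x, simplex_push m \<theta> t) \<in> topspace (realization_sum X)"
    unfolding mem_realization_sum_iff
    using semi_simplicial_spaceD(4)[OF X \<theta> x] x t simplex_push_mem[OF \<theta> t] by simp_all
  have "((m, act X m n \<theta> x, t), (n, x, simplex_push m \<theta> t)) \<in> realization_gluing X"
    unfolding realization_gluing_def using \<theta> x t by blast
  then show ?thesis
    unfolding realization_class_eq_iff[OF mem] unfolding realization_rel_def using mem by blast
qed

text \<open>\<open>G\<close> may have values in any type: it is instantiated with truth values, with
  options and with classes in another realization.\<close>

lemma realization_rel_invariant:
  assumes G: "\<And>m n \<theta> x t. \<theta> \<in> Delta_plus_hom m n \<Longrightarrow> x \<in> topspace (level X n) \<Longrightarrow> t \<in> standard_simplex m \<Longrightarrow>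
      G (m, act X m n \<theta> x, t) = G (n, x, simplex_push m \<theta> t)"
    and z: "(z, z') \<in> realization_rel X"
  shows "G z = G z'"
proof -
  have "(z, z') \<in> (realization_gluing X \<union> (realization_gluing X)\<inverse>)\<^sup>*"
    using z unfolding realization_rel_def by blast
  then show ?thesis
  proof (induction rule: rtrancl_induct)
    case (step y y')
    have "G y = G y'"
      using step(2) unfolding realization_gluing_def by (auto simp: G)
    then show ?case
      using step(3) by simp
  qed simp
qed

lemma quotient_map_fat_realization:
  "quotient_map (realization_sum X) (fat_realization X) (realization_class X)"
  unfolding fat_realization_def by (rule quotient_map_quotient_topology)

lemma topspace_fat_realization:
  "topspace (fat_realization X) = realization_class X ` topspace (realization_sum X)"
  using quotient_imp_surjective_map[OF quotient_map_fat_realization] by metis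

lemma continuous_map_sum_component:
  "continuous_map (subtopology (sum_topology X I) {z \<in> topspace (sum_topology X I). fst z = n}) (X n) snd"
  unfolding continuous_map_def
proof (intro conjI allI impI)
  fix U assume U: "openin (X n) U"
  have "{z \<in> topspace (subtopology (sum_topology X I) {z \<in> topspace (sum_topology X I). fst z = n}). snd z \<in> U}
      = ({n} \<inter> I) \<times> U \<inter> {z \<in> topspace (sum_topology X I). fst z = n}"
    using openin_subset[OF U] by auto
  moreover have "openin (sum_topology X I) (({n} \<inter> I) \<times> U)"
    unfolding openin_sum_topology
  proof (intro conjI ballI)
    fix i assume "i \<in> I"
    show "openin (X i) {x. (i, x) \<in> ({n} \<inter> I) \<times> U}"
      using U \<open>i \<in> I\<close> by (cases "i = n") simp_all
  qed (use openin_subset[OF U] in auto)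
  ultimately show "openin (subtopology (sum_topology X I) {z \<in> topspace (sum_topology X I). fst z = n})
      {z \<in> topspace (subtopology (sum_topology X I) {z \<in> topspace (sum_topology X I). fst z = n}). snd z \<in> U}"
    unfolding openin_subtopology by blast
qed auto

lemma continuous_map_from_sum:
  assumes "\<And>i. i \<in> I \<Longrightarrow> continuous_map (X i) Y (\<lambda>x. h (i, x))"
  shows "continuous_map (sum_topology X I) Y h"
  unfolding continuous_map_def
proof (intro conjI allI impI)
  show "h \<in> topspace (sum_topology X I) \<rightarrow> topspace Y"
    using continuous_map_image_subset_topspace[OF assms] by force
  fix U assume U: "openin Y U"
  have "openin (X i) {x. (i, x) \<in> {z \<in> topspace (sum_topology X I). h z \<in> U}}" if i: "i \<in> I" for i
    using openin_continuous_map_preimage[OF assms[OF i] U] i by simp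
  then show "openin (sum_topology X I) {x \<in> topspace (sum_topology X I). h x \<in> U}"
    unfolding openin_sum_topology by auto
qed

text \<open>A condition on simplex coordinates alone, open on each simplex and invariant under face
  inclusions. It cuts out an open set in the realization of every semi-simplicial space at once, so
  the same condition serves for \<open>X\<close> and \<open>Y\<close>.\<close>

definition open_simplex_condition :: "(nat \<Rightarrow> (nat \<Rightarrow> real) \<Rightarrow> bool) \<Rightarrow> bool" where
  "open_simplex_condition Q \<longleftrightarrow>
     (\<forall>m n. \<forall>\<theta>\<in>Delta_plus_hom m n. \<forall>t\<in>standard_simplex m. Q n (simplex_push m \<theta> t) = Q m t) \<and>
     (\<forall>n. openin (simplex_space n) {t \<in> standard_simplex n. Q n t})"

definition sum_region :: "'a space_diagram \<Rightarrow> (nat \<Rightarrow> (nat \<Rightarrow> real) \<Rightarrow> bool) \<Rightarrow> (nat \<times> 'a \<times> (nat \<Rightarrow> real)) set" where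
  "sum_region X Q = {z \<in> topspace (realization_sum X). Q (fst z) (snd (snd z))}"

definition region ::
    "'a space_diagram \<Rightarrow> (nat \<Rightarrow> (nat \<Rightarrow> real) \<Rightarrow> bool) \<Rightarrow> (nat \<times> 'a \<times> (nat \<Rightarrow> real)) set set" where
  "region X Q = realization_class X ` sum_region X Q"

lemma region_subset: "region X Q \<subseteq> topspace (fat_realization X)"
  unfolding region_def sum_region_def topspace_fat_realization by blast

lemma open_simplex_conditionD:
  assumes "open_simplex_condition Q"
  shows "\<theta> \<in> Delta_plus_hom m n \<Longrightarrow> t \<in> standard_simplex m \<Longrightarrow> Q n (simplex_push m \<theta> t) = Q m t"
    "openin (simplex_space n) {t \<in> standard_simplex n. Q n t}"
  using assms unfolding open_simplex_condition_def by simp_all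

text \<open>Saturation: the condition has the same truth value on glued points, so any
  representative decides membership.\<close>

lemma mem_region_iff:
  assumes Q: "open_simplex_condition Q" and z: "z \<in> topspace (realization_sum X)"
  shows "realization_class X z \<in> region X Q \<longleftrightarrow> Q (fst z) (snd (snd z))"
proof
  assume "realization_class X z \<in> region X Q"
  then obtain z' where z': "z' \<in> topspace (realization_sum X)" "Q (fst z') (snd (snd z'))"
      "realization_class X z = realization_class X z'"
    unfolding region_def sum_region_def by auto
  then have "(z, z') \<in> realization_rel X"
    using realization_class_eq_iff[OF z z'(1)] by simp
  then have "Q (fst z) (snd (snd z)) = Q (fst z') (snd (snd z'))"
    by (rule realization_rel_invariant[where G="\<lambda>z. Q (fst z) (snd (snd z))", rotated])
       (simp add: open_simplex_conditionD(1)[OF Q])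
  with z'(2) show "Q (fst z) (snd (snd z))"
    by simp
qed (use z in \<open>auto simp: region_def sum_region_def\<close>)

lemma sum_region_eq:
  "open_simplex_condition Q \<Longrightarrow> {z \<in> topspace (realization_sum X). realization_class X z \<in> region X Q} = sum_region X Q"
  unfolding sum_region_def using mem_region_iff[of Q _ X] by blast

lemma sum_region_invariant:
  assumes Q: "open_simplex_condition Q"
    and G: "\<And>m n \<theta> x t. \<theta> \<in> Delta_plus_hom m n \<Longrightarrow> x \<in> topspace (level X n) \<Longrightarrow> t \<in> standard_simplex m \<Longrightarrow>
      Q m t \<Longrightarrow> G (m, act X m n \<theta> x, t) = G (n, x, simplex_push m \<theta> t)"
    and z: "z \<in> sum_region X Q" "z' \<in> topspace (realization_sum X)" "realization_class X z = realization_class X z'"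
  shows "G z = G z'"
proof -
  \<comment> \<open>Extending \<open>G\<close> by \<open>None\<close> off the region yields a
    function invariant under all gluing relations, although \<open>G\<close> is controlled only
    where \<open>Q\<close> holds.\<close>
  let ?G = "\<lambda>z. if Q (fst z) (snd (snd z)) then Some (G z) else None"
  have "z \<in> topspace (realization_sum X)"
    using z(1) unfolding sum_region_def by blast
  from realization_class_eq_iff[OF this z(2)] z(3) have "(z, z') \<in> realization_rel X"
    by simp
  then have "?G z = ?G z'"
    by (rule realization_rel_invariant[where G="?G", rotated]) (simp add: G open_simplex_conditionD(1)[OF Q])
  then show ?thesis
    using z(1) unfolding sum_region_def by (simp split: if_splits)
qed

lemma openin_sum_region:
  assumes "\<And>n. openin (simplex_space n) {t \<in> standard_simplex n. Q n t}"
  shows "openin (realization_sum X) (sum_region X Q)"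
  unfolding realization_sum_def openin_sum_topology
proof (intro conjI ballI)
  show "sum_region X Q \<subseteq> Sigma UNIV (topspace \<circ> (\<lambda>n. prod_topology (level X n) (simplex_space n)))"
    unfolding sum_region_def realization_sum_def by auto
  fix n
  have "{z. (n, z) \<in> sum_region X Q} = topspace (level X n) \<times> {t \<in> standard_simplex n. Q n t}"
    unfolding sum_region_def by (auto simp: mem_realization_sum_iff)
  then show "openin (prod_topology (level X n) (simplex_space n)) {z. (n, z) \<in> sum_region X Q}"
    using assms[of n] by (simp add: openin_prod_Times_iff)
qed

lemma openin_region:
  assumes Q: "open_simplex_condition Q"
  shows "openin (fat_realization X) (region X Q)"
proof -
  have "openin (realization_sum X) {z \<in> topspace (realization_sum X). realization_class X z \<in> region X Q}"
    unfolding sum_region_eq[OF Q] by (rule openin_sum_region) (rule open_simplex_conditionD(2)[OF Q])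
  then show ?thesis
    using quotient_map_fat_realization[of X] region_subset[of X Q] unfolding quotient_map_def by blast
qed

text \<open>Maps out of a region can therefore be defined on representatives, with continuity
  checked there; this rests on the region being open.\<close>

lemma quotient_map_region:
  assumes Q: "open_simplex_condition Q"
  shows "quotient_map (subtopology (realization_sum X) (sum_region X Q))
    (subtopology (fat_realization X) (region X Q)) (realization_class X)"
  by (rule quotient_map_restriction[OF quotient_map_fat_realization sum_region_eq[OF Q]])
     (simp add: openin_region[OF Q])

lemma region_Int_INT:
  assumes "\<And>k. k \<in> S \<Longrightarrow> open_simplex_condition (Q k)" "S \<noteq> {}" "open_simplex_condition (\<lambda>n t. \<forall>k\<in>S. Q k n t)"
  shows "(\<Inter>k\<in>S. region X (Q k)) = region X (\<lambda>n t. \<forall>k\<in>S. Q k n t)"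
proof (rule Set.set_eqI)
  fix c
  have "c \<in> topspace (fat_realization X)" if "c \<in> (\<Inter>k\<in>S. region X (Q k))"
    using that assms(2) region_subset by blast
  moreover have "c \<in> topspace (fat_realization X)" if "c \<in> region X (\<lambda>n t. \<forall>k\<in>S. Q k n t)"
    using that region_subset by blast
  moreover have "c \<in> (\<Inter>k\<in>S. region X (Q k)) \<longleftrightarrow> c \<in> region X (\<lambda>n t. \<forall>k\<in>S. Q k n t)"
    if c: "c \<in> topspace (fat_realization X)"
  proof -
    obtain z where z: "z \<in> topspace (realization_sum X)" "c = realization_class X z"
      using c unfolding topspace_fat_realization by blast
    have "c \<in> region X (Q k) \<longleftrightarrow> Q k (fst z) (snd (snd z))" if "k \<in> S" for k
      unfolding z(2) by (rule mem_region_iff[OF assms(1)[OF that] z(1)])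
    then show ?thesis
      unfolding z(2) mem_region_iff[OF assms(3) z(1)] by simp
  qed
  ultimately show "c \<in> (\<Inter>k\<in>S. region X (Q k)) \<longleftrightarrow> c \<in> region X (\<lambda>n t. \<forall>k\<in>S. Q k n t)"
    by blast
qed

lemma openin_Collect_Ball:
  assumes "finite S" "\<And>k. k \<in> S \<Longrightarrow> openin X {t \<in> topspace X. Q k t}"
  shows "openin X {t \<in> topspace X. \<forall>k\<in>S. Q k t}"
  using assms
proof (induction S rule: finite_induct)
  case (insert k S)
  have "{t \<in> topspace X. \<forall>k\<in>insert k S. Q k t} =
      {t \<in> topspace X. Q k t} \<inter> {t \<in> topspace X. \<forall>k\<in>S. Q k t}"
    by blast
  then show ?case
    using insert by (simp add: openin_Int)
qed simp

lemma openin_simplex_space_dominant: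
  assumes fin: "finite T"
  shows "openin (simplex_space n) {t \<in> standard_simplex n. dominant T t}"
proof (cases "T = {}")
  case True
  then show ?thesis
    using openin_topspace[of "simplex_space n"] by (simp add: dominant_def)
next
  case False
  have open_less: "openin (simplex_space n) {t \<in> standard_simplex n. t j < t i}" for i j
  proof -
    have eq: "{t \<in> standard_simplex n. t j < t i} = standard_simplex n \<inter> {t. t j < t i}"
      by blast
    have "open {t :: nat \<Rightarrow> real. t j < t i}"
      by (intro open_Collect_less continuous_intros)
    then show ?thesis
      unfolding simplex_space_def euclidean_product_topology eq by (rule openin_open_Int)
  qed
  \<comment> \<open>An index outside \<open>T\<close> and beyond \<open>n\<close>, where the
    coordinate is zero. The comparison with it settles all larger indices, which leaves finitely
    many strict inequalities.\<close>
  define j0 where "j0 = Suc (Max (insert n T))"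
  have j0: "j0 \<notin> T" "n < j0"
  proof -
    have "i < j0" if "i \<in> insert n T" for i
      using Max_ge[OF _ that] fin by (simp add: j0_def less_Suc_eq_le)
    then show "j0 \<notin> T" "n < j0"
      by blast+
  qed
  let ?P = "T \<times> ({..j0} - T)"
  have iff: "dominant T t \<longleftrightarrow> (\<forall>p\<in>?P. t (snd p) < t (fst p))" if t: "t \<in> standard_simplex n" for t
  proof
    assume "dominant T t"
    then show "\<forall>p\<in>?P. t (snd p) < t (fst p)"
      unfolding dominant_def by auto
  next
    assume lt: "\<forall>p\<in>?P. t (snd p) < t (fst p)"
    show "dominant T t"
      unfolding dominant_def
    proof (intro ballI allI impI)
      fix i j assume i: "i \<in> T" and j: "j \<notin> T"
      show "t j < t i"
      proof (cases "j \<le> j0")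
        case True
        then show ?thesis
          using bspec[OF lt, of "(i, j)"] i j by simp
      next
        case False
        have "t j0 < t i"
          using bspec[OF lt, of "(i, j0)"] i j0 by simp
        then show ?thesis
          using False j0 standard_simplexD(3)[OF t, of j] standard_simplexD(3)[OF t, of j0] by simp
      qed
    qed
  qed
  have "openin (simplex_space n) {t \<in> standard_simplex n. \<forall>p\<in>?P. t (snd p) < t (fst p)}"
    using openin_Collect_Ball[of ?P "simplex_space n" "\<lambda>p t. t (snd p) < t (fst p)"] fin open_less by simp
  moreover have "{t \<in> standard_simplex n. \<forall>p\<in>?P. t (snd p) < t (fst p)} = {t \<in> standard_simplex n. dominant T t}"
    using iff by blast
  ultimately show ?thesis
    by simp
qed

lemma open_simplex_condition_has_dominant: "open_simplex_condition (has_dominant k)"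
  unfolding open_simplex_condition_def
proof (intro conjI allI ballI)
  fix n
  have "{t \<in> standard_simplex n. has_dominant k n t} =
     (\<Union>T\<in>{T. finite T \<and> card T = Suc k}. {t \<in> standard_simplex n. dominant T t})"
    unfolding has_dominant_def by blast
  then show "openin (simplex_space n) {t \<in> standard_simplex n. has_dominant k n t}"
    by (auto intro!: openin_Union openin_simplex_space_dominant)
qed (rule has_dominant_push_iff)

lemma open_simplex_condition_Ball:
  assumes "finite S" "\<And>k. k \<in> S \<Longrightarrow> open_simplex_condition (Q k)"
  shows "open_simplex_condition (\<lambda>n t. \<forall>k\<in>S. Q k n t)"
  unfolding open_simplex_condition_def
proof (intro conjI allI ballI)
  show "(\<forall>k\<in>S. Q k n (simplex_push m \<theta> t)) = (\<forall>k\<in>S. Q k m t)"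
    if "\<theta> \<in> Delta_plus_hom m n" "t \<in> standard_simplex m" for m n \<theta> t
    using open_simplex_conditionD(1)[OF assms(2) that] by blast
  show "openin (simplex_space n) {t \<in> standard_simplex n. \<forall>k\<in>S. Q k n t}" for n
    using openin_Collect_Ball[of S "simplex_space n" "\<lambda>k. Q k n"] assms(1) open_simplex_conditionD(2)[OF assms(2)]
    by simp
qed

lemma openin_flag_map:
  fixes \<theta> :: "nat \<Rightarrow> nat"
  assumes "\<C> \<subseteq> Pow {..m}"
  shows "openin (simplex_space n) {t \<in> standard_simplex n. \<forall>C\<in>\<C>. dominant (\<theta> ` C) t}"
proof -
  have "finite \<C>"
    using assms by (rule finite_subset) (simp add: finite_Pow_iff)
  moreover have "finite (\<theta> ` C)" if "C \<in> \<C>" for C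
  proof -
    have "C \<subseteq> {..m}"
      using that assms by blast
    then show ?thesis
      by (meson finite_atMost finite_imageI finite_subset)
  qed
  ultimately show ?thesis
    using openin_Collect_Ball[of \<C> "simplex_space n" "\<lambda>C. dominant (\<theta> ` C)"] openin_simplex_space_dominant
    by simp
qed

lemma open_simplex_condition_flag_type:
  assumes \<C>: "\<C> \<subseteq> Pow {..m}" "{..m} \<in> \<C>"
  shows "open_simplex_condition (flag_type m \<C>)"
  unfolding open_simplex_condition_def
proof (intro conjI allI ballI)
  fix n
  have "{t \<in> standard_simplex n. flag_type m \<C> n t} =
     (\<Union>\<theta>\<in>Delta_plus_hom m n. {t \<in> standard_simplex n. \<forall>C\<in>\<C>. dominant (\<theta> ` C) t})"
    unfolding flag_type_def flag_map_def by blast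
  then show "openin (simplex_space n) {t \<in> standard_simplex n. flag_type m \<C> n t}"
    by (auto intro!: openin_Union openin_flag_map[OF \<C>(1)])
qed (rule flag_type_push_iff[OF _ _ \<C>])

section \<open>The map induced on realizations\<close>

lemma semi_simplicial_mapD:
  assumes "semi_simplicial_map X Y f"
  shows "semi_simplicial_space X" "semi_simplicial_space Y"
    "continuous_map (level X n) (level Y n) (f n)"
    "x \<in> topspace (level X n) \<Longrightarrow> f n x \<in> topspace (level Y n)"
    "\<theta> \<in> Delta_plus_hom m n \<Longrightarrow> x \<in> topspace (level X n) \<Longrightarrow> f m (act X m n \<theta> x) = act Y m n \<theta> (f n x)"
proof -
  show "semi_simplicial_space X" "semi_simplicial_space Y"
    using assms by (simp_all add: semi_simplicial_map_def)
  show c: "continuous_map (level X n) (level Y n) (f n)" for n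
    using assms by (simp add: semi_simplicial_map_def natural_map_def)
  show "x \<in> topspace (level X n) \<Longrightarrow> f n x \<in> topspace (level Y n)"
    using continuous_map_image_subset_topspace[OF c] by blast
  show "\<theta> \<in> Delta_plus_hom m n \<Longrightarrow> x \<in> topspace (level X n) \<Longrightarrow> f m (act X m n \<theta> x) = act Y m n \<theta> (f n x)"
    using assms by (simp add: semi_simplicial_map_def natural_map_def)
qed

lemma fat_realization_map_class:
  assumes f: "semi_simplicial_map X Y f" and x: "x \<in> topspace (level X n)" and t: "t \<in> standard_simplex n"
  shows "fat_realization_map Y f (realization_class X (n, x, t)) = realization_class Y (n, f n x, t)"
proof -
  note D = semi_simplicial_mapD[OF f]
  let ?h = "\<lambda>(n, x, t). (n, f n x, t)"
  have h_mem: "?h z \<in> topspace (realization_sum Y)" if "z \<in> topspace (realization_sum X)" for z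
    using that D(4) by (cases z) (simp add: mem_realization_sum_iff)
  have "(?h y, ?h z) \<in> realization_rel Y" if yz: "(y, z) \<in> realization_rel X" for y z
  proof -
    have mem: "y \<in> topspace (realization_sum X)" "z \<in> topspace (realization_sum X)"
      using yz unfolding realization_rel_def by blast+
    have "realization_class Y (?h y) = realization_class Y (?h z)"
      using yz by (rule realization_rel_invariant[where G="\<lambda>z. realization_class Y (?h z)", rotated])
        (simp add: D realization_class_glue[OF D(2)])
    then show ?thesis
      using realization_class_eq_iff[OF h_mem[OF mem(1)] h_mem[OF mem(2)]] by simp
  qed
  then have "quotient_induced (realization_rel Y) ?h (realization_class X (n, x, t)) = realization_class Y (?h (n, x, t))"
    using x t by (intro quotient_induced_class[OF equiv_realization_rel equiv_realization_rel])
      (simp_all add: mem_realization_sum_iff)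
  then show ?thesis
    unfolding fat_realization_map_def by simp
qed

lemma continuous_map_fat_realization_map:
  assumes f: "semi_simplicial_map X Y f"
  shows "continuous_map (fat_realization X) (fat_realization Y) (fat_realization_map Y f)"
proof (rule continuous_compose_quotient_map[OF quotient_map_fat_realization])
  let ?h = "\<lambda>(n, x, t). (n, f n x, t)"
  have "continuous_map (realization_sum X) (realization_sum Y) ?h"
    unfolding realization_sum_def
  proof (rule continuous_map_from_sum)
    fix n
    have "continuous_map (prod_topology (level X n) (simplex_space n)) (prod_topology (level Y n) (simplex_space n))
        (\<lambda>(x, t). (f n x, t))"
      using semi_simplicial_mapD(3)[OF f, of n] by (simp add: continuous_map_prod_top)
    from continuous_map_compose[OF this continuous_map_component_injection[of n UNIV "\<lambda>n. prod_topology (level Y n) (simplex_space n)"]]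
    show "continuous_map (prod_topology (level X n) (simplex_space n))
        (sum_topology (\<lambda>n. prod_topology (level Y n) (simplex_space n)) UNIV) (\<lambda>x. ?h (n, x))"
      by (simp add: o_def case_prod_unfold)
  qed
  from continuous_map_compose[OF this quotient_imp_continuous_map[OF quotient_map_fat_realization]]
  show "continuous_map (realization_sum X) (fat_realization Y) (fat_realization_map Y f \<circ> realization_class X)"
  proof (rule continuous_map_eq)
    fix z assume "z \<in> topspace (realization_sum X)"
    then show "(realization_class Y \<circ> ?h) z = (fat_realization_map Y f \<circ> realization_class X) z"
      using fat_realization_map_class[OF f] by (cases z) (simp add: mem_realization_sum_iff)
  qed
qed

text \<open>The induced map leaves simplex coordinates unchanged, so the preimage of a region is the
  region for the same condition.\<close>

lemma fat_realization_map_region_iff: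
  assumes f: "semi_simplicial_map X Y f" and Q: "open_simplex_condition Q" and c: "c \<in> topspace (fat_realization X)"
  shows "fat_realization_map Y f c \<in> region Y Q \<longleftrightarrow> c \<in> region X Q"
proof -
  obtain n x t where z: "(n, x, t) \<in> topspace (realization_sum X)" "c = realization_class X (n, x, t)"
    using c unfolding topspace_fat_realization by auto
  then have xt: "x \<in> topspace (level X n)" "t \<in> standard_simplex n"
    by (simp_all add: mem_realization_sum_iff)
  have "(n, f n x, t) \<in> topspace (realization_sum Y)"
    using xt semi_simplicial_mapD(4)[OF f] by (simp add: mem_realization_sum_iff)
  from mem_region_iff[OF Q this] mem_region_iff[OF Q z(1)] show ?thesis
    unfolding z(2) fat_realization_map_class[OF f xt] by simp
qed

section \<open>Contraction of the open pieces\<close>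

lemma locally_compact_unit_interval: "locally_compact_space (top_of_set \<I>)"
  by (simp add: compact_imp_locally_compact_space compact_space_subtopology)

text \<open>The interval is locally compact Hausdorff, so its product with a quotient map is again
  one. Homotopies defined on representatives thus descend, whatever the levels are.\<close>

lemma quotient_map_cylinder:
  assumes "quotient_map X Y q"
  shows "quotient_map (prod_topology (top_of_set \<I>) X) (prod_topology (top_of_set \<I>) Y) (\<lambda>(s, x). (s, q x))"
  by (rule quotient_map_prod_right[OF locally_compact_unit_interval _ assms])
     (simp add: Hausdorff_space_subtopology)

lemma continuous_map_convex_comb:
  assumes w: "w \<in> standard_simplex n"
  shows "continuous_map (prod_topology (top_of_set \<I>) (simplex_space n)) (simplex_space n)
    (\<lambda>z. convex_comb (fst z) (snd z) w)"
proof -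
  have "continuous_map (top_of_set (\<I> \<times> standard_simplex n)) (top_of_set (standard_simplex n))
      (\<lambda>z. convex_comb (fst z) (snd z) w)"
    unfolding continuous_map_in_subtopology
  proof (intro conjI)
    show "continuous_map (top_of_set (\<I> \<times> standard_simplex n)) euclidean (\<lambda>z. convex_comb (fst z) (snd z) w)"
      unfolding continuous_map_iff_continuous convex_comb_def by (intro continuous_intros)
    show "(\<lambda>z. convex_comb (fst z) (snd z) w) \<in> topspace (top_of_set (\<I> \<times> standard_simplex n)) \<rightarrow> standard_simplex n"
      using convex_comb_mem[OF _ _ w] by (intro Pi_I) (simp add: mem_Times_iff)
  qed
  then show ?thesis
    unfolding simplex_space_def euclidean_product_topology by simp
qed

text \<open>The linear contraction \<open>D\<close> ends in the copy of the level \<open>X\<^sub>m\<close> over the point \<open>\<tau>\<close> of the simplex.\<close>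

lemma flag_region_retraction:
  assumes X: "semi_simplicial_space X" and \<C>: "\<C> \<subseteq> Pow {..m}" "{..m} \<in> \<C>"
    and \<tau>: "\<tau> \<in> standard_simplex m" "\<And>C. C \<in> \<C> \<Longrightarrow> dominant C \<tau>"
  defines "R \<equiv> subtopology (fat_realization X) (region X (flag_type m \<C>))"
  obtains r D where "continuous_map R (level X m) r"
    "continuous_map (prod_topology (top_of_set \<I>) R) R D"
    "\<And>n x t \<theta>. x \<in> topspace (level X n) \<Longrightarrow> t \<in> standard_simplex n \<Longrightarrow> flag_map m \<C> n t \<theta> \<Longrightarrow>
      r (realization_class X (n, x, t)) = act X m n \<theta> x"
    "\<And>n x t \<theta> s. x \<in> topspace (level X n) \<Longrightarrow> t \<in> standard_simplex n \<Longrightarrow> flag_map m \<C> n t \<theta> \<Longrightarrow> s \<in> \<I> \<Longrightarrow>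
      D (s, realization_class X (n, x, t)) = realization_class X (n, x, convex_comb s t (simplex_push m \<theta> \<tau>))"
proof -
  let ?Q = "flag_type m \<C>"
  let ?S = "subtopology (realization_sum X) (sum_region X ?Q)"
  let ?cls = "realization_class X"
  have Q: "open_simplex_condition ?Q"
    by (rule open_simplex_condition_flag_type[OF \<C>])
  have quot: "quotient_map ?S R ?cls"
    unfolding R_def by (rule quotient_map_region[OF Q])
  have topS: "topspace ?S = sum_region X ?Q"
    unfolding sum_region_def by auto
  \<comment> \<open>The choice is harmless: by \<open>flag_map_unique\<close> there is at most one
    such injection.\<close>
  define \<theta>of where "\<theta>of n t = (SOME \<theta>. flag_map m \<C> n t \<theta>)" for n t
  have \<theta>of: "\<theta>of n t = \<theta>" if "flag_map m \<C> n t \<theta>" for n t \<theta>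
    using flag_map_unique[OF someI[of "flag_map m \<C> n t", OF that] that \<C>(2)] unfolding \<theta>of_def .
  have fm_iff: "flag_map m \<C> n t \<theta> \<longleftrightarrow> (\<forall>C\<in>\<C>. dominant (\<theta> ` C) t)" if "\<theta> \<in> Delta_plus_hom m n" for n t \<theta>
    using that unfolding flag_map_def by simp
  have comb_mem: "convex_comb s t (simplex_push m \<theta> \<tau>) \<in> standard_simplex n"
    "flag_map m \<C> n (convex_comb s t (simplex_push m \<theta> \<tau>)) \<theta>"
    if fm: "flag_map m \<C> n t \<theta>" and t: "t \<in> standard_simplex n" and s: "s \<in> \<I>" for n t \<theta> s
  proof -
    have \<theta>: "\<theta> \<in> Delta_plus_hom m n"
      using fm unfolding flag_map_def by blast
    show "convex_comb s t (simplex_push m \<theta> \<tau>) \<in> standard_simplex n"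
      by (rule convex_comb_mem[OF s t simplex_push_mem[OF \<theta> \<tau>(1)]])
    show "flag_map m \<C> n (convex_comb s t (simplex_push m \<theta> \<tau>)) \<theta>"
      unfolding fm_iff[OF \<theta>]
    proof
      fix C assume C: "C \<in> \<C>"
      then have "dominant (\<theta> ` C) (simplex_push m \<theta> \<tau>)"
        using dominant_push_iff[OF \<theta> \<tau>(1), of C] \<tau>(2) \<C>(1) by blast
      moreover have "dominant (\<theta> ` C) t"
        using fm C unfolding flag_map_def by blast
      ultimately show "dominant (\<theta> ` C) (convex_comb s t (simplex_push m \<theta> \<tau>))"
        using dominant_convex_comb s by blast
    qed
  qed
  \<comment> \<open>Maps on the region depend on the injection, which varies with the point. On the
    open piece belonging to a fixed \<open>n\<close> and a fixed injection it is constant, so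
    continuity is clear there and is pasted.\<close>
  define idx where "idx = {(n, \<theta>). \<theta> \<in> Delta_plus_hom m n}"
  define piece where "piece p = {z \<in> topspace (realization_sum X). fst z = fst p \<and> (\<forall>C\<in>\<C>. dominant (snd p ` C) (snd (snd z)))}"
    for p :: "nat \<times> (nat \<Rightarrow> nat)"
  have piece_sub: "piece p \<subseteq> sum_region X ?Q" if "p \<in> idx" for p
    using that unfolding piece_def sum_region_def idx_def flag_type_def flag_map_def by auto
  have piece_open: "openin (realization_sum X) (piece p)" if "p \<in> idx" for p
  proof -
    have "piece p = sum_region X (\<lambda>n t. n = fst p \<and> (\<forall>C\<in>\<C>. dominant (snd p ` C) t))"
      unfolding piece_def sum_region_def ..
    moreover have "openin (simplex_space n) {t \<in> standard_simplex n. n = fst p \<and> (\<forall>C\<in>\<C>. dominant (snd p ` C) t)}" for n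
      using openin_flag_map[OF \<C>(1), of n "snd p"] by (cases "n = fst p") simp_all
    ultimately show ?thesis
      by (simp only: openin_sum_region)
  qed
  have piece_flag: "flag_map m \<C> (fst z) (snd (snd z)) (snd p)" if "p \<in> idx" "z \<in> piece p" for p z
    using that unfolding piece_def idx_def flag_map_def by auto
  have piece_cover: "\<exists>p\<in>idx. z \<in> piece p" if z: "z \<in> sum_region X ?Q" for z
  proof -
    obtain \<theta> where "flag_map m \<C> (fst z) (snd (snd z)) \<theta>"
      using z unfolding sum_region_def flag_type_def by blast
    then have "(fst z, \<theta>) \<in> idx" "z \<in> piece (fst z, \<theta>)"
      using z unfolding idx_def piece_def sum_region_def flag_map_def by auto
    then show ?thesis
      by blast
  qed
  have subS: "subtopology ?S (piece p) = subtopology (realization_sum X) (piece p)" if "p \<in> idx" for p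
    using piece_sub[OF that] by (simp add: subtopology_subtopology Int_absorb1)
  have snd_cont: "continuous_map (subtopology (realization_sum X) (piece p))
      (prod_topology (level X (fst p)) (simplex_space (fst p))) snd" for p
    unfolding realization_sum_def
    by (rule continuous_map_from_subtopology_mono[OF continuous_map_sum_component])
       (auto simp: piece_def realization_sum_def)
  define g where "g z = act X m (fst z) (\<theta>of (fst z) (snd (snd z))) (fst (snd z))" for z
  \<comment> \<open>Functoriality: pushing the simplex point along \<open>\<theta>\<close> composes
    its injection with \<open>\<theta>\<close>, and the action of the composite first applies
    \<open>\<theta>\<close>.\<close>
  have g_glue: "g z = g z'" if z: "z \<in> sum_region X ?Q" "z' \<in> topspace (realization_sum X)" "?cls z = ?cls z'" for z z'
  proof (rule sum_region_invariant[OF Q _ z])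
    fix m' n \<theta> x t
    assume \<theta>: "\<theta> \<in> Delta_plus_hom m' n" and x: "x \<in> topspace (level X n)" and t: "t \<in> standard_simplex m'"
      and "?Q m' t"
    then obtain \<psi> where \<psi>: "flag_map m \<C> m' t \<psi>"
      unfolding flag_type_def by blast
    then have "\<psi> \<in> Delta_plus_hom m m'"
      unfolding flag_map_def by blast
    then show "g (m', act X m' n \<theta> x, t) = g (n, x, simplex_push m' \<theta> t)"
      unfolding g_def using \<theta>of[OF \<psi>] \<theta>of[OF flag_map_push[OF \<theta> t \<C>(1) \<psi>]]
      by (simp add: semi_simplicial_spaceD(3)[OF X _ \<theta> x])
  qed
  have g_cont: "continuous_map ?S (level X m) g"
  proof (rule pasting_lemma[where I=idx and T=piece and f="\<lambda>p z. act X m (fst p) (snd p) (fst (snd z))"])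
    show "openin ?S (piece p)" if "p \<in> idx" for p
      using piece_open[OF that] piece_sub[OF that] unfolding openin_subtopology by blast
    show "continuous_map (subtopology ?S (piece p)) (level X m) (\<lambda>z. act X m (fst p) (snd p) (fst (snd z)))" if "p \<in> idx" for p
    proof -
      have "snd p \<in> Delta_plus_hom m (fst p)"
        using that unfolding idx_def by auto
      from continuous_map_compose[OF continuous_map_compose[OF snd_cont continuous_map_fst] semi_simplicial_spaceD(1)[OF X this]]
      show ?thesis
        unfolding subS[OF that] by (simp add: o_def)
    qed
    show "act X m (fst p) (snd p) (fst (snd z)) = act X m (fst p') (snd p') (fst (snd z))"
      if "p \<in> idx" "p' \<in> idx" "z \<in> topspace ?S \<inter> piece p \<inter> piece p'" for p p' z
    proof -
      have "snd p = snd p'"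
        using flag_map_unique[OF piece_flag[of p z] piece_flag[of p' z] \<C>(2)] that by blast
      moreover have "fst p = fst p'"
        using that unfolding piece_def by auto
      ultimately show ?thesis
        by simp
    qed
    show "\<exists>p. p \<in> idx \<and> z \<in> piece p \<and> g z = act X m (fst p) (snd p) (fst (snd z))" if zS: "z \<in> topspace ?S" for z
    proof -
      obtain p where p: "p \<in> idx" "z \<in> piece p"
        using piece_cover[of z] zS unfolding topS by blast
      have "fst p = fst z"
        using p(2) unfolding piece_def by simp
      then have "g z = act X m (fst p) (snd p) (fst (snd z))"
        unfolding g_def \<theta>of[OF piece_flag[OF p]] by simp
      then show ?thesis
        using p by blast
    qed
  qed
  obtain r where r: "continuous_map R (level X m) r" "\<And>z. z \<in> topspace ?S \<Longrightarrow> r (?cls z) = g z"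
    by (rule quotient_map_lift_exists[OF quot g_cont]) (use g_glue in \<open>auto simp: topS sum_region_def\<close>)
  \<comment> \<open>Only the simplex coordinates move, in a straight line towards the copy of
    \<open>\<tau>\<close> in the face named by the injection; the point of the level stays
    fixed.\<close>
  define K where "K p = ?cls (fst (snd p), fst (snd (snd p)),
      convex_comb (fst p) (snd (snd (snd p))) (simplex_push m (\<theta>of (fst (snd p)) (snd (snd (snd p)))) \<tau>))"
    for p :: "real \<times> nat \<times> 'a \<times> (nat \<Rightarrow> real)"
  \<comment> \<open>Pushing forward commutes with convex combinations and with composition, so the
    straight line to the copy of \<open>\<tau>\<close> is carried to the corresponding line in the
    larger simplex.\<close>
  have K_glue: "K (s, z) = K (s, z')"
    if z: "z \<in> sum_region X ?Q" "z' \<in> topspace (realization_sum X)" "?cls z = ?cls z'" and s: "s \<in> \<I>" for s z z'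
  proof (rule sum_region_invariant[where G="\<lambda>z. K (s, z)", OF Q _ z])
    fix m' n \<theta> x t
    assume \<theta>: "\<theta> \<in> Delta_plus_hom m' n" and x: "x \<in> topspace (level X n)" and t: "t \<in> standard_simplex m'"
      and "?Q m' t"
    then obtain \<psi> where \<psi>: "flag_map m \<C> m' t \<psi>"
      unfolding flag_type_def by blast
    have \<psi>': "\<psi> \<in> Delta_plus_hom m m'"
      using \<psi> unfolding flag_map_def by blast
    have "K (s, m', act X m' n \<theta> x, t) = ?cls (n, x, simplex_push m' \<theta> (convex_comb s t (simplex_push m \<psi> \<tau>)))"
      unfolding K_def using \<theta>of[OF \<psi>]
      by (simp add: realization_class_glue[OF X \<theta> x comb_mem(1)[OF \<psi> t s]])
    also have "\<dots> = K (s, n, x, simplex_push m' \<theta> t)"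
      unfolding K_def using \<theta>of[OF flag_map_push[OF \<theta> t \<C>(1) \<psi>]]
      by (simp add: simplex_push_convex_comb[OF \<theta>] simplex_push_compose[OF \<psi>' \<theta>])
    finally show "K (s, m', act X m' n \<theta> x, t) = K (s, n, x, simplex_push m' \<theta> t)" .
  qed
  have K_eq: "K (s, z) = ?cls (fst z, fst (snd z), convex_comb s (snd (snd z)) (simplex_push m \<theta> \<tau>))"
    if "flag_map m \<C> (fst z) (snd (snd z)) \<theta>" for s z \<theta>
    unfolding K_def using \<theta>of[OF that] by simp
  have K_cont: "continuous_map (prod_topology (top_of_set \<I>) ?S) (fat_realization X) K"
  proof (rule pasting_lemma[where I=idx and T="\<lambda>p. \<I> \<times> piece p" and
        f="\<lambda>p y. ?cls (fst p, fst (snd (snd y)), convex_comb (fst y) (snd (snd (snd y))) (simplex_push m (snd p) \<tau>))"])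
    show "openin (prod_topology (top_of_set \<I>) ?S) (\<I> \<times> piece p)" if "p \<in> idx" for p
    proof -
      have "openin ?S (piece p)"
        using piece_open[OF that] piece_sub[OF that] unfolding openin_subtopology by blast
      then show ?thesis
        by (simp add: openin_prod_Times_iff)
    qed
    show "continuous_map (subtopology (prod_topology (top_of_set \<I>) ?S) (\<I> \<times> piece p)) (fat_realization X)
        (\<lambda>y. ?cls (fst p, fst (snd (snd y)), convex_comb (fst y) (snd (snd (snd y))) (simplex_push m (snd p) \<tau>)))"
      if p: "p \<in> idx" for p
    proof -
      let ?n = "fst p"
      let ?P = "prod_topology (top_of_set \<I>) (subtopology (realization_sum X) (piece p))"
      have eq: "subtopology (prod_topology (top_of_set \<I>) ?S) (\<I> \<times> piece p) = ?P"
        using subS[OF p] by (simp add: subtopology_Times subtopology_subtopology)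
      have \<theta>: "snd p \<in> Delta_plus_hom m ?n"
        using p unfolding idx_def by auto
      have s: "continuous_map ?P (prod_topology (level X ?n) (simplex_space ?n)) (\<lambda>y. snd (snd y))"
        using continuous_map_compose[OF continuous_map_snd snd_cont] by (simp add: o_def)
      have 1: "continuous_map ?P (level X ?n) (\<lambda>y. fst (snd (snd y)))"
        using continuous_map_compose[OF s continuous_map_fst] by (simp add: o_def)
      have 2: "continuous_map ?P (simplex_space ?n) (\<lambda>y. snd (snd (snd y)))"
        using continuous_map_compose[OF s continuous_map_snd] by (simp add: o_def)
      have "continuous_map ?P (prod_topology (top_of_set \<I>) (simplex_space ?n)) (\<lambda>y. (fst y, snd (snd (snd y))))"
        by (intro continuous_map_pairedI continuous_map_fst 2)
      from continuous_map_compose[OF this continuous_map_convex_comb[OF simplex_push_mem[OF \<theta> \<tau>(1)]]]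
      have 3: "continuous_map ?P (simplex_space ?n) (\<lambda>y. convex_comb (fst y) (snd (snd (snd y))) (simplex_push m (snd p) \<tau>))"
        by (simp add: o_def)
      have "continuous_map ?P (prod_topology (level X ?n) (simplex_space ?n))
          (\<lambda>y. (fst (snd (snd y)), convex_comb (fst y) (snd (snd (snd y))) (simplex_push m (snd p) \<tau>)))"
        by (intro continuous_map_pairedI 1 3)
      from continuous_map_compose[OF this
          continuous_map_component_injection[of ?n UNIV "\<lambda>n. prod_topology (level X n) (simplex_space n)"]]
      have "continuous_map ?P (realization_sum X)
          (\<lambda>y. (?n, fst (snd (snd y)), convex_comb (fst y) (snd (snd (snd y))) (simplex_push m (snd p) \<tau>)))"
        unfolding realization_sum_def by (simp add: o_def)
      from continuous_map_compose[OF this quotient_imp_continuous_map[OF quotient_map_fat_realization]]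
      show ?thesis
        unfolding eq by (simp add: o_def)
    qed
    show "?cls (fst p, fst (snd (snd y)), convex_comb (fst y) (snd (snd (snd y))) (simplex_push m (snd p) \<tau>)) =
        ?cls (fst p', fst (snd (snd y)), convex_comb (fst y) (snd (snd (snd y))) (simplex_push m (snd p') \<tau>))"
      if "p \<in> idx" "p' \<in> idx" "y \<in> topspace (prod_topology (top_of_set \<I>) ?S) \<inter> \<I> \<times> piece p \<inter> \<I> \<times> piece p'" for p p' y
    proof -
      have y: "snd y \<in> piece p" "snd y \<in> piece p'"
        using that(3) by (simp_all only: Int_iff mem_Times_iff)
      have "snd p = snd p'"
        by (rule flag_map_unique[OF piece_flag[OF that(1) y(1)] piece_flag[OF that(2) y(2)] \<C>(2)])
      moreover have "fst p = fst p'"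
        using y unfolding piece_def by auto
      ultimately show ?thesis
        by simp
    qed
    show "\<exists>p. p \<in> idx \<and> y \<in> \<I> \<times> piece p \<and>
        K y = ?cls (fst p, fst (snd (snd y)), convex_comb (fst y) (snd (snd (snd y))) (simplex_push m (snd p) \<tau>))"
      if "y \<in> topspace (prod_topology (top_of_set \<I>) ?S)" for y
    proof -
      have y: "fst y \<in> \<I>" "snd y \<in> sum_region X ?Q"
        using that unfolding topspace_prod_topology topS mem_Times_iff by simp_all
      obtain p where p: "p \<in> idx" "snd y \<in> piece p"
        using piece_cover[OF y(2)] by blast
      have "fst p = fst (snd y)"
        using p(2) unfolding piece_def by simp
      then have "K y = ?cls (fst p, fst (snd (snd y)), convex_comb (fst y) (snd (snd (snd y))) (simplex_push m (snd p) \<tau>))"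
        using K_eq[OF piece_flag[OF p], of "fst y"] by simp
      moreover have "y \<in> \<I> \<times> piece p"
        using y(1) p(2) by (simp only: mem_Times_iff)
      ultimately show ?thesis
        using p(1) by blast
    qed
  qed
  \<comment> \<open>The contraction stays in the region because dominance of each member of the flag
    is preserved by convex combinations.\<close>
  have K_R: "K y \<in> region X ?Q" if "y \<in> \<I> \<times> sum_region X ?Q" for y
  proof -
    have y: "fst y \<in> \<I>" "snd y \<in> sum_region X ?Q"
      using that by (simp_all only: mem_Times_iff)
    obtain n x t where z: "snd y = (n, x, t)"
      by (metis prod.collapse)
    have xt: "x \<in> topspace (level X n)" "t \<in> standard_simplex n" "?Q n t"
      using y(2) unfolding sum_region_def z by (simp_all add: mem_realization_sum_iff)
    then obtain \<theta> where \<theta>: "flag_map m \<C> n t \<theta>"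
      unfolding flag_type_def by blast
    have "(n, x, convex_comb (fst y) t (simplex_push m \<theta> \<tau>)) \<in> sum_region X ?Q"
      using xt comb_mem[OF \<theta> xt(2) y(1)] unfolding sum_region_def flag_type_def by (auto simp: mem_realization_sum_iff)
    moreover have "K y = ?cls (n, x, convex_comb (fst y) t (simplex_push m \<theta> \<tau>))"
    proof -
      have "K (fst y, snd y) = ?cls (n, x, convex_comb (fst y) t (simplex_push m \<theta> \<tau>))"
        unfolding z using K_eq[of "(n, x, t)" \<theta> "fst y"] \<theta> by simp
      then show ?thesis
        by simp
    qed
    ultimately show ?thesis
      unfolding region_def by blast
  qed
  have K_cont': "continuous_map (prod_topology (top_of_set \<I>) ?S) R K"
    unfolding R_def continuous_map_in_subtopology using K_cont K_R by (auto simp: topS)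
  have K_compat: "K y = K y'"
    if "y \<in> topspace (prod_topology (top_of_set \<I>) ?S)" "y' \<in> topspace (prod_topology (top_of_set \<I>) ?S)"
      "(\<lambda>(s, z). (s, ?cls z)) y = (\<lambda>(s, z). (s, ?cls z)) y'" for y y'
  proof -
    have y: "fst y \<in> \<I>" "snd y \<in> sum_region X ?Q" and y': "snd y' \<in> sum_region X ?Q"
      using that(1,2) unfolding topspace_prod_topology topS mem_Times_iff by simp_all
    have "fst y = fst y'" "?cls (snd y) = ?cls (snd y')"
      using that(3) by (simp_all add: case_prod_unfold)
    then show ?thesis
      using K_glue[OF y(2) _ _ y(1), of "snd y'"] y' unfolding sum_region_def by (metis (mono_tags, lifting) mem_Collect_eq prod.collapse)
  qed
  \<comment> \<open>\<open>K\<close> descends along the product of the interval with the quotient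
    map.\<close>
  obtain D where D: "continuous_map (prod_topology (top_of_set \<I>) R) R D"
    "\<And>y. y \<in> topspace (prod_topology (top_of_set \<I>) ?S) \<Longrightarrow> D ((\<lambda>(s, z). (s, ?cls z)) y) = K y"
  proof (rule quotient_map_lift_exists[OF quotient_map_cylinder[OF quot] K_cont'])
    fix D
    assume D: "continuous_map (prod_topology (top_of_set \<I>) R) R D"
      "\<And>y. y \<in> topspace (prod_topology (top_of_set \<I>) ?S) \<Longrightarrow> D ((\<lambda>(s, z). (s, ?cls z)) y) = K y"
    show thesis
      by (rule that[OF D])
  qed (rule K_compat)
  show ?thesis
  proof (rule that[OF r(1) D(1)])
    fix n x t \<theta> assume xt: "x \<in> topspace (level X n)" "t \<in> standard_simplex n" and \<theta>: "flag_map m \<C> n t \<theta>"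
    have mem: "(n, x, t) \<in> topspace ?S"
      unfolding topS sum_region_def flag_type_def using xt \<theta> by (auto simp: mem_realization_sum_iff)
    show "r (?cls (n, x, t)) = act X m n \<theta> x"
      using r(2)[OF mem] \<theta>of[OF \<theta>] unfolding g_def by simp
    show "D (s, ?cls (n, x, t)) = ?cls (n, x, convex_comb s t (simplex_push m \<theta> \<tau>))" if "s \<in> \<I>" for s
      using D(2)[of "(s, n, x, t)"] mem that K_eq[of "(n, x, t)" \<theta> s] \<theta> by simp
  qed
qed

lemma region_mono: "(\<And>n t. Q n t \<Longrightarrow> Q' n t) \<Longrightarrow> region X Q \<subseteq> region X Q'"
  unfolding region_def sum_region_def by blast

lemma flag_region_cases:
  assumes c: "c \<in> region X (flag_type m \<C>)"
  obtains n x t \<theta> where "c = realization_class X (n, x, t)" "x \<in> topspace (level X n)"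
    "t \<in> standard_simplex n" "flag_map m \<C> n t \<theta>"
proof -
  obtain z where z: "z \<in> sum_region X (flag_type m \<C>)" "c = realization_class X z"
    using c unfolding region_def by blast
  obtain n x t where nxt: "z = (n, x, t)"
    by (metis prod.collapse)
  have "x \<in> topspace (level X n)" "t \<in> standard_simplex n" "flag_type m \<C> n t"
    using z(1) unfolding nxt sum_region_def by (simp_all add: mem_realization_sum_iff)
  then show ?thesis
    using z(2) that unfolding nxt flag_type_def by blast
qed

text \<open>Supplies the inclusion of level \<open>m\<close> into the piece, as the slice over the
  fixed simplex point \<open>\<tau>\<close>.\<close>

lemma continuous_map_flag_region_section:
  assumes \<tau>: "\<tau> \<in> standard_simplex m" "flag_map m \<C> m \<tau> \<theta>"
  shows "continuous_map (level X m) (subtopology (fat_realization X) (region X (flag_type m \<C>)))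
    (\<lambda>x. realization_class X (m, x, \<tau>))"
proof -
  have "continuous_map (level X m) (prod_topology (level X m) (simplex_space m)) (\<lambda>x. (x, \<tau>))"
    using \<tau>(1) by (intro continuous_map_pairedI) simp_all
  from continuous_map_compose[OF this
      continuous_map_component_injection[of m UNIV "\<lambda>n. prod_topology (level X n) (simplex_space n)"]]
  have "continuous_map (level X m) (realization_sum X) (\<lambda>x. (m, x, \<tau>))"
    unfolding realization_sum_def by (simp add: o_def)
  from continuous_map_compose[OF this quotient_imp_continuous_map[OF quotient_map_fat_realization]]
  have "continuous_map (level X m) (fat_realization X) (\<lambda>x. realization_class X (m, x, \<tau>))"
    by (simp add: o_def)
  moreover have "realization_class X (m, x, \<tau>) \<in> region X (flag_type m \<C>)" if "x \<in> topspace (level X m)" for x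
    unfolding region_def sum_region_def flag_type_def
    using that \<tau> by (intro imageI) (auto simp: mem_realization_sum_iff)
  ultimately show ?thesis
    by (auto simp: continuous_map_in_subtopology)
qed

text \<open>One centre \<open>\<tau>\<close> is used for both \<open>X\<close> and \<open>Y\<close>,
  which makes retractions, sections and contractions commute with the induced map. If no centre
  exists, no point carries the flag and both pieces are empty.\<close>

lemma lifting_equivalence_flag_region:
  assumes f: "semi_simplicial_map X Y f" and L: "\<And>n. lifting_equivalence (f n) (level X n) (level Y n)"
    and \<C>: "\<C> \<subseteq> Pow {..m}" "{..m} \<in> \<C>"
  shows "lifting_equivalence (fat_realization_map Y f)
    (subtopology (fat_realization X) (region X (flag_type m \<C>)))
    (subtopology (fat_realization Y) (region Y (flag_type m \<C>)))"
proof (cases "\<exists>\<tau>\<in>standard_simplex m. \<forall>C\<in>\<C>. dominant C \<tau>")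
  case False
  then have no_flag: "\<not> flag_map m \<C> n t \<theta>" if "t \<in> standard_simplex n" for n t \<theta>
    using flag_centre[OF _ \<C> that] by blast
  show ?thesis
  proof (rule lifting_equivalence_empty)
    show "topspace (subtopology (fat_realization Y) (region Y (flag_type m \<C>))) = {}"
      "topspace (subtopology (fat_realization X) (region X (flag_type m \<C>))) = {}"
      using no_flag by (auto elim: flag_region_cases)
  qed
next
  case True
  then obtain \<tau> where \<tau>: "\<tau> \<in> standard_simplex m" "\<And>C. C \<in> \<C> \<Longrightarrow> dominant C \<tau>"
    by blast
  note fD = semi_simplicial_mapD[OF f]
  let ?Q = "flag_type m \<C>"
  let ?F = "fat_realization_map Y f"
  have Q: "open_simplex_condition ?Q"
    by (rule open_simplex_condition_flag_type[OF \<C>])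
  have fm\<tau>: "flag_map m \<C> m \<tau> (restrict id {..m})"
  proof -
    have "restrict id {..m} ` C = C" if "C \<in> \<C>" for C
    proof -
      have "C \<subseteq> {..m}" using that \<C>(1) by blast
      then show ?thesis by (auto simp: image_iff subset_iff)
    qed
    then show ?thesis
      unfolding flag_map_def using Delta_plus_hom_id \<tau>(2) by simp
  qed
  obtain r D where r: "continuous_map (subtopology (fat_realization X) (region X ?Q)) (level X m) r"
    and D: "continuous_map (prod_topology (top_of_set \<I>) (subtopology (fat_realization X) (region X ?Q)))
       (subtopology (fat_realization X) (region X ?Q)) D"
    and r_eq: "\<And>n x t \<theta>. x \<in> topspace (level X n) \<Longrightarrow> t \<in> standard_simplex n \<Longrightarrow> flag_map m \<C> n t \<theta> \<Longrightarrow>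
      r (realization_class X (n, x, t)) = act X m n \<theta> x"
    and D_eq: "\<And>n x t \<theta> s. x \<in> topspace (level X n) \<Longrightarrow> t \<in> standard_simplex n \<Longrightarrow> flag_map m \<C> n t \<theta> \<Longrightarrow> s \<in> \<I> \<Longrightarrow>
      D (s, realization_class X (n, x, t)) = realization_class X (n, x, convex_comb s t (simplex_push m \<theta> \<tau>))"
    by (rule flag_region_retraction[OF fD(1) \<C> \<tau>(1)]) (erule \<tau>(2), rule that)
  obtain r' D' where r': "continuous_map (subtopology (fat_realization Y) (region Y ?Q)) (level Y m) r'"
    and D': "continuous_map (prod_topology (top_of_set \<I>) (subtopology (fat_realization Y) (region Y ?Q)))
       (subtopology (fat_realization Y) (region Y ?Q)) D'"
    and r'_eq: "\<And>n x t \<theta>. x \<in> topspace (level Y n) \<Longrightarrow> t \<in> standard_simplex n \<Longrightarrow> flag_map m \<C> n t \<theta> \<Longrightarrow>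
      r' (realization_class Y (n, x, t)) = act Y m n \<theta> x"
    and D'_eq: "\<And>n x t \<theta> s. x \<in> topspace (level Y n) \<Longrightarrow> t \<in> standard_simplex n \<Longrightarrow> flag_map m \<C> n t \<theta> \<Longrightarrow> s \<in> \<I> \<Longrightarrow>
      D' (s, realization_class Y (n, x, t)) = realization_class Y (n, x, convex_comb s t (simplex_push m \<theta> \<tau>))"
    by (rule flag_region_retraction[OF fD(2) \<C> \<tau>(1)]) (erule \<tau>(2), rule that)
  have comb0: "convex_comb 0 t w = t" and comb1: "convex_comb 1 t w = w" for t w
    by (simp_all add: convex_comb_def)
  have one: "(1::real) \<in> \<I>" and zero: "(0::real) \<in> \<I>"
    by simp_all
  have F_eq: "?F (realization_class X (n, x, t)) = realization_class Y (n, f n x, t)"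
    if "x \<in> topspace (level X n)" "t \<in> standard_simplex n" for n x t
    by (rule fat_realization_map_class[OF f that])
  have F_cont: "continuous_map (subtopology (fat_realization X) (region X ?Q)) (subtopology (fat_realization Y) (region Y ?Q)) ?F"
    unfolding continuous_map_in_subtopology
  proof (intro conjI continuous_map_from_subtopology continuous_map_fat_realization_map[OF f])
    show "?F \<in> topspace (subtopology (fat_realization X) (region X ?Q)) \<rightarrow> region Y ?Q"
      using fat_realization_map_region_iff[OF f Q] by auto
  qed
  show ?thesis
  proof (rule lifting_equivalence_deformation[OF L F_cont r r'
        continuous_map_flag_region_section[OF \<tau>(1) fm\<tau>] continuous_map_flag_region_section[OF \<tau>(1) fm\<tau>] D D'])
    fix c assume "c \<in> topspace (subtopology (fat_realization X) (region X ?Q))"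
    then have "c \<in> region X ?Q"
      by simp
    then obtain n x t \<theta> where c: "c = realization_class X (n, x, t)"
      and x: "x \<in> topspace (level X n)" and t: "t \<in> standard_simplex n" and \<theta>: "flag_map m \<C> n t \<theta>"
      by (rule flag_region_cases)
    have \<theta>': "\<theta> \<in> Delta_plus_hom m n"
      using \<theta> unfolding flag_map_def by blast
    show "D (0, c) = c"
      unfolding c D_eq[OF x t \<theta> zero] comb0 ..
    \<comment> \<open>At time 1 the simplex point is the push of \<open>\<tau>\<close> along
      \<open>\<theta>\<close>, so the gluing relation moves the class to level
      \<open>m\<close>.\<close>
    show "D (1, c) = realization_class X (m, r c, \<tau>)"
      unfolding c D_eq[OF x t \<theta> one] comb1 r_eq[OF x t \<theta>]
      by (rule realization_class_glue[OF fD(1) \<theta>' x \<tau>(1), symmetric])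
    show "r' (?F c) = f m (r c)"
      unfolding c F_eq[OF x t] r_eq[OF x t \<theta>] r'_eq[OF fD(4)[OF x] t \<theta>] by (rule fD(5)[OF \<theta>' x, symmetric])
    show "?F (D (s, c)) = D' (s, ?F c)" if s: "s \<in> \<I>" for s
      unfolding c F_eq[OF x t] D_eq[OF x t \<theta> s] D'_eq[OF fD(4)[OF x] t \<theta> s]
      by (rule F_eq[OF x convex_comb_mem[OF s t simplex_push_mem[OF \<theta>' \<tau>(1)]]])
  next
    fix c assume "c \<in> topspace (subtopology (fat_realization Y) (region Y ?Q))"
    then have "c \<in> region Y ?Q"
      by simp
    then obtain n x t \<theta> where c: "c = realization_class Y (n, x, t)"
      and x: "x \<in> topspace (level Y n)" and t: "t \<in> standard_simplex n" and \<theta>: "flag_map m \<C> n t \<theta>"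
      by (rule flag_region_cases)
    have \<theta>': "\<theta> \<in> Delta_plus_hom m n"
      using \<theta> unfolding flag_map_def by blast
    show "D' (0, c) = c"
      unfolding c D'_eq[OF x t \<theta> zero] comb0 ..
    show "D' (1, c) = realization_class Y (m, r' c, \<tau>)"
      unfolding c D'_eq[OF x t \<theta> one] comb1 r'_eq[OF x t \<theta>]
      by (rule realization_class_glue[OF fD(2) \<theta>' x \<tau>(1), symmetric])
  next
    fix x assume "x \<in> topspace (level X m)"
    then show "?F (realization_class X (m, x, \<tau>)) = realization_class Y (m, f m x, \<tau>)"
      by (rule F_eq[OF _ \<tau>(1)])
  qed
qed

text \<open>Locality is applied a second time, to the cover by the flag pieces. Their disjointness
  reduces every finite intersection to a single piece or to the empty set.\<close>

lemma lifting_equivalence_region_Int: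
  assumes f: "semi_simplicial_map X Y f" and L: "\<And>n. lifting_equivalence (f n) (level X n) (level Y n)"
    and S: "finite S" "S \<noteq> {}"
  defines "Q \<equiv> \<lambda>n t. \<forall>k\<in>S. has_dominant k n t"
  shows "lifting_equivalence (fat_realization_map Y f)
    (subtopology (fat_realization X) (region X Q)) (subtopology (fat_realization Y) (region Y Q))"
proof -
  let ?F = "fat_realization_map Y f"
  let ?m = "Max S"
  have Q: "open_simplex_condition Q"
    unfolding Q_def by (rule open_simplex_condition_Ball[OF S(1) open_simplex_condition_has_dominant])
  have flag: "\<C> \<subseteq> Pow {..?m}" "{..?m} \<in> \<C>" if "\<C> \<in> flags S" for \<C>
    using that unfolding flags_def by blast+
  have P: "open_simplex_condition (flag_type ?m \<C>)" if "\<C> \<in> flags S" for \<C>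
    by (rule open_simplex_condition_flag_type[OF flag[OF that]])
  have sub: "region X (flag_type ?m \<C>) \<subseteq> region X Q" "region Y (flag_type ?m \<C>) \<subseteq> region Y Q"
    if "\<C> \<in> flags S" for \<C>
    unfolding Q_def by (rule region_mono; use flag_type_dominant[OF that] in blast)+
  have F_iff: "?F c \<in> region Y R \<longleftrightarrow> c \<in> region X R" if "open_simplex_condition R" "c \<in> topspace (fat_realization X)" for R c
    by (rule fat_realization_map_region_iff[OF f that])
  have disj: "\<C> = \<C>'" if \<C>: "\<C> \<in> flags S" "\<C>' \<in> flags S" and c: "c \<in> region Y (flag_type ?m \<C>)" "c \<in> region Y (flag_type ?m \<C>')"
    for \<C> \<C>' c
  proof -
    obtain z where z: "z \<in> topspace (realization_sum Y)" "c = realization_class Y z"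
      using c(1) unfolding region_def sum_region_def by blast
    show ?thesis
      using c mem_region_iff[OF P[OF \<C>(1)] z(1)] mem_region_iff[OF P[OF \<C>(2)] z(1)] flag_type_disjoint[OF \<C>]
      unfolding z(2) by blast
  qed
  show ?thesis
  proof (rule lifting_equivalence_open_cover[where M="flags S" and V="\<lambda>\<C>. region Y (flag_type ?m \<C>)"])
    show "continuous_map (subtopology (fat_realization X) (region X Q)) (subtopology (fat_realization Y) (region Y Q)) ?F"
      unfolding continuous_map_in_subtopology
    proof (intro conjI continuous_map_from_subtopology continuous_map_fat_realization_map[OF f])
      show "?F \<in> topspace (subtopology (fat_realization X) (region X Q)) \<rightarrow> region Y Q"
        using F_iff[OF Q] by auto
    qed
    show "openin (subtopology (fat_realization Y) (region Y Q)) (region Y (flag_type ?m \<C>))" if "\<C> \<in> flags S" for \<C>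
      using openin_region[OF P[OF that], of Y] sub(2)[OF that] unfolding openin_subtopology by blast
    show "topspace (subtopology (fat_realization Y) (region Y Q)) \<subseteq> (\<Union>\<C>\<in>flags S. region Y (flag_type ?m \<C>))"
    proof
      fix c assume "c \<in> topspace (subtopology (fat_realization Y) (region Y Q))"
      then obtain n x t where z: "(n, x, t) \<in> topspace (realization_sum Y)" "Q n t" "c = realization_class Y (n, x, t)"
        unfolding region_def sum_region_def by auto
      then have "t \<in> standard_simplex n"
        by (simp add: mem_realization_sum_iff)
      from flag_type_exists[OF S this] z(2) obtain \<C> where "\<C> \<in> flags S" "flag_type ?m \<C> n t"
        unfolding Q_def by blast
      then show "c \<in> (\<Union>\<C>\<in>flags S. region Y (flag_type ?m \<C>))"
        using mem_region_iff[OF P z(1), of \<C>] z(3) by auto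
    qed
    fix T assume T: "finite T" "T \<noteq> {}" "T \<subseteq> flags S"
    let ?W = "\<Inter>\<C>\<in>T. region Y (flag_type ?m \<C>)"
    let ?X = "subtopology (subtopology (fat_realization X) (region X Q))
      {x \<in> topspace (subtopology (fat_realization X) (region X Q)). ?F x \<in> ?W}"
    let ?Y = "subtopology (subtopology (fat_realization Y) (region Y Q)) ?W"
    obtain \<C> where \<C>: "\<C> \<in> T" "\<C> \<in> flags S"
      using T by blast
    show "lifting_equivalence ?F ?X ?Y"
    proof (cases "T = {\<C>}")
      case True
      have "region X Q \<inter> {x \<in> topspace (subtopology (fat_realization X) (region X Q)). ?F x \<in> ?W} =
          region X (flag_type ?m \<C>)"
        using sub(1)[OF \<C>(2)] F_iff[OF P[OF \<C>(2)]] region_subset[of X Q] unfolding True by auto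
      moreover have "region Y Q \<inter> ?W = region Y (flag_type ?m \<C>)"
        using sub(2)[OF \<C>(2)] unfolding True by auto
      ultimately show ?thesis
        using lifting_equivalence_flag_region[OF f L flag[OF \<C>(2)]] by (simp add: subtopology_subtopology)
    next
      \<comment> \<open>Two different flags in \<open>T\<close> already make the intersection
        empty.\<close>
      case False
      then obtain \<C>' where \<C>': "\<C>' \<in> T" "\<C>' \<noteq> \<C>"
        using \<C> by blast
      have W: "?W = {}"
        using disj[of \<C> \<C>'] \<C> \<C>' T(3) by blast
      show ?thesis
        unfolding W by (rule lifting_equivalence_empty) simp_all
    qed
  qed
qed

text \<open>The cover has one member for each dimension of a dominant face. It may be infinite, but
  locality asks only about its finite intersections, and each of these has a largest dimension,
  which selects the level to contract to.\<close>

lemma lifting_equivalence_fat_realization_map: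
  assumes f: "semi_simplicial_map X Y f" and L: "\<And>n. lifting_equivalence (f n) (level X n) (level Y n)"
  shows "lifting_equivalence (fat_realization_map Y f) (fat_realization X) (fat_realization Y)"
proof (rule lifting_equivalence_open_cover[where M=UNIV and V="\<lambda>k. region Y (has_dominant k)"])
  let ?F = "fat_realization_map Y f"
  note H = open_simplex_condition_has_dominant
  show "continuous_map (fat_realization X) (fat_realization Y) ?F"
    by (rule continuous_map_fat_realization_map[OF f])
  show "openin (fat_realization Y) (region Y (has_dominant k))" for k
    by (rule openin_region[OF H])
  show "topspace (fat_realization Y) \<subseteq> (\<Union>k. region Y (has_dominant k))"
  proof
    fix c assume "c \<in> topspace (fat_realization Y)"
    then obtain n x t where z: "(n, x, t) \<in> topspace (realization_sum Y)" "c = realization_class Y (n, x, t)"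
      unfolding topspace_fat_realization by auto
    then obtain k where "has_dominant k n t"
      using ex_has_dominant[of t n] by (auto simp: mem_realization_sum_iff)
    then show "c \<in> (\<Union>k. region Y (has_dominant k))"
      using mem_region_iff[OF H z(1), of k] z(2) by auto
  qed
  fix S :: "nat set" assume S: "finite S" "S \<noteq> {}"
  let ?Q = "\<lambda>n t. \<forall>k\<in>S. has_dominant k n t"
  have Q: "open_simplex_condition ?Q"
    by (rule open_simplex_condition_Ball[OF S(1) H])
  have W: "(\<Inter>k\<in>S. region Y (has_dominant k)) = region Y ?Q"
    by (rule region_Int_INT[OF H S(2) Q])
  have "{x \<in> topspace (fat_realization X). ?F x \<in> region Y ?Q} = region X ?Q"
    using fat_realization_map_region_iff[OF f Q] region_subset[of X ?Q] by auto
  then show "lifting_equivalence ?F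
      (subtopology (fat_realization X) {x \<in> topspace (fat_realization X). ?F x \<in> (\<Inter>k\<in>S. region Y (has_dominant k))})
      (subtopology (fat_realization Y) (\<Inter>k\<in>S. region Y (has_dominant k)))"
    unfolding W using lifting_equivalence_region_Int[OF f L S] by simp
qed

section \<open>Restriction of simplicial spaces to injective maps, and the conclusion\<close>

lemma semi_simplicial_space_restrict:
  assumes "simplicial_space X"
  shows "semi_simplicial_space (restrict_to_Delta_plus X)"
proof -
  have sub: "\<theta> \<in> Delta_hom m n" if "\<theta> \<in> Delta_plus_hom m n" for m n \<theta>
    using that unfolding Delta_plus_hom_def by blast
  have "contravariant_functor Delta_hom X"
    using assms by (simp add: simplicial_space_def)
  then have X: "\<And>m n \<theta>. \<theta> \<in> Delta_hom m n \<Longrightarrow> continuous_map (level X n) (level X m) (act X m n \<theta>)"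
    "\<And>n x. x \<in> topspace (level X n) \<Longrightarrow> act X n n (restrict id {..n}) x = x"
    "\<And>l m n \<phi> \<theta> x. \<phi> \<in> Delta_hom l m \<Longrightarrow> \<theta> \<in> Delta_hom m n \<Longrightarrow> x \<in> topspace (level X n) \<Longrightarrow>
      act X l n (compose {..l} \<theta> \<phi>) x = act X l m \<phi> (act X m n \<theta> x)"
    unfolding contravariant_functor_def by blast+
  show ?thesis
    unfolding semi_simplicial_space_def contravariant_functor_def restrict_to_Delta_plus_def space_diagram.simps
  proof (intro conjI allI ballI)
    fix l m n \<phi> \<theta> x
    show "continuous_map (level X n) (level X m) (restrict (act X m n) (Delta_plus_hom m n) \<theta>)"
      if "\<theta> \<in> Delta_plus_hom m n"
      using X(1)[OF sub[OF that]] that by simp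
    show "restrict (act X n n) (Delta_plus_hom n n) (restrict id {..n}) x = x" if "x \<in> topspace (level X n)"
      using X(2)[OF that] Delta_plus_hom_id by simp
    show "restrict (act X l n) (Delta_plus_hom l n) (compose {..l} \<theta> \<phi>) x =
        restrict (act X l m) (Delta_plus_hom l m) \<phi> (restrict (act X m n) (Delta_plus_hom m n) \<theta> x)"
      if "\<phi> \<in> Delta_plus_hom l m" "\<theta> \<in> Delta_plus_hom m n" "x \<in> topspace (level X n)"
      using X(3)[OF sub[OF that(1)] sub[OF that(2)] that(3)] that(1,2) Delta_plus_hom_compose[OF that(1,2)] by simp
  qed
qed

lemma semi_simplicial_map_restrict:
  assumes "simplicial_map X Y f"
  shows "semi_simplicial_map (restrict_to_Delta_plus X) (restrict_to_Delta_plus Y) f"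
  unfolding semi_simplicial_map_def
proof (intro conjI semi_simplicial_space_restrict)
  show "simplicial_space X" "simplicial_space Y"
    using assms by (simp_all add: simplicial_map_def)
  have "natural_map Delta_hom X Y f"
    using assms by (simp add: simplicial_map_def)
  then show "natural_map Delta_plus_hom (restrict_to_Delta_plus X) (restrict_to_Delta_plus Y) f"
    unfolding natural_map_def restrict_to_Delta_plus_def Delta_plus_hom_def by simp
qed

theorem lemma1p2:
  fixes X :: "'a space_diagram" and Y :: "'b space_diagram" and f :: "nat \<Rightarrow> 'a \<Rightarrow> 'b"
  assumes "\<And>n. weak_homotopy_equivalence (level X n) (level Y n) (f n)"
  shows "(simplicial_map X Y f \<longrightarrow>
            weak_homotopy_equivalence
              (fat_realization (restrict_to_Delta_plus X))
              (fat_realization (restrict_to_Delta_plus Y))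
              (fat_realization_map (restrict_to_Delta_plus Y) f)) \<and>
         (semi_simplicial_map X Y f \<longrightarrow>
            weak_homotopy_equivalence
              (fat_realization X) (fat_realization Y) (fat_realization_map Y f))"
proof (intro conjI impI)
  have L: "lifting_equivalence (f n) (level X n) (level Y n)" for n
    by (rule lifting_equivalence_if_weak[OF assms])
  assume "semi_simplicial_map X Y f"
  then show "weak_homotopy_equivalence (fat_realization X) (fat_realization Y) (fat_realization_map Y f)"
    by (intro weak_if_lifting_equivalence lifting_equivalence_fat_realization_map L)
next
  have L: "lifting_equivalence (f n) (level (restrict_to_Delta_plus X) n) (level (restrict_to_Delta_plus Y) n)" for n
    using lifting_equivalence_if_weak[OF assms] by (simp add: restrict_to_Delta_plus_def)
  assume "simplicial_map X Y f"
  then show "weak_homotopy_equivalence (fat_realization (restrict_to_Delta_plus X))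
      (fat_realization (restrict_to_Delta_plus Y)) (fat_realization_map (restrict_to_Delta_plus Y) f)"
    by (intro weak_if_lifting_equivalence lifting_equivalence_fat_realization_map semi_simplicial_map_restrict L)
qed

end
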